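(* Let $\varepsilon>0$ be fixed and let $g:\mathbb{T}^1\to\mathbb{R}$ be a periodic function. If $\widetilde{\mathcal{A}}_{\varepsilon,g}$ is non-empty, then there exists $u_\varepsilon\in\widetilde{\mathcal{A}}_{\varepsilon,g}$ such that $$E_\varepsilon(u_\varepsilon)=\inf_{u\in\widetilde{\mathcal{A}}_{\varepsilon,g}}E_\varepsilon(u).$$
   Context: $\mathbb{T}^1=[0,1)$ and $\mathbb{T}^2=[0,1)^2$ are the flat tori with Lebesgue measure; functions are real valued and 1-periodic in each variable. For $u\in W^{1,2}(\mathbb{T}^2)$, $$E_\varepsilon(u)=\frac12\int_{\mathbb{T}^2}\frac1\varepsilon\left(\partial_2u-\frac12(\partial_1u)^2\right)^2+\varepsilon(\partial_{11}u)^2\,dx\in[0,\infty],$$ with $E_\varepsilon(u)=+\infty$ if the distribution $\partial_{11}u$ is not in $L^2(\mathbb{T}^2)$ or $\partial_2u-\frac12(\partial_1u)^2\notin L^2(\mathbb{T}^2)$. The admissible class is $$\widetilde{\mathcal{A}}_{\varepsilon,g}=\left\{u\in W^{1,2}(\mathbb{T}^2):\ E_\varepsilon(u)<\infty,\ \int_0^1u(x_1,x_2)\,dx_1=g(x_2)\text{ for a.e. }x_2\in[0,1)\right\}.$$ *)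

theory Defs
  imports "HOL-Analysis.Analysis"
begin

text \<open>
  Functions on the two-dimensional flat torus are represented by functions on the plane that are
  1-periodic in each variable, and integrals are taken over the fundamental domain. An element of
  \<open>L\<^sup>2\<close> is represented by a Borel function, which every almost-everywhere class contains; this keeps
  the slices used for the mean in the first variable measurable.
\<close>

definition periodic1 :: "(real \<Rightarrow> real) \<Rightarrow> bool" where
  "periodic1 g \<longleftrightarrow> (\<forall>t. g (t + 1) = g t)"

definition periodic2 :: "(real \<times> real \<Rightarrow> real) \<Rightarrow> bool" where
  "periodic2 u \<longleftrightarrow> (\<forall>s t. u (s + 1, t) = u (s, t) \<and> u (s, t + 1) = u (s, t))"

definition torus2 :: "(real \<times> real) set" where
  "torus2 = {0..<1} \<times> {0..<1}"

definition L2_torus :: "(real \<times> real \<Rightarrow> real) set" where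
  "L2_torus = {u. periodic2 u \<and> u \<in> borel_measurable borel
                  \<and> set_integrable lborel torus2 (\<lambda>x. (u x)\<^sup>2)}"

definition dir_deriv :: "real \<times> real \<Rightarrow> (real \<times> real \<Rightarrow> real) \<Rightarrow> real \<times> real \<Rightarrow> real" where
  "dir_deriv e \<phi> = (\<lambda>x. frechet_derivative \<phi> (at x) e)"

abbreviation e1 :: "real \<times> real" where "e1 \<equiv> (1, 0)"
abbreviation e2 :: "real \<times> real" where "e2 \<equiv> (0, 1)"

primrec C_k :: "nat \<Rightarrow> (real \<times> real \<Rightarrow> real) \<Rightarrow> bool" where
  "C_k 0 \<phi> \<longleftrightarrow> continuous_on UNIV \<phi>"
| "C_k (Suc k) \<phi> \<longleftrightarrow> (\<forall>x. \<phi> differentiable (at x))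
                       \<and> C_k k (dir_deriv e1 \<phi>) \<and> C_k k (dir_deriv e2 \<phi>)"

definition test_functions :: "(real \<times> real \<Rightarrow> real) set" where
  "test_functions = {\<phi>. periodic2 \<phi> \<and> (\<forall>k. C_k k \<phi>)}"

text \<open>The list \<open>es\<close> gives the directions of differentiation, so \<open>[e1, e1]\<close> stands for the second
  derivative in the first variable. The equation says that the distributional derivative of \<open>u\<close>
  on the torus is the function \<open>w\<close>.\<close>

definition has_weak_deriv ::
    "(real \<times> real) list \<Rightarrow> (real \<times> real \<Rightarrow> real) \<Rightarrow> (real \<times> real \<Rightarrow> real) \<Rightarrow> bool" where
  "has_weak_deriv es u w \<longleftrightarrow>
     (\<forall>\<phi>\<in>test_functions.
        (LINT x:torus2|lborel. u x * foldr dir_deriv es \<phi> x)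
          = (-1) ^ length es * (LINT x:torus2|lborel. w x * \<phi> x))"

definition weak_deriv_in_L2 :: "(real \<times> real) list \<Rightarrow> (real \<times> real \<Rightarrow> real) \<Rightarrow> bool" where
  "weak_deriv_in_L2 es u \<longleftrightarrow> (\<exists>w\<in>L2_torus. has_weak_deriv es u w)"

text \<open>A representative of the weak derivative; it is unique up to null sets, and meaningful only
  if \<open>weak_deriv_in_L2 es u\<close>.\<close>

definition weak_deriv ::
    "(real \<times> real) list \<Rightarrow> (real \<times> real \<Rightarrow> real) \<Rightarrow> real \<times> real \<Rightarrow> real" where
  "weak_deriv es u = (SOME w. w \<in> L2_torus \<and> has_weak_deriv es u w)"

definition W12_torus :: "(real \<times> real \<Rightarrow> real) set" where
  "W12_torus = {u \<in> L2_torus. weak_deriv_in_L2 [e1] u \<and> weak_deriv_in_L2 [e2] u}"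

definition burgers_term :: "(real \<times> real \<Rightarrow> real) \<Rightarrow> real \<times> real \<Rightarrow> real" where
  "burgers_term u = (\<lambda>x. weak_deriv [e2] u x - 1 / 2 * (weak_deriv [e1] u x)\<^sup>2)"

text \<open>Only intended for \<open>u \<in> W12_torus\<close>, where the first weak derivatives exist.\<close>

definition energy :: "real \<Rightarrow> (real \<times> real \<Rightarrow> real) \<Rightarrow> ennreal" where
  "energy \<epsilon> u =
     (if weak_deriv_in_L2 [e1, e1] u \<and> burgers_term u \<in> L2_torus
      then ennreal (1 / 2 * (LINT x:torus2|lborel.
             1 / \<epsilon> * (burgers_term u x)\<^sup>2 + \<epsilon> * (weak_deriv [e1, e1] u x)\<^sup>2))
      else \<infinity>)"

definition admissible :: "real \<Rightarrow> (real \<Rightarrow> real) \<Rightarrow> (real \<times> real \<Rightarrow> real) set" where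
  "admissible \<epsilon> g = {u \<in> W12_torus. energy \<epsilon> u < \<infinity> \<and>
     (AE x2 in lborel. x2 \<in> {0..<1} \<longrightarrow> (LINT x1:{0..<1}|lborel. u (x1, x2)) = g x2)}"

end

theory Submission
  imports Defs "HOL-Complex_Analysis.Great_Picard"
begin

text \<open>
  Direct method. Write \<open>w\<close>, \<open>p\<close>, \<open>h\<close> for the weak derivatives in the directions \<open>[e1]\<close>, \<open>[e2]\<close>, \<open>[e1, e1]\<close> and
  \<open>\<eta> = p - w\<^sup>2 / 2\<close> for the Burgers term. Convolution with trigonometric kernels commutes with weak derivatives,
  and \<open>w\<close> lies in \<open>L\<^sup>4\<close> because \<open>w\<^sup>2 = 2 (p - \<eta>)\<close>; hence a minimising sequence may be replaced by trigonometric
  polynomials, the constraint on the mean surviving in the limit.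

  For smooth \<open>u\<close> the integral of \<open>w\<^sup>2\<close> over a horizontal line changes in the second variable at the rate of
  minus twice the integral of \<open>h \<eta>\<close>, since \<open>w\<^sup>2 h\<close> is a derivative in the first variable. So \<open>w\<close> is bounded in
  \<open>L\<^sup>2\<close> on every line by the energy, which bounds \<open>w\<close> in \<open>L\<^sup>4\<close>, thus \<open>p\<close> in \<open>L\<^sup>2\<close>, and makes the sequence equicontinuous.
  By Arzela-Ascoli it converges uniformly, and \<open>\<integral>w\<^sup>2 = - \<integral>u h\<close>, applied to differences, upgrades this to strong convergence
  of \<open>w\<close>. The nonlinear term then passes to the limit, while \<open>p\<close> and \<open>h\<close>, which enter linearly, are made to
  converge strongly by passing to convex combinations; convexity and Fatou's lemma give lower semicontinuity.
\<close>

section \<open>Integration on the torus\<close>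

text \<open>The obstacle is the square in the Burgers term: it passes neither to weak limits nor to
  averages. So \<open>w\<close> must converge strongly along the sequence itself, while
  \<open>p\<close> and \<open>h\<close> come from averages, and these are formed for the tuple of
  \<open>u\<close>, \<open>w\<^sup>2\<close>, \<open>p\<close> and \<open>h\<close>: averaging
  \<open>w\<^sup>2\<close> as an entry of its own keeps the energy convex in the tuple. The identity
  for the integral of \<open>w\<^sup>2\<close> over a line differentiates \<open>w\<close> in the
  second variable, and nothing in the class controls that derivative; this is the reason for
  smoothing. Trigonometric polynomials are stable under products, derivatives and convolution, and
  claims about them reduce by induction to a single cosine. Smoothing does not respect the
  constraint. Each approximant is therefore paired with an admissible function close to it in L2,
  and the constraint is read off from the partner. The constraint has a second task: it fixes the
  mean over the torus, which the energy does not see and without which no uniform bound on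
  \<open>u\<close> could hold.\<close>

definition tor1 :: "real measure" where
  "tor1 = density lborel (indicator {0..<1})"

text \<open>Both measures are densities on the whole space rather than restrictions to a subspace:
  functions stay total, and measurability refers to \<open>borel\<close> throughout.\<close>

definition tor2 :: "(real \<times> real) measure" where
  "tor2 = density lborel (indicator torus2)"

lemma sets_tor1 [simp, measurable_cong]: "sets tor1 = sets borel"
  by (simp add: tor1_def)

lemma sets_tor2 [simp, measurable_cong]: "sets tor2 = sets borel"
  by (simp add: tor2_def)

lemma space_tor1 [simp]: "space tor1 = UNIV"
  by (simp add: tor1_def)

lemma space_tor2 [simp]: "space tor2 = UNIV"
  by (simp add: tor2_def)

lemma torus2_measurable [measurable]: "torus2 \<in> sets borel"
  unfolding torus2_def by (intro borel_Times) auto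

lemma emeasure_tor1 [simp]: "emeasure tor1 UNIV = 1"
  by (simp add: tor1_def emeasure_density)

lemma sigma_finite_tor1: "sigma_finite_measure tor1"
proof -
  interpret finite_measure tor1 by (rule finite_measureI) simp
  show ?thesis by (rule sigma_finite_measure_axioms)
qed

interpretation T1: finite_measure tor1
  by (rule finite_measureI) simp

lemma tor2_eq_prod: "tor2 = tor1 \<Otimes>\<^sub>M tor1"
proof -
  have "tor1 \<Otimes>\<^sub>M tor1 = density (lborel \<Otimes>\<^sub>M lborel) (\<lambda>(x,y). indicator {0..<1} x * indicator {0..<1} y :: ennreal)"
    unfolding tor1_def
    using sigma_finite_tor1 by (intro pair_measure_density) (auto simp: tor1_def lborel.sigma_finite_measure_axioms)
  also have "(\<lambda>(x,y). indicator {0..<1::real} x * indicator {0..<1::real} y :: ennreal) = indicator torus2"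
    by (auto simp: torus2_def indicator_def fun_eq_iff)
  finally show ?thesis by (simp add: tor2_def lborel_prod)
qed

lemma emeasure_tor2 [simp]: "emeasure tor2 UNIV = 1"
proof -
  have "emeasure (tor1 \<Otimes>\<^sub>M tor1) (UNIV \<times> UNIV) = 1"
    by (subst T1.emeasure_pair_measure_Times) auto
  thus ?thesis by (simp add: tor2_eq_prod)
qed

interpretation T2: finite_measure tor2
  by (rule finite_measureI) simp

interpretation TT: pair_sigma_finite tor1 tor1
  by standard

lemma measure_tor1 [simp]: "measure tor1 UNIV = 1"
  by (simp add: measure_def)

lemma measure_tor2 [simp]: "measure tor2 UNIV = 1"
  by (simp add: measure_def)

lemma set_integral_torus2:
  fixes f :: "real \<times> real \<Rightarrow> real"
  assumes [measurable]: "f \<in> borel_measurable borel"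
  shows "(LINT x:torus2|lborel. f x) = (\<integral>x. f x \<partial>tor2)"
  unfolding tor2_def set_lebesgue_integral_def
  by (subst integral_density[symmetric]) (auto simp: ennreal_indicator)

lemma set_integrable_torus2:
  fixes f :: "real \<times> real \<Rightarrow> real"
  assumes [measurable]: "f \<in> borel_measurable borel"
  shows "set_integrable lborel torus2 f \<longleftrightarrow> integrable tor2 f"
  unfolding tor2_def set_integrable_def
  by (subst integrable_density[symmetric]) (auto simp: ennreal_indicator)

lemma set_integral_tor1:
  fixes f :: "real \<Rightarrow> real"
  assumes [measurable]: "f \<in> borel_measurable borel"
  shows "(LINT x:{0..<1}|lborel. f x) = (\<integral>x. f x \<partial>tor1)"
  unfolding tor1_def set_lebesgue_integral_def
  by (subst integral_density[symmetric]) (auto simp: ennreal_indicator)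

lemma AE_tor1: "(AE x in tor1. P x) \<longleftrightarrow> (AE x in lborel. x \<in> {0..<1} \<longrightarrow> P x)"
  unfolding tor1_def by (subst AE_density) (auto simp: indicator_def)

lemma AE_tor2_torus: "AE x in tor2. x \<in> torus2"
  unfolding tor2_def by (subst AE_density) (auto simp: indicator_def)

lemma AE_tor1_unitI: "(\<And>x. 0 \<le> x \<Longrightarrow> x < 1 \<Longrightarrow> P x) \<Longrightarrow> AE x in tor1. P x"
  by (simp add: AE_tor1)

lemma AE_tor2_torusI: "(\<And>x. x \<in> torus2 \<Longrightarrow> P x) \<Longrightarrow> AE x in tor2. P x"
  using AE_tor2_torus by (rule eventually_mono)

lemma integrable_tor2_bounded:
  fixes f :: "real \<times> real \<Rightarrow> real"
  assumes "f \<in> borel_measurable borel" "\<And>x. x \<in> torus2 \<Longrightarrow> \<bar>f x\<bar> \<le> B"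
  shows "integrable tor2 f"
  using assms by (intro T2.integrable_const_bound[where B=B] AE_tor2_torusI) auto

lemma integrable_tor1_bounded:
  fixes f :: "real \<Rightarrow> real"
  assumes "f \<in> borel_measurable borel" "\<And>x. x \<in> {0..<1} \<Longrightarrow> \<bar>f x\<bar> \<le> B"
  shows "integrable tor1 f"
  using assms by (intro T1.integrable_const_bound[where B=B] AE_tor1_unitI) auto

lemma integrable_tor2_continuous:
  fixes f :: "real \<times> real \<Rightarrow> real"
  assumes "continuous_on UNIV f"
  shows "integrable tor2 f"
proof -
  have "compact (f ` ({0..1} \<times> {0..1}))"
    by (intro compact_continuous_image compact_Times) (auto intro: continuous_on_subset[OF assms])
  then obtain B where "\<And>x. x \<in> {0..1} \<times> {0..1} \<Longrightarrow> \<bar>f x\<bar> \<le> B"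
    by (fastforce simp: bounded_iff dest!: compact_imp_bounded)
  thus ?thesis
    by (intro integrable_tor2_bounded[where B=B] borel_measurable_continuous_onI assms)
       (auto simp: torus2_def)
qed

lemma integrable_tor1_continuous:
  fixes f :: "real \<Rightarrow> real"
  assumes "continuous_on UNIV f"
  shows "integrable tor1 f"
proof -
  have "compact (f ` {0..1})"
    by (intro compact_continuous_image) (auto intro: continuous_on_subset[OF assms])
  then obtain B where "\<And>x. x \<in> {0..1} \<Longrightarrow> \<bar>f x\<bar> \<le> B"
    by (fastforce simp: bounded_iff dest!: compact_imp_bounded)
  thus ?thesis
    by (intro integrable_tor1_bounded[where B=B] borel_measurable_continuous_onI assms) auto
qed

lemma integral_tor2_iterated1:
  fixes f :: "real \<times> real \<Rightarrow> real"
  assumes "integrable tor2 f"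
  shows "(\<integral>x. f x \<partial>tor2) = (\<integral>t. (\<integral>s. f (s, t) \<partial>tor1) \<partial>tor1)"
    and "integrable tor1 (\<lambda>t. \<integral>s. f (s, t) \<partial>tor1)"
    and "AE t in tor1. integrable tor1 (\<lambda>s. f (s, t))"
  using assms TT.integral_snd[of "\<lambda>s t. f (s, t)"] TT.integrable_snd[of "\<lambda>s t. f (s, t)"]
    TT.AE_integrable_snd[of "\<lambda>s t. f (s, t)"]
  by (auto simp: tor2_eq_prod case_prod_unfold)

lemma integral_tor2_iterated2:
  fixes f :: "real \<times> real \<Rightarrow> real"
  assumes "integrable tor2 f"
  shows "(\<integral>x. f x \<partial>tor2) = (\<integral>s. (\<integral>t. f (s, t) \<partial>tor1) \<partial>tor1)"
  using assms TT.integral_fst[of "\<lambda>s t. f (s, t)"]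
  by (auto simp: tor2_eq_prod case_prod_unfold)

lemma FTC_tor1_indicator:
  fixes F f :: "real \<Rightarrow> real"
  assumes "\<And>s. (F has_real_derivative f s) (at s)" "continuous_on UNIV f" "0 \<le> a" "a \<le> b" "b \<le> 1"
  shows "(\<integral>s. indicator {a..b} s * f s \<partial>tor1) = F b - F a"
proof -
  have [measurable]: "f \<in> borel_measurable borel"
    using assms by (intro borel_measurable_continuous_onI)
  have "(\<integral>s. indicator {a..b} s * f s \<partial>tor1) = (\<integral>s. indicator {0..<1} s * (indicator {a..b} s * f s) \<partial>lborel)"
    using set_integral_tor1[of "\<lambda>s. indicator {a..b} s * f s"]
    by (simp add: set_lebesgue_integral_def)
  also have "\<dots> = (\<integral>s. indicator {a..b} s *\<^sub>R f s \<partial>lborel)"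
  proof (rule integral_cong_AE)
    \<comment> \<open>For \<open>b = 1\<close> the closed interval exceeds \<open>{0..<1}\<close> by
      the point 1, a null set.\<close>
    have "AE s in lborel. s \<noteq> (1::real)" by (rule AE_lborel_singleton)
    thus "AE s in lborel. indicator {0..<1} s * (indicator {a..b} s * f s) = indicator {a..b} s *\<^sub>R f s"
      using assms by (auto simp: indicator_def elim!: eventually_mono)
  qed auto
  also have "\<dots> = F b - F a"
    by (rule integral_FTC_Icc) (use assms in \<open>auto intro: DERIV_subset has_field_derivative_at_within
          continuous_on_subset simp: has_real_derivative_iff_has_vector_derivative[symmetric]\<close>)
  finally show ?thesis .
qed

lemma FTC_tor1:
  fixes F f :: "real \<Rightarrow> real"
  assumes "\<And>s. (F has_real_derivative f s) (at s)" "continuous_on UNIV f"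
  shows "(\<integral>s. f s \<partial>tor1) = F 1 - F 0"
proof -
  have [measurable]: "f \<in> borel_measurable borel"
    using assms by (intro borel_measurable_continuous_onI)
  have "(\<integral>s. f s \<partial>tor1) = (\<integral>s. indicator {0..1} s * f s \<partial>tor1)"
    by (intro integral_cong_AE AE_tor1_unitI) auto
  thus ?thesis using FTC_tor1_indicator[OF assms, of 0 1] by simp
qed

section \<open>Trigonometric polynomials\<close>

text \<open>The free phase \<open>a\<close> absorbs the sines, so one kind of generator suffices:
  differentiation multiplies by a frequency and advances the phase by a quarter period, translation
  only changes the phase, and products split into two generators by the product-to-sum
  formula.\<close>

inductive_set trig :: "(real \<times> real \<Rightarrow> real) set" where
  trig_cos: "(\<lambda>x. cos (2 * pi * (of_int m * fst x + of_int n * snd x) + a)) \<in> trig"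
| trig_scale: "f \<in> trig \<Longrightarrow> (\<lambda>x. c * f x) \<in> trig"
| trig_add: "f \<in> trig \<Longrightarrow> g \<in> trig \<Longrightarrow> (\<lambda>x. f x + g x) \<in> trig"

lemma trig_const: "(\<lambda>x. c) \<in> trig"
  using trig_scale[OF trig_cos[of 0 0 0], of c] by simp

lemma trig_diff:
  assumes "f \<in> trig" "g \<in> trig"
  shows "(\<lambda>x. f x - g x) \<in> trig"
  using trig_add[OF assms(1) trig_scale[OF assms(2), of "-1"]] by simp

lemma trig_mult_cos:
  assumes "g \<in> trig"
  shows "(\<lambda>x. cos (2 * pi * (of_int m * fst x + of_int n * snd x) + a) * g x) \<in> trig"
  using assms
proof induction
  case (trig_cos m' n' b)
  have "(\<lambda>x. 1/2 * cos (2 * pi * (of_int (m-m') * fst x + of_int (n-n') * snd x) + (a-b))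
           + 1/2 * cos (2 * pi * (of_int (m+m') * fst x + of_int (n+n') * snd x) + (a+b))) \<in> trig"
    by (intro trig.intros)
  also have "(\<lambda>x. 1/2 * cos (2 * pi * (of_int (m-m') * fst x + of_int (n-n') * snd x) + (a-b))
           + 1/2 * cos (2 * pi * (of_int (m+m') * fst x + of_int (n+n') * snd x) + (a+b)))
     = (\<lambda>x. cos (2 * pi * (of_int m * fst x + of_int n * snd x) + a) * cos (2 * pi * (of_int m' * fst x + of_int n' * snd x) + b))"
    by (simp add: cos_times_cos algebra_simps add_divide_distrib)
  finally show ?case .
next
  case (trig_scale f c)
  thus ?case using trig.trig_scale[OF trig_scale.IH, of c] by (simp add: algebra_simps)
next
  case (trig_add f g)
  thus ?case using trig.trig_add[OF trig_add.IH] by (simp add: algebra_simps)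
qed

lemma trig_mult:
  assumes "f \<in> trig" "g \<in> trig"
  shows "(\<lambda>x. f x * g x) \<in> trig"
  using assms(1)
proof induction
  case (trig_cos m n a)
  show ?case by (rule trig_mult_cos[OF assms(2)])
next
  case (trig_scale f c)
  thus ?case using trig.trig_scale[OF trig_scale.IH, of c] by (simp add: algebra_simps)
next
  case (trig_add f h)
  thus ?case using trig.trig_add[OF trig_add.IH] by (simp add: algebra_simps)
qed

lemma trig_power: "f \<in> trig \<Longrightarrow> (\<lambda>x. f x ^ n) \<in> trig"
  by (induction n) (simp_all add: trig_const trig_mult)

lemma cos_shift: "cos (z + (a + pi / 2)) = - sin (z + a)" for z a :: real
  using cos_add[of "z + a" "pi / 2"] by (simp add: add.assoc)

lemma trig_has_derivative:
  assumes "f \<in> trig"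
  shows "\<exists>f1\<in>trig. \<exists>f2\<in>trig. \<forall>x. (f has_derivative (\<lambda>h. f1 x * fst h + f2 x * snd h)) (at x)"
  using assms
proof induction
  case (trig_cos m n a)
  let ?f = "\<lambda>x :: real \<times> real. cos (2 * pi * (of_int m * fst x + of_int n * snd x) + (a + pi/2))"
  have "((\<lambda>x. cos (2 * pi * (of_int m * fst x + of_int n * snd x) + a)) has_derivative
      (\<lambda>h. (2 * pi * of_int m * ?f x) * fst h + (2 * pi * of_int n * ?f x) * snd h)) (at x)" for x :: "real \<times> real"
    unfolding cos_shift by (auto intro!: derivative_eq_intros simp: algebra_simps)
  moreover have "(\<lambda>x. 2 * pi * of_int m * ?f x) \<in> trig" "(\<lambda>x. 2 * pi * of_int n * ?f x) \<in> trig"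
    by (intro trig.intros)+
  ultimately show ?case
    by (intro bexI[of _ "\<lambda>x. 2 * pi * of_int m * ?f x"] bexI[of _ "\<lambda>x. 2 * pi * of_int n * ?f x"] allI)
next
  case (trig_scale f c)
  then obtain f1 f2 where f: "f1 \<in> trig" "f2 \<in> trig"
      "\<And>x. (f has_derivative (\<lambda>h. f1 x * fst h + f2 x * snd h)) (at x)" by blast
  have "((\<lambda>x. c * f x) has_derivative (\<lambda>h. (c * f1 x) * fst h + (c * f2 x) * snd h)) (at x)" for x
    using has_derivative_mult_right[OF f(3), of c x] by (simp add: algebra_simps)
  with trig.trig_scale[OF f(1), of c] trig.trig_scale[OF f(2), of c] show ?case
    by (intro bexI[of _ "\<lambda>x. c * f1 x"] bexI[of _ "\<lambda>x. c * f2 x"] allI)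
next
  case (trig_add f g)
  then obtain f1 f2 g1 g2 where f: "f1 \<in> trig" "f2 \<in> trig"
      "\<And>x. (f has_derivative (\<lambda>h. f1 x * fst h + f2 x * snd h)) (at x)" 
     and g: "g1 \<in> trig" "g2 \<in> trig"
      "\<And>x. (g has_derivative (\<lambda>h. g1 x * fst h + g2 x * snd h)) (at x)" by blast
  have "((\<lambda>x. f x + g x) has_derivative (\<lambda>h. (f1 x + g1 x) * fst h + (f2 x + g2 x) * snd h)) (at x)" for x
    using has_derivative_add[OF f(3) g(3), of x] by (simp add: algebra_simps)
  with trig.trig_add[OF f(1) g(1)] trig.trig_add[OF f(2) g(2)] show ?case
    by (intro bexI[of _ "\<lambda>x. f1 x + g1 x"] bexI[of _ "\<lambda>x. f2 x + g2 x"] allI)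
qed

lemma dir_deriv_eqI: "(f has_derivative D) (at x) \<Longrightarrow> dir_deriv e f x = D e"
  unfolding dir_deriv_def by (metis frechet_derivative_at)

lemma trig_derivs:
  assumes "f \<in> trig"
  shows "dir_deriv e1 f \<in> trig" "dir_deriv e2 f \<in> trig"
    and "(f has_derivative (\<lambda>h. dir_deriv e1 f x * fst h + dir_deriv e2 f x * snd h)) (at x)"
proof -
  obtain f1 f2 where f: "f1 \<in> trig" "f2 \<in> trig"
      "\<And>x. (f has_derivative (\<lambda>h. f1 x * fst h + f2 x * snd h)) (at x)"
    using trig_has_derivative[OF assms] by blast
  have "dir_deriv e1 f = f1" "dir_deriv e2 f = f2"
    using dir_deriv_eqI[OF f(3)] by (auto simp: fun_eq_iff)
  with f show "dir_deriv e1 f \<in> trig" "dir_deriv e2 f \<in> trig"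
     "(f has_derivative (\<lambda>h. dir_deriv e1 f x * fst h + dir_deriv e2 f x * snd h)) (at x)" by auto
qed

lemma trig_differentiable: "f \<in> trig \<Longrightarrow> f differentiable (at x)"
  unfolding differentiable_def using trig_derivs(3) by blast

lemma trig_continuous: "f \<in> trig \<Longrightarrow> continuous_on S f"
  by (meson continuous_at_imp_continuous_on differentiable_imp_continuous_within trig_differentiable)

lemma trig_measurable: "f \<in> trig \<Longrightarrow> f \<in> borel_measurable borel"
  by (intro borel_measurable_continuous_onI trig_continuous)

lemma trig_integrable: "f \<in> trig \<Longrightarrow> integrable tor2 f"
  by (intro integrable_tor2_continuous trig_continuous)

lemma trig_periodic: "f \<in> trig \<Longrightarrow> periodic2 f"
proof (induction rule: trig.induct)
  case (trig_cos m n a)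
  have *: "cos (z + 2 * pi * of_int k + a) = cos (z + a)" for z and k :: int
  proof -
    have "cos (z + a + 2 * pi * of_int k) = cos (z + a)"
      by (simp only: cos_add[of "z + a"] cos_int_2pin sin_int_2pin mult_zero_right mult_1_right diff_zero)
    moreover have "z + 2 * pi * of_int k + a = z + a + 2 * pi * of_int k" by simp
    ultimately show ?thesis by (simp only:)
  qed
  have "2 * pi * (of_int m * (s + 1) + of_int n * t) = 2 * pi * (of_int m * s + of_int n * t) + 2 * pi * of_int m"
    "2 * pi * (of_int m * s + of_int n * (t + 1)) = 2 * pi * (of_int m * s + of_int n * t) + 2 * pi * of_int n" for s t
    by (simp_all add: algebra_simps)
  thus ?case by (simp add: periodic2_def *)
qed (auto simp: periodic2_def)

lemma trig_C_k: "f \<in> trig \<Longrightarrow> C_k k f"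
  by (induction k arbitrary: f) (auto simp: trig_continuous trig_differentiable trig_derivs)

lemma trig_test: "f \<in> trig \<Longrightarrow> f \<in> test_functions"
  by (auto simp: test_functions_def trig_C_k trig_periodic)

section \<open>Directional derivatives, line slices and integration by parts\<close>

lemma dir_deriv_scale:
  assumes "f differentiable (at x)"
  shows "dir_deriv e (\<lambda>x. c * f x) x = c * dir_deriv e f x"
proof -
  have "(f has_derivative frechet_derivative f (at x)) (at x)"
    using assms by (simp add: frechet_derivative_works)
  from dir_deriv_eqI[OF has_derivative_mult_right[OF this, of c], of e] show ?thesis
    by (simp add: dir_deriv_def)
qed

lemma dir_deriv_add:
  assumes "f differentiable (at x)" "g differentiable (at x)"
  shows "dir_deriv e (\<lambda>x. f x + g x) x = dir_deriv e f x + dir_deriv e g x"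
proof -
  have "(f has_derivative frechet_derivative f (at x)) (at x)" "(g has_derivative frechet_derivative g (at x)) (at x)"
    using assms by (simp_all add: frechet_derivative_works)
  from dir_deriv_eqI[OF has_derivative_add[OF this], of e] show ?thesis
    by (simp add: dir_deriv_def)
qed

lemma dir_deriv_mult:
  assumes "f differentiable (at x)" "g differentiable (at x)"
  shows "dir_deriv e (\<lambda>x. f x * g x) x = f x * dir_deriv e g x + dir_deriv e f x * g x"
proof -
  have "(f has_derivative frechet_derivative f (at x)) (at x)" "(g has_derivative frechet_derivative g (at x)) (at x)"
    using assms by (simp_all add: frechet_derivative_works)
  from dir_deriv_eqI[OF has_derivative_mult[OF this], of e] show ?thesis
    by (simp add: dir_deriv_def)
qed

lemma dir_deriv_cos:
  "dir_deriv e (\<lambda>x. cos (2 * pi * (of_int m * fst x + of_int n * snd x) + a))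
    = (\<lambda>x. (2 * pi * (of_int m * fst e + of_int n * snd e)) * cos (2 * pi * (of_int m * fst x + of_int n * snd x) + (a + pi / 2)))"
proof
  fix x :: "real \<times> real"
  have "((\<lambda>x. cos (2 * pi * (of_int m * fst x + of_int n * snd x) + a)) has_derivative
    (\<lambda>e. (2 * pi * (of_int m * fst e + of_int n * snd e)) * cos (2 * pi * (of_int m * fst x + of_int n * snd x) + (a + pi / 2)))) (at x)"
    unfolding cos_shift by (auto intro!: derivative_eq_intros simp: algebra_simps)
  from dir_deriv_eqI[OF this]
  show "dir_deriv e (\<lambda>x. cos (2 * pi * (of_int m * fst x + of_int n * snd x) + a)) x
    = (2 * pi * (of_int m * fst e + of_int n * snd e)) * cos (2 * pi * (of_int m * fst x + of_int n * snd x) + (a + pi / 2))" .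
qed

text \<open>On a cosine each derivative multiplies by a frequency and advances the phase, operations
  that commute; linearity does the rest. \<open>A_diff\<close> uses this to trade the
  second-variable derivative of \<open>W\<close> for the first-variable derivative of
  \<open>P\<close>.\<close>

lemma trig_mixed_partials:
  assumes "f \<in> trig"
  shows "dir_deriv e2 (dir_deriv e1 f) = dir_deriv e1 (dir_deriv e2 f)"
  using assms
proof induction
  case (trig_cos m n a)
  have scale: "dir_deriv e (\<lambda>x. c * cos (2 * pi * (of_int m * fst x + of_int n * snd x) + a)) = 
    (\<lambda>x. c * dir_deriv e (\<lambda>x. cos (2 * pi * (of_int m * fst x + of_int n * snd x) + a)) x)" for e c a
    by (intro ext dir_deriv_scale trig_differentiable trig.intros)
  show ?case by (simp only: dir_deriv_cos scale) (simp add: ac_simps)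
next
  case (trig_scale f c)
  have "dir_deriv e (\<lambda>x. c * f x) = (\<lambda>x. c * dir_deriv e f x)" if "f \<in> trig" for f e
    by (intro ext dir_deriv_scale trig_differentiable that)
  thus ?case using trig_scale by (simp add: trig_derivs)
next
  case (trig_add f g)
  have "dir_deriv e (\<lambda>x. f x + g x) = (\<lambda>x. dir_deriv e f x + dir_deriv e g x)" if "f \<in> trig" "g \<in> trig" for f g e
    by (intro ext dir_deriv_add trig_differentiable that)
  thus ?case using trig_add by (simp add: trig_derivs)
qed

lemma partial1:
  assumes "f differentiable (at (s, t))"
  shows "((\<lambda>s. f (s, t)) has_real_derivative dir_deriv e1 f (s, t)) (at s)"
proof -
  have f: "(f has_derivative frechet_derivative f (at (s, t))) (at (s, t))"
    using assms by (simp add: frechet_derivative_works)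
  have "((\<lambda>s. (s, t)) has_derivative (\<lambda>h. h *\<^sub>R e1)) (at s)"
    by (auto intro!: derivative_eq_intros)
  from has_derivative_compose[OF this f]
  have "((\<lambda>s. f (s, t)) has_derivative (\<lambda>h. frechet_derivative f (at (s, t)) (h *\<^sub>R e1))) (at s)" .
  moreover have "frechet_derivative f (at (s, t)) (h *\<^sub>R e1) = h * dir_deriv e1 f (s,t)" for h
    unfolding dir_deriv_def
    using linear_scale[OF has_derivative_linear[OF f], of h e1] by simp
  ultimately show ?thesis by (simp add: has_field_derivative_def mult.commute[of _ "dir_deriv e1 f (s,t)"])
qed

lemma partial2:
  assumes "f differentiable (at (s, t))"
  shows "((\<lambda>t. f (s, t)) has_real_derivative dir_deriv e2 f (s, t)) (at t)"
proof -
  have f: "(f has_derivative frechet_derivative f (at (s, t))) (at (s, t))"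
    using assms by (simp add: frechet_derivative_works)
  have "((\<lambda>t. (s, t)) has_derivative (\<lambda>h. h *\<^sub>R e2)) (at t)"
    by (auto intro!: derivative_eq_intros)
  from has_derivative_compose[OF this f]
  have "((\<lambda>t. f (s, t)) has_derivative (\<lambda>h. frechet_derivative f (at (s, t)) (h *\<^sub>R e2))) (at t)" .
  moreover have "frechet_derivative f (at (s, t)) (h *\<^sub>R e2) = h * dir_deriv e2 f (s,t)" for h
    unfolding dir_deriv_def
    using linear_scale[OF has_derivative_linear[OF f], of h e2] by simp
  ultimately show ?thesis by (simp add: has_field_derivative_def mult.commute[of _ "dir_deriv e2 f (s,t)"])
qed

lemma continuous_on_slice1: "continuous_on UNIV (f :: real \<times> real \<Rightarrow> real) \<Longrightarrow> continuous_on UNIV (\<lambda>s. f (s, t))"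
  by (rule continuous_on_compose2[where g=f]) (auto intro!: continuous_intros)

lemma continuous_on_slice2: "continuous_on UNIV (f :: real \<times> real \<Rightarrow> real) \<Longrightarrow> continuous_on UNIV (\<lambda>t. f (s, t))"
  by (rule continuous_on_compose2[where g=f]) (auto intro!: continuous_intros)

lemma periodic2_wrap:
  assumes "periodic2 f"
  shows "f (1, t) = f (0, t)" "f (s, 1) = f (s, 0)"
  using assms unfolding periodic2_def by (metis add_0)+

text \<open>Periodicity makes the boundary values at 0 and 1 cancel. The claim is made for each line
  separately because the energy estimate integrates over strips of heights, not over the whole
  torus.\<close>

lemma integral_dir_deriv1_zero:
  assumes "periodic2 f" "\<And>x. f differentiable (at x)" "continuous_on UNIV (dir_deriv e1 f)"
  shows "(\<integral>s. dir_deriv e1 f (s, t) \<partial>tor1) = 0"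
  using FTC_tor1[of "\<lambda>s. f (s, t)" "\<lambda>s. dir_deriv e1 f (s, t)", OF partial1[OF assms(2)] continuous_on_slice1[OF assms(3)]]
    periodic2_wrap[OF assms(1)]
  by simp

lemma integral_dir_deriv2_zero:
  assumes "periodic2 f" "\<And>x. f differentiable (at x)" "continuous_on UNIV (dir_deriv e2 f)"
  shows "(\<integral>t. dir_deriv e2 f (s, t) \<partial>tor1) = 0"
  using FTC_tor1[of "\<lambda>t. f (s, t)" "\<lambda>t. dir_deriv e2 f (s, t)", OF partial2[OF assms(2)] continuous_on_slice2[OF assms(3)]]
    periodic2_wrap[OF assms(1)]
  by simp

lemma integral_dir_deriv_zero:
  assumes "periodic2 f" "\<And>x. f differentiable (at x)" "continuous_on UNIV (dir_deriv e f)" "e \<in> {e1, e2}"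
  shows "(\<integral>x. dir_deriv e f x \<partial>tor2) = 0"
  using assms integral_tor2_iterated1(1)[OF integrable_tor2_continuous[OF assms(3)]] 
    integral_tor2_iterated2[OF integrable_tor2_continuous[OF assms(3)]]
    integral_dir_deriv1_zero[of f] integral_dir_deriv2_zero[of f]
  by auto

lemma test_functionsD:
  assumes "\<phi> \<in> test_functions"
  shows "periodic2 \<phi>" "\<phi> differentiable (at x)" "continuous_on UNIV \<phi>"
    and "e \<in> {e1, e2} \<Longrightarrow> continuous_on UNIV (dir_deriv e \<phi>)"
proof -
  have *: "C_k 0 \<phi>" "C_k 1 \<phi>" "periodic2 \<phi>" using assms by (auto simp: test_functions_def)
  thus "periodic2 \<phi>" "continuous_on UNIV \<phi>" by auto
  show "\<phi> differentiable (at x)" using *(2) unfolding One_nat_def C_k.simps by blast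
  show "e \<in> {e1, e2} \<Longrightarrow> continuous_on UNIV (dir_deriv e \<phi>)" using * by auto
qed

lemma test_function_deriv:
  assumes "\<phi> \<in> test_functions" "e \<in> {e1, e2}"
  shows "dir_deriv e \<phi> \<in> test_functions"
proof -
  have "C_k k (dir_deriv e \<phi>)" for k
    using assms C_k.simps(2)[of k \<phi>] by (auto simp: test_functions_def)
  moreover have "periodic2 (dir_deriv e \<phi>)"
  proof -
    \<comment> \<open>A period of \<open>\<phi>\<close> is a period of its derivative, by the chain
      rule for the translation.\<close>
    have shift: "dir_deriv e \<phi> (x + z) = dir_deriv e \<phi> x" if "\<And>x. \<phi> (x + z) = \<phi> x" for x z
    proof -
      have "(\<phi> has_derivative frechet_derivative \<phi> (at (x + z))) (at (x + z))"
        using test_functionsD(2)[OF assms(1)] by (simp add: frechet_derivative_works)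
      moreover have "((\<lambda>x. x + z) has_derivative (\<lambda>h. h)) (at x)"
        by (auto intro!: derivative_eq_intros)
      ultimately have "(\<phi> has_derivative frechet_derivative \<phi> (at (x + z))) (at x)"
        using has_derivative_compose[of "\<lambda>x. x + z" "\<lambda>h. h" x UNIV \<phi> "frechet_derivative \<phi> (at (x + z))"] that
        by simp
      from dir_deriv_eqI[OF this] show ?thesis by (simp add: dir_deriv_def)
    qed
    have "\<phi> (x + e1) = \<phi> x" "\<phi> (x + e2) = \<phi> x" for x
      using test_functionsD(1)[OF assms(1)] by (cases x; simp add: periodic2_def)+
    from shift[OF this(1)] shift[OF this(2)] show ?thesis
      by (auto simp: periodic2_def)
  qed
  ultimately show ?thesis by (simp add: test_functions_def)
qed

text \<open>The derivative of the product of \<open>f\<close> and \<open>\<phi>\<close> integrates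
  to zero over the torus.\<close>

lemma integration_by_parts_test:
  assumes "\<phi> \<in> test_functions" "f \<in> test_functions" "e \<in> {e1, e2}"
  shows "(\<integral>x. f x * dir_deriv e \<phi> x \<partial>tor2) = - (\<integral>x. dir_deriv e f x * \<phi> x \<partial>tor2)"
proof -
  have d: "dir_deriv e (\<lambda>x. f x * \<phi> x) = (\<lambda>x. f x * dir_deriv e \<phi> x + dir_deriv e f x * \<phi> x)"
    using assms by (intro ext dir_deriv_mult test_functionsD)
  have c: "continuous_on UNIV (\<lambda>x. f x * dir_deriv e \<phi> x)" "continuous_on UNIV (\<lambda>x. dir_deriv e f x * \<phi> x)"
    by (rule continuous_on_mult; use assms test_functionsD(3,4) in blast)+
  have "(\<integral>x. dir_deriv e (\<lambda>x. f x * \<phi> x) x \<partial>tor2) = 0"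
  proof (rule integral_dir_deriv_zero[OF _ _ _ assms(3)])
    show "periodic2 (\<lambda>x. f x * \<phi> x)"
      using test_functionsD(1)[OF assms(1)] test_functionsD(1)[OF assms(2)] by (simp add: periodic2_def)
    show "(\<lambda>x. f x * \<phi> x) differentiable at x" for x
      using assms by (intro differentiable_mult test_functionsD(2))
    show "continuous_on UNIV (dir_deriv e (\<lambda>x. f x * \<phi> x))"
      unfolding d by (intro continuous_on_add c)
  qed
  thus ?thesis unfolding d using c by (simp add: integrable_tor2_continuous)
qed

section \<open>Mollification\<close>

text \<open>The translate sits on the kernel, which will be a trigonometric polynomial. Translation
  and reflection thus have to be understood on \<open>trig\<close> alone, where they are changes of
  phase and of sign of the frequencies.\<close>

definition conv :: "(real \<times> real \<Rightarrow> real) \<Rightarrow> (real \<times> real \<Rightarrow> real) \<Rightarrow> real \<times> real \<Rightarrow> real" where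
  "conv K f x = (\<integral>y. f y * K (x - y) \<partial>tor2)"

lemma trig_bounded: "f \<in> trig \<Longrightarrow> \<exists>B. \<forall>x. \<bar>f x\<bar> \<le> B"
proof (induction rule: trig.induct)
  case (trig_cos m n a)
  show ?case by (intro exI[of _ 1]) simp
next
  case (trig_scale f c)
  then obtain B where "\<And>x. \<bar>f x\<bar> \<le> B" by blast
  thus ?case by (intro exI[of _ "\<bar>c\<bar> * B"]) (simp add: abs_mult mult_left_mono)
next
  case (trig_add f g)
  then obtain B C where "\<And>x. \<bar>f x\<bar> \<le> B" "\<And>x. \<bar>g x\<bar> \<le> C" by blast
  thus ?case by (intro exI[of _ "B + C"] allI order_trans[OF abs_triangle_ineq] add_mono) auto
qed

lemma trig_reflect: "f \<in> trig \<Longrightarrow> (\<lambda>y. f (x - y)) \<in> trig"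
proof (induction rule: trig.induct)
  case (trig_cos m n a)
  have "(\<lambda>y. cos (2 * pi * (of_int m * fst (x - y) + of_int n * snd (x - y)) + a)) =
     (\<lambda>y. cos (2 * pi * (of_int (- m) * fst y + of_int (- n) * snd y) + (2 * pi * (of_int m * fst x + of_int n * snd x) + a)))"
    by (intro ext arg_cong[where f=cos]) (simp add: algebra_simps)
  thus ?case using trig.trig_cos[of "-m" "-n" "2 * pi * (of_int m * fst x + of_int n * snd x) + a"] by (simp only:)
qed (auto intro: trig.intros)

lemma dir_deriv_reflect:
  assumes "\<And>x. f differentiable (at x)"
  shows "dir_deriv e (\<lambda>y. f (x - y)) y = - dir_deriv e f (x - y)"
proof -
  have f: "(f has_derivative frechet_derivative f (at (x - y))) (at (x - y))"
    using assms by (simp add: frechet_derivative_works)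
  have "((\<lambda>y. x - y) has_derivative (\<lambda>h. - h)) (at y)"
    by (auto intro!: derivative_eq_intros)
  from has_derivative_compose[OF this f]
  have "((\<lambda>y. f (x - y)) has_derivative (\<lambda>h. frechet_derivative f (at (x - y)) (- h))) (at y)" .
  from dir_deriv_eqI[OF this, of e] show ?thesis
    using linear_neg[OF has_derivative_linear[OF f], of e] by (simp add: dir_deriv_def)
qed

lemma integrable_mult_bounded:
  fixes f g :: "'a \<Rightarrow> real"
  assumes f: "integrable M f" and g: "g \<in> borel_measurable M" "\<And>x. \<bar>g x\<bar> \<le> B"
  shows "integrable M (\<lambda>x. f x * g x)"
proof (rule Bochner_Integration.integrable_bound)
  show "integrable M (\<lambda>x. B * f x)" using f by simp
  show "(\<lambda>x. f x * g x) \<in> borel_measurable M"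
    using f g by auto
  show "AE x in M. norm (f x * g x) \<le> norm (B * f x)"
    using g(2) by (intro AE_I2) (auto simp: abs_mult mult.commute[of B] intro!: mult_left_mono order_trans[OF g(2) abs_ge_self])
qed

lemma integrable_mult_trig:
  assumes "integrable tor2 f" "K \<in> trig"
  shows "integrable tor2 (\<lambda>y. f y * K y)"
proof -
  obtain B where "\<And>x. \<bar>K x\<bar> \<le> B" using trig_bounded[OF assms(2)] by blast
  thus ?thesis using assms trig_measurable[OF assms(2)] by (intro integrable_mult_bounded) auto
qed

lemma integrable_conv:
  assumes "integrable tor2 f" "K \<in> trig"
  shows "integrable tor2 (\<lambda>y. f y * K (x - y))"
  by (intro integrable_mult_trig trig_reflect assms)

text \<open>The addition theorem separates \<open>x\<close> from \<open>y\<close>, and the integral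
  over \<open>y\<close> leaves one cosine and one sine coefficient of \<open>f\<close>. Hence a
  trigonometric kernel turns every integrable \<open>f\<close> into a trigonometric polynomial, and
  derivatives of the convolution act on explicit cosines in \<open>x\<close>.\<close>

lemma conv_cos:
  assumes f: "integrable tor2 f"
  shows "conv (\<lambda>x. cos (2 * pi * (of_int m * fst x + of_int n * snd x) + a)) f =
    (\<lambda>x. (\<integral>y. f y * cos (2 * pi * (of_int m * fst y + of_int n * snd y)) \<partial>tor2) 
        * cos (2 * pi * (of_int m * fst x + of_int n * snd x) + a) +
       (\<integral>y. f y * sin (2 * pi * (of_int m * fst y + of_int n * snd y)) \<partial>tor2) 
        * cos (2 * pi * (of_int m * fst x + of_int n * snd x) + (a - pi / 2)))"
proof
  fix x :: "real \<times> real"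
  let ?\<theta> = "\<lambda>x :: real \<times> real. 2 * pi * (of_int m * fst x + of_int n * snd x)"
  have s: "cos (z + (a - pi / 2)) = sin (z + a)" for z
    using cos_shift[of z "a - pi / 2"] sin_cos_eq[of "z+a"] cos_minus[of "z + a - pi/2"] by (simp add: algebra_simps)
  have s0: "cos (z + (0 - pi / 2)) = sin z" for z
    using cos_shift[of z "0 - pi / 2"] sin_cos_eq[of "z"] cos_minus[of "z - pi/2"] by simp
  have t: "(\<lambda>x. cos (?\<theta> x)) \<in> trig" "(\<lambda>x. sin (?\<theta> x)) \<in> trig"
    using trig_cos[of m n 0] trig_cos[of m n "0 - pi/2"] unfolding s0 by simp_all
  have e: "cos (?\<theta> (x - y) + a) = cos (?\<theta> y) * cos (?\<theta> x + a) + sin (?\<theta> y) * cos (?\<theta> x + (a - pi / 2))" for y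
    using cos_diff[of "?\<theta> x + a" "?\<theta> y"] unfolding s by (simp add: algebra_simps)
  have "conv (\<lambda>x. cos (?\<theta> x + a)) f x = 
     (\<integral>y. (f y * cos (?\<theta> y)) * cos (?\<theta> x + a) + (f y * sin (?\<theta> y)) * cos (?\<theta> x + (a - pi / 2)) \<partial>tor2)"
    unfolding conv_def e by (intro Bochner_Integration.integral_cong refl) (simp only: distrib_left mult.assoc)
  also have "\<dots> = (\<integral>y. f y * cos (?\<theta> y) \<partial>tor2) * cos (?\<theta> x + a) + (\<integral>y. f y * sin (?\<theta> y) \<partial>tor2) * cos (?\<theta> x + (a - pi / 2))"
    using integrable_mult_trig[OF f t(1)] integrable_mult_trig[OF f t(2)]
    by (subst Bochner_Integration.integral_add) (auto simp only: integral_mult_left_zero intro!: integrable_mult_left)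
  finally show "conv (\<lambda>x. cos (?\<theta> x + a)) f x = \<dots>" .
qed

lemma conv_scale: "conv (\<lambda>x. c * K x) f = (\<lambda>x. c * conv K f x)"
  by (simp add: conv_def mult.left_commute[of _ c] fun_eq_iff)

lemma conv_add:
  "integrable tor2 f \<Longrightarrow> K \<in> trig \<Longrightarrow> L \<in> trig \<Longrightarrow> conv (\<lambda>x. K x + L x) f = (\<lambda>x. conv K f x + conv L f x)"
  by (simp add: conv_def distrib_left fun_eq_iff integrable_conv)

lemma trig_cos_sum: 
  "(\<lambda>x. A * cos (2 * pi * (of_int m * fst x + of_int n * snd x) + a)
      + B * cos (2 * pi * (of_int m * fst x + of_int n * snd x) + b)) \<in> trig"
  by (intro trig.intros)

lemma conv_trig:
  assumes "K \<in> trig" "integrable tor2 f"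
  shows "conv K f \<in> trig"
  using assms
proof induction
  case (trig_cos m n a)
  thus ?case by (simp only: conv_cos trig_cos_sum)
qed (simp_all add: conv_scale conv_add trig.intros)

lemma dir_deriv_scale_trig: "f \<in> trig \<Longrightarrow> dir_deriv e (\<lambda>x. c * f x) = (\<lambda>x. c * dir_deriv e f x)"
  by (intro ext dir_deriv_scale trig_differentiable)

lemma dir_deriv_add_trig:
  "f \<in> trig \<Longrightarrow> g \<in> trig \<Longrightarrow> dir_deriv e (\<lambda>x. f x + g x) = (\<lambda>x. dir_deriv e f x + dir_deriv e g x)"
  by (intro ext dir_deriv_add trig_differentiable)

lemma dir_deriv_conv:
  assumes "K \<in> trig" "integrable tor2 f" "e \<in> {e1, e2}"
  shows "dir_deriv e (conv K f) = conv (dir_deriv e K) f"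
  using assms
proof induction
  case (trig_cos m n a)
  \<comment> \<open>The phase of the sine part is shifted back by the convolution and forward by the
    derivative; the two sides of the claim do so in opposite orders.\<close>
  have *: "a - pi / 2 + pi / 2 = a + pi / 2 - pi / 2" for a :: real by simp
  show ?case
    by (simp only: conv_cos[OF trig_cos(1)] dir_deriv_cos conv_scale dir_deriv_add_trig dir_deriv_scale_trig trig.intros *)
       (simp add: algebra_simps)
next
  case (trig_scale K c)
  thus ?case by (simp add: conv_scale dir_deriv_scale_trig conv_trig)
next
  case (trig_add K L)
  have "dir_deriv e K \<in> trig" "dir_deriv e L \<in> trig" using trig_add.prems trig_add.hyps trig_derivs by auto
  thus ?case using trig_add by (simp add: conv_add dir_deriv_add_trig conv_trig)
qed

text \<open>The cosine multiplied by either of its frequencies is a derivative of a periodic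
  function, so a nonzero frequency forces the integral to vanish.\<close>

lemma integral_trig_cos:
  "(\<integral>x. cos (2 * pi * (of_int m * fst x + of_int n * snd x) + a) \<partial>tor2) = (if m = 0 \<and> n = 0 then cos a else 0)"
proof -
  have "2 * pi * (of_int m * fst e + of_int n * snd e) * (\<integral>x. cos (2 * pi * (of_int m * fst x + of_int n * snd x) + a) \<partial>tor2) = 0"
    if "e \<in> {e1, e2}" for e
  proof -
    let ?f = "\<lambda>x. cos (2 * pi * (of_int m * fst x + of_int n * snd x) + (a - pi / 2))"
    have t: "?f \<in> trig" by (rule trig_cos)
    hence "dir_deriv e ?f \<in> trig" using that trig_derivs by auto
    hence "(\<integral>x. dir_deriv e ?f x \<partial>tor2) = 0"
      using t that by (intro integral_dir_deriv_zero trig_periodic trig_differentiable trig_continuous)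
    thus ?thesis unfolding dir_deriv_cos by simp
  qed
  from this[of e1] this[of e2] show ?thesis by auto
qed

text \<open>Reflection and translation change the signs of the frequencies and the phase. The phase
  influences the integral only when both frequencies vanish, and in that case it is
  unchanged.\<close>

lemma integral_trig_reflect:
  assumes "K \<in> trig"
  shows "(\<integral>y. K (x - y) \<partial>tor2) = (\<integral>y. K y \<partial>tor2)"
  using assms
proof induction
  case (trig_cos m n a)
  have "(\<integral>y. cos (2 * pi * (of_int m * fst (x - y) + of_int n * snd (x - y)) + a) \<partial>tor2) =
     (\<integral>y. cos (2 * pi * (of_int (- m) * fst y + of_int (- n) * snd y) + (2 * pi * (of_int m * fst x + of_int n * snd x) + a)) \<partial>tor2)"
    by (intro Bochner_Integration.integral_cong refl arg_cong[where f=cos]) (simp add: algebra_simps)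
  also have "\<dots> = (\<integral>y. cos (2 * pi * (of_int m * fst y + of_int n * snd y) + a) \<partial>tor2)"
    unfolding integral_trig_cos by auto
  finally show ?case .
next
  case (trig_add f g)
  thus ?case by (simp add: trig_integrable trig_reflect)
qed simp

lemma integral_conv:
  assumes "K \<in> trig" "integrable tor2 f"
  shows "(\<integral>x. conv K f x \<partial>tor2) = (\<integral>x. K x \<partial>tor2) * (\<integral>x. f x \<partial>tor2)"
  using assms
proof induction
  case (trig_cos m n a)
  have "integrable tor2 (\<lambda>x. A * cos (2 * pi * (of_int m * fst x + of_int n * snd x) + a))" for A a
    by (intro trig_integrable trig.intros)
  thus ?case by (auto simp: conv_cos[OF trig_cos(1)] integral_trig_cos simp del: integrable_mult_left_iff)
next
  case (trig_scale f c)
  thus ?case by (simp add: conv_scale)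
next
  case (trig_add f g)
  thus ?case by (simp add: conv_add conv_trig trig_integrable distrib_right)
qed

text \<open>As a function of \<open>y\<close>, \<open>K (x - y)\<close> is itself a test function;
  the sign of the inner derivative cancels the sign in the definition of the weak derivative.
  Together with \<open>dir_deriv_conv\<close> this says that mollification commutes with weak
  derivatives.\<close>

lemma conv_weak_deriv:
  assumes K: "K \<in> trig" and f: "f \<in> borel_measurable borel" and w: "w \<in> borel_measurable borel"
    and d: "has_weak_deriv [e] f w" "e \<in> {e1, e2}"
  shows "conv (dir_deriv e K) f = conv K w"
proof
  fix x
  let ?\<phi> = "\<lambda>y. K (x - y)"
  have \<phi>: "?\<phi> \<in> trig" "dir_deriv e ?\<phi> \<in> trig" using trig_reflect[OF K, of x] trig_derivs(1,2)[of ?\<phi>] d(2) by auto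
  have [measurable]: "?\<phi> \<in> borel_measurable borel" "dir_deriv e ?\<phi> \<in> borel_measurable borel"
    using \<phi> trig_measurable by auto
  have eq: "dir_deriv e ?\<phi> y = - dir_deriv e K (x - y)" for y
    by (intro dir_deriv_reflect trig_differentiable K)
  have "(LINT x:torus2|lborel. f x * dir_deriv e ?\<phi> x) = - (LINT x:torus2|lborel. w x * ?\<phi> x)"
    using d(1) trig_test[OF \<phi>(1)] by (auto simp: has_weak_deriv_def)
  hence "(\<integral>y. f y * dir_deriv e ?\<phi> y \<partial>tor2) = - (\<integral>y. w y * ?\<phi> y \<partial>tor2)"
    using f w by (subst (asm) (1 2) set_integral_torus2) auto
  thus "conv (dir_deriv e K) f x = conv K w x"
    by (simp add: eq conv_def)
qed

text \<open>Two reflections produce two signs, and the weak second derivative carries none. The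
  derivative is moved in one go because membership in the class concerns \<open>[e1, e1]\<close> as
  a whole.\<close>

lemma conv_weak_deriv2:
  assumes K: "K \<in> trig" and f: "f \<in> borel_measurable borel" and w: "w \<in> borel_measurable borel"
    and d: "has_weak_deriv [e1, e1] f w"
  shows "conv (dir_deriv e1 (dir_deriv e1 K)) f = conv K w"
proof
  fix x
  let ?\<phi> = "\<lambda>y. K (x - y)"
  have \<phi>: "?\<phi> \<in> trig" "dir_deriv e1 ?\<phi> \<in> trig" "dir_deriv e1 (dir_deriv e1 ?\<phi>) \<in> trig"
    using trig_reflect[OF K, of x] trig_derivs(1)[of ?\<phi>] trig_derivs(1)[of "dir_deriv e1 ?\<phi>"] by auto
  have [measurable]: "?\<phi> \<in> borel_measurable borel" "dir_deriv e1 (dir_deriv e1 ?\<phi>) \<in> borel_measurable borel"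
    using \<phi> trig_measurable by auto
  have "dir_deriv e1 ?\<phi> = (\<lambda>y. - 1 * dir_deriv e1 K (x - y))"
    by (intro ext) (simp add: dir_deriv_reflect trig_differentiable K)
  hence eq: "dir_deriv e1 (dir_deriv e1 ?\<phi>) = (\<lambda>y. dir_deriv e1 (dir_deriv e1 K) (x - y))"
    by (simp only: dir_deriv_scale_trig trig_reflect trig_derivs(1) K)
       (intro ext, simp add: dir_deriv_reflect trig_differentiable trig_derivs(1) K)
  have "(LINT x:torus2|lborel. f x * dir_deriv e1 (dir_deriv e1 ?\<phi>) x) = (LINT x:torus2|lborel. w x * ?\<phi> x)"
    using d trig_test[OF \<phi>(1)] by (auto simp: has_weak_deriv_def)
  hence "(\<integral>y. f y * dir_deriv e1 (dir_deriv e1 ?\<phi>) y \<partial>tor2) = (\<integral>y. w y * ?\<phi> y \<partial>tor2)"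
    using f w by (subst (asm) (1 2) set_integral_torus2) auto
  thus "conv (dir_deriv e1 (dir_deriv e1 K)) f x = conv K w x"
    by (simp only: eq conv_def)
qed

section \<open>Averaging kernels and Jensen's inequality\<close>

definition averaging_kernel :: "(real \<times> real \<Rightarrow> real) \<Rightarrow> bool" where
  "averaging_kernel K \<longleftrightarrow> K \<in> trig \<and> (\<forall>x. 0 \<le> K x) \<and> (\<integral>x. K x \<partial>tor2) = 1"

text \<open>Convexity of the power as a tangent inequality. Exponent 2 serves the terms of the
  energy, exponent 4 serves \<open>w\<close>, whose square enters the Burgers term. For exponent 4
  the difference of the two sides factors as
  \<open>(t - s)\<^sup>2 * ((t + s)\<^sup>2 + 2 * s\<^sup>2)\<close>.\<close>

lemma power_tangent:
  fixes s t :: real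
  assumes "q \<in> {2, 4::nat}"
  shows "t ^ q \<ge> s ^ q + q * s ^ (q - 1) * (t - s)"
proof -
  have "0 \<le> (t - s)\<^sup>2" "0 \<le> (t - s)\<^sup>2 * ((t + s)\<^sup>2 + 2 * s\<^sup>2)" by simp_all
  thus ?thesis using assms by (auto simp: power2_eq_square power4_eq_xxxx power3_eq_cube algebra_simps)
qed

lemma abs_le_even_power:
  fixes t :: real
  assumes "q \<in> {2, 4::nat}"
  shows "\<bar>t\<bar> \<le> 1 + t ^ q"
  using assms power_tangent[OF assms, of 1 "\<bar>t\<bar>"] zero_le_power2[of "t\<^sup>2"]
  by (cases "\<bar>t\<bar> \<le> 1") (auto simp: power4_eq_xxxx power2_eq_square mult.assoc)

lemma integrable_even_power:
  fixes f :: "real \<times> real \<Rightarrow> real"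
  assumes [measurable]: "f \<in> borel_measurable borel" and "integrable tor2 (\<lambda>x. f x ^ q)" "q \<in> {2, 4::nat}"
  shows "integrable tor2 f"
proof (rule Bochner_Integration.integrable_bound)
  show "integrable tor2 (\<lambda>x. 1 + f x ^ q)" using assms by simp
  show "AE x in tor2. norm (f x) \<le> norm (1 + f x ^ q)"
    using order_trans[OF abs_le_even_power[OF assms(3)] abs_ge_self] by simp
qed simp

text \<open>For fixed \<open>x\<close> the weight \<open>K (x - y)\<close> is a probability density
  in \<open>y\<close>, and \<open>conv K f x\<close> is the mean of \<open>f\<close> under it. The
  tangent to the power at this mean is integrated against the weight; its linear term drops
  out.\<close>

lemma conv_Jensen:
  assumes K: "averaging_kernel K" and f: "f \<in> borel_measurable borel" "integrable tor2 (\<lambda>x. f x ^ q)" and q: "q \<in> {2, 4::nat}"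
  shows "conv K f x ^ q \<le> conv K (\<lambda>y. f y ^ q) x"
proof -
  have K': "K \<in> trig" "\<And>x. 0 \<le> K x" using K by (auto simp: averaging_kernel_def)
  have one: "(\<integral>y. K (x - y) \<partial>tor2) = 1" "integrable tor2 (\<lambda>y. K (x - y))"
    using integral_trig_reflect[OF K'(1)] K trig_integrable[OF trig_reflect[OF K'(1)]] by (auto simp: averaging_kernel_def)
  have fi: "integrable tor2 (\<lambda>y. f y * K (x - y))" "integrable tor2 (\<lambda>y. f y ^ q * K (x - y))"
    using integrable_even_power[OF f q] f by (auto intro!: integrable_conv K')
  let ?m = "conv K f x" 
  let ?c = "q * ?m ^ (q - 1)"
  have "?m ^ q = (\<integral>y. ?m ^ q * K (x - y) + (?c * (f y * K (x - y)) - ?c * ?m * K (x - y)) \<partial>tor2)"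
    using fi one by (simp add: conv_def)
  also have "\<dots> \<le> (\<integral>y. f y ^ q * K (x - y) \<partial>tor2)"
  proof (intro integral_mono fi Bochner_Integration.integrable_add Bochner_Integration.integrable_diff integrable_mult_right one)
    fix y
    have "(?m ^ q + ?c * (f y - ?m)) * K (x - y) \<le> f y ^ q * K (x - y)"
      by (intro mult_right_mono power_tangent q K')
    thus "?m ^ q * K (x - y) + (?c * (f y * K (x - y)) - ?c * ?m * K (x - y)) \<le> f y ^ q * K (x - y)"
      by (simp add: algebra_simps)
  qed
  finally show ?thesis by (simp add: conv_def)
qed

text \<open>Jensen's inequality pointwise, after which the unit mass of \<open>K\<close> preserves
  the integral of \<open>f ^ q\<close>. This contraction makes the error of replacing
  \<open>f\<close> by a continuous function uniform in the kernel.\<close>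

lemma conv_Lq_le:
  assumes K: "averaging_kernel K" and f: "f \<in> borel_measurable borel" "integrable tor2 (\<lambda>x. f x ^ q)" and q: "q \<in> {2, 4::nat}"
  shows "(\<integral>x. conv K f x ^ q \<partial>tor2) \<le> (\<integral>x. f x ^ q \<partial>tor2)"
proof -
  have K': "K \<in> trig" "(\<integral>x. K x \<partial>tor2) = 1" using K by (auto simp: averaging_kernel_def)
  have "(\<integral>x. conv K f x ^ q \<partial>tor2) \<le> (\<integral>x. conv K (\<lambda>y. f y ^ q) x \<partial>tor2)"
    using trig_integrable[OF trig_power[OF conv_trig[OF K'(1) integrable_even_power[OF f q]], of q]]
      trig_integrable[OF conv_trig[OF K'(1) f(2)]]
    by (intro integral_mono conv_Jensen[OF K f q])
  also have "\<dots> = (\<integral>x. f x ^ q \<partial>tor2)"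
    using integral_conv[OF K'(1) f(2)] K'(2) by simp
  finally show ?thesis .
qed

text \<open>One constant for both exponents: 2 would do for squares and 8 for fourth powers.\<close>

lemma power_add_le:
  fixes a b :: real
  assumes "q \<in> {2, 4::nat}"
  shows "(a + b) ^ q \<le> 16 * (a ^ q + b ^ q)"
proof -
  have sq: "(a + b)\<^sup>2 \<le> 2 * (a\<^sup>2 + b\<^sup>2)" for a b :: real
    using zero_le_power2[of "a - b"] by (simp add: power2_eq_square algebra_simps)
  have "((a + b)\<^sup>2)\<^sup>2 \<le> (2 * (a\<^sup>2 + b\<^sup>2))\<^sup>2"
    by (intro power_mono sq) auto
  also have "\<dots> \<le> 8 * ((a\<^sup>2)\<^sup>2 + (b\<^sup>2)\<^sup>2)"
    using sq[of "a\<^sup>2" "b\<^sup>2"] unfolding power_mult_distrib by simp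
  finally have "(a + b) ^ 4 \<le> 8 * (a ^ 4 + b ^ 4)"
    by (simp flip: power_mult)
  moreover have "(a + b)\<^sup>2 \<le> 16 * (a\<^sup>2 + b\<^sup>2)"
    by (rule order_trans[OF sq]) (auto intro!: mult_right_mono)
  moreover have "0 \<le> a ^ 4" "0 \<le> b ^ 4" by auto
  ultimately show ?thesis using assms by (auto intro: order_trans)
qed

section \<open>Density of bounded continuous functions\<close>

definition trunc :: "real \<Rightarrow> real \<Rightarrow> real" where
  "trunc M x = max (- M) (min M x)"

lemma continuous_on_trunc: "continuous_on UNIV (trunc M)"
  unfolding trunc_def by (intro continuous_intros)

lemma trunc_measurable [measurable]: "trunc M \<in> borel_measurable borel"
  by (intro borel_measurable_continuous_onI continuous_on_trunc)

lemma abs_trunc_le: "0 \<le> M \<Longrightarrow> \<bar>trunc M x\<bar> \<le> M"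
  by (auto simp: trunc_def)

lemma trunc_tendsto: "(\<lambda>n. trunc (real n) x) \<longlonglongrightarrow> x"
proof (rule tendsto_eventually)
  obtain N where "\<bar>x\<bar> \<le> real N" using real_arch_simple by blast
  thus "\<forall>\<^sub>F n in sequentially. trunc (real n) x = x"
    by (intro eventually_sequentiallyI[of N]) (auto simp: trunc_def)
qed

lemma even_power_mono_abs:
  fixes a b :: real
  assumes "\<bar>a\<bar> \<le> \<bar>b\<bar>" "even q"
  shows "a ^ q \<le> b ^ q"
  using power_mono[OF assms(1), of q] assms(2) by (simp add: power_even_abs)

lemma AE_tor2_lborel: "AE x in lborel. P x \<Longrightarrow> AE x in tor2. P x"
  unfolding tor2_def by (subst AE_density) (auto elim: eventually_mono)

lemma AE_tor2_negligible:
  assumes "negligible N"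
  shows "AE x in tor2. x \<notin> N"
proof -
  have "AE x in lebesgue. x \<notin> N"
    using assms by (intro AE_not_in) (simp add: negligible_iff_null_sets)
  hence "AE x in lborel. x \<notin> N" by (simp only: AE_completion_iff)
  thus ?thesis by (rule AE_tor2_lborel)
qed

text \<open>\<open>f\<close> is truncated, the bounded result is approximated almost everywhere by
  continuous functions, and these are truncated at the same level. Both errors vanish by dominated
  convergence, with majorant \<open>f ^ q\<close> in the first case and a constant in the
  second.\<close>

lemma Lq_continuous_dense:
  fixes f :: "real \<times> real \<Rightarrow> real"
  assumes f [measurable]: "f \<in> borel_measurable borel" and fi: "integrable tor2 (\<lambda>x. f x ^ q)"
    and q: "q \<in> {2, 4::nat}" and d: "\<delta> > 0"
  shows "\<exists>g B. continuous_on UNIV g \<and> (\<forall>x. \<bar>g x\<bar> \<le> B) \<and> (\<integral>x. (f x - g x) ^ q \<partial>tor2) < \<delta>"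
proof -
  have ev: "even q" and q0: "q > 0" using q by auto
  have "(\<lambda>n. \<integral>x. (f x - trunc (real n) (f x)) ^ q \<partial>tor2) \<longlonglongrightarrow> (\<integral>x. 0 \<partial>tor2)"
  proof (rule integral_dominated_convergence[where w="\<lambda>x. f x ^ q"])
    show "AE x in tor2. (\<lambda>n. (f x - trunc (real n) (f x)) ^ q) \<longlonglongrightarrow> 0"
    proof (rule AE_I2)
      fix x
      have "(\<lambda>n. (f x - trunc (real n) (f x)) ^ q) \<longlonglongrightarrow> (f x - f x) ^ q"
        by (intro tendsto_intros trunc_tendsto)
      thus "(\<lambda>n. (f x - trunc (real n) (f x)) ^ q) \<longlonglongrightarrow> 0" by (simp only: diff_self zero_power[OF q0])
    qed
    show "AE x in tor2. norm ((f x - trunc (real n) (f x)) ^ q) \<le> f x ^ q" for n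
      using ev by (intro AE_I2) (auto simp: zero_le_even_power trunc_def intro!: even_power_mono_abs)
  qed (use fi in auto)
  \<comment> \<open>Two errors of this size, multiplied by the factor 16 of
    \<open>power_add_le\<close>, stay below \<open>\<delta>\<close>.\<close>
  hence "\<forall>\<^sub>F n in sequentially. (\<integral>x. (f x - trunc (real n) (f x)) ^ q \<partial>tor2) < \<delta> / 32"
    using d by (intro order_tendstoD) auto
  then obtain n where n: "(\<integral>x. (f x - trunc (real n) (f x)) ^ q \<partial>tor2) < \<delta> / 32"
    by (auto simp: eventually_sequentially)
  let ?h = "\<lambda>x. trunc (real n) (f x)"
  \<comment> \<open>\<open>measurable_on\<close> provides continuous functions that converge to
    \<open>?h\<close> off a negligible set; these are the source of the approximants.\<close>
  have "?h measurable_on UNIV"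
    by (rule lebesgue_measurable_imp_measurable_on) (auto intro: measurable_completion)
  then obtain N g where N: "negligible N" and g: "\<And>k. continuous_on UNIV (g k)"
      and lim: "\<And>x. x \<notin> N \<Longrightarrow> (\<lambda>k. g k x) \<longlonglongrightarrow> ?h x"
    unfolding measurable_on_def by auto
  let ?G = "\<lambda>k x. trunc (real n) (g k x)"
  have Gc: "continuous_on UNIV (?G k)" for k
    using continuous_on_compose2[OF continuous_on_trunc g[of k]] by auto
  have [measurable]: "?G k \<in> borel_measurable borel" for k
    by (intro borel_measurable_continuous_onI Gc)
  have bnd: "\<bar>?h x - ?G k x\<bar> \<le> 2 * real n" for k x
    using abs_trunc_le[of "real n" "f x"] abs_trunc_le[of "real n" "g k x"] by linarith
  have bndq: "\<bar>(?h x - ?G k x) ^ q\<bar> \<le> (2 * real n) ^ q" for k x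
    unfolding power_abs by (intro power_mono bnd) simp
  have "(\<lambda>k. \<integral>x. (?h x - ?G k x) ^ q \<partial>tor2) \<longlonglongrightarrow> (\<integral>x. 0 \<partial>tor2)"
  proof (rule integral_dominated_convergence[where w="\<lambda>x. (2 * real n) ^ q"])
    show "AE x in tor2. (\<lambda>k. (?h x - ?G k x) ^ q) \<longlonglongrightarrow> 0"
      using AE_tor2_negligible[OF N]
    proof (rule eventually_mono)
      fix x assume x: "x \<notin> N"
      have "(\<lambda>k. (?h x - ?G k x) ^ q) \<longlonglongrightarrow> (?h x - trunc (real n) (?h x)) ^ q"
        using continuous_on_tendsto_compose[OF continuous_on_trunc lim[OF x]] by (intro tendsto_intros) auto
      moreover have "trunc (real n) (?h x) = ?h x" by (simp add: trunc_def)
      ultimately show "(\<lambda>k. (?h x - ?G k x) ^ q) \<longlonglongrightarrow> 0" by (simp only: diff_self zero_power[OF q0])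
    qed
    show "AE x in tor2. norm ((?h x - ?G k x) ^ q) \<le> (2 * real n) ^ q" for k
      unfolding real_norm_def by (intro AE_I2 bndq)
  qed auto
  hence "\<forall>\<^sub>F k in sequentially. (\<integral>x. (?h x - ?G k x) ^ q \<partial>tor2) < \<delta> / 32"
    using d by (intro order_tendstoD) auto
  then obtain k where k: "(\<integral>x. (?h x - ?G k x) ^ q \<partial>tor2) < \<delta> / 32"
    by (auto simp: eventually_sequentially)
  have i1: "integrable tor2 (\<lambda>x. (f x - ?h x) ^ q)"
    using ev by (intro Bochner_Integration.integrable_bound[OF fi])
      (auto simp: zero_le_even_power trunc_def intro!: AE_I2 even_power_mono_abs)
  have i2: "integrable tor2 (\<lambda>x. (?h x - ?G k x) ^ q)"
    by (intro integrable_tor2_bounded[where B="(2 * real n) ^ q"] bndq) measurable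
  have le: "(f x - ?G k x) ^ q \<le> 16 * ((f x - ?h x) ^ q + (?h x - ?G k x) ^ q)" for x
    using power_add_le[OF q, of "f x - ?h x" "?h x - ?G k x"] by simp
  have i3: "integrable tor2 (\<lambda>x. (f x - ?G k x) ^ q)"
    by (rule Bochner_Integration.integrable_bound[where f="\<lambda>x. 16 * ((f x - ?h x) ^ q + (?h x - ?G k x) ^ q)"])
       (use i1 i2 le ev in \<open>auto simp: zero_le_even_power intro!: AE_I2 order_trans[OF le abs_ge_self]\<close>)
  have "(\<integral>x. (f x - ?G k x) ^ q \<partial>tor2) \<le> (\<integral>x. 16 * ((f x - ?h x) ^ q + (?h x - ?G k x) ^ q) \<partial>tor2)"
    using i1 i2 i3 le by (intro integral_mono) auto
  also have "\<dots> = 16 * ((\<integral>x. (f x - ?h x) ^ q \<partial>tor2) + (\<integral>x. (?h x - ?G k x) ^ q \<partial>tor2))"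
    using i1 i2 by simp
  also have "\<dots> < \<delta>" using n k by simp
  finally show ?thesis
    using Gc[of k] abs_trunc_le[of "real n"]
    by (intro exI[of _ "?G k"] exI[of _ "real n"]) auto
qed

text \<open>The powers of \<open>peak\<close>, suitably normalised, concentrate at the lattice points, where \<open>peak\<close> attains its maximum 1.\<close>

definition peak :: "real \<times> real \<Rightarrow> real" where
  "peak x = (2 + cos (2 * pi * fst x) + cos (2 * pi * snd x)) / 4"

lemma peak_trig: "peak \<in> trig"
proof -
  have "(\<lambda>x. 1/2 + 1/4 * cos (2 * pi * (of_int 1 * fst x + of_int 0 * snd x) + 0) + 
      1/4 * cos (2 * pi * (of_int 0 * fst x + of_int 1 * snd x) + 0)) \<in> trig"
    by (intro trig.intros trig_const)
  also have "(\<lambda>x. 1/2 + 1/4 * cos (2 * pi * (of_int 1 * fst x + of_int 0 * snd x) + 0) + 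
      1/4 * cos (2 * pi * (of_int 0 * fst x + of_int 1 * snd x) + 0)) = peak"
    by (auto simp: peak_def fun_eq_iff add_divide_distrib)
  finally show ?thesis .
qed

lemma peak_nonneg: "0 \<le> peak x"
proof -
  have "0 \<le> (2 + a + b) / 4" if "- 1 \<le> a" "- 1 \<le> b" for a b :: real
    using that by simp
  thus ?thesis unfolding peak_def by (metis cos_ge_minus_one)
qed

lemma peak_le_1: "peak x \<le> 1"
proof -
  have "(2 + a + b) / 4 \<le> 1" if "a \<le> 1" "b \<le> 1" for a b :: real
    using that by simp
  thus ?thesis unfolding peak_def by (metis cos_le_one)
qed

text \<open>Both cosines equal 1 only at lattice points, and the open square of side 2 around the
  origin contains no lattice point but 0.\<close>

lemma peak_less_1:
  assumes "\<bar>fst x\<bar> < 1" "\<bar>snd x\<bar> < 1" "x \<noteq> 0"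
  shows "peak x < 1"
proof (rule ccontr)
  assume "\<not> peak x < 1"
  hence "cos (2 * pi * fst x) + cos (2 * pi * snd x) \<ge> 2"
    by (simp add: peak_def not_less)
  hence "cos (2 * pi * fst x) = 1 \<and> cos (2 * pi * snd x) = 1"
    using cos_le_one[of "2 * pi * fst x"] cos_le_one[of "2 * pi * snd x"] by linarith
  then obtain m n :: int where "2 * pi * fst x = of_int m * 2 * pi" "2 * pi * snd x = of_int n * 2 * pi"
    by (auto simp: cos_one_2pi_int)
  hence mn: "fst x = of_int m" "snd x = of_int n" by auto
  hence "\<bar>of_int m :: real\<bar> < 1" "\<bar>of_int n :: real\<bar> < 1" using assms by auto
  hence "m = 0" "n = 0" by linarith+
  with mn assms(3) show False by (simp add: prod_eq_iff)
qed

lemma measure_tor2_square: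
  assumes "0 < r" "r \<le> 1"
  shows "measure tor2 ({0..<r} \<times> {0..<r}) = r * r"
proof -
  have "emeasure tor1 {0..<r} = emeasure lborel {0..<r}"
  proof -
    have "indicator {0..<1} x * indicator {0..<r} x = (indicator {0..<r} x :: ennreal)" for x
      using assms by (auto simp: indicator_def)
    thus ?thesis by (simp add: tor1_def emeasure_density)
  qed
  hence "emeasure tor2 ({0..<r} \<times> {0..<r}) = ennreal r * ennreal r"
    using assms by (simp add: tor2_eq_prod T1.emeasure_pair_measure_Times)
  thus ?thesis using assms by (simp add: measure_def flip: ennreal_mult)
qed

text \<open>With \<open>I N\<close> the integral of \<open>peak ^ N\<close>, the kernel
  \<open>peak ^ N / I N\<close> has the defect \<open>1 - I (Suc N) / I N\<close>. If every ratio
  were below \<open>1 - \<eta>\<close>, \<open>I N\<close> would be at most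
  \<open>(1 - \<eta>) ^ N\<close>, while a small square near the origin alone contributes a fixed
  multiple of \<open>(1 - \<eta> / 2) ^ N\<close>.\<close>

lemma ex_peaked_averaging_kernel:
  assumes "\<delta> > 0"
  shows "\<exists>K. averaging_kernel K \<and> (\<integral>x. K x * (1 - peak x) \<partial>tor2) \<le> \<delta>"
proof -
  \<comment> \<open>The cap keeps \<open>1 - \<eta>\<close> positive in the geometric
    comparison.\<close>
  define \<eta> where "\<eta> = min \<delta> (1/2)"
  have \<eta>: "0 < \<eta>" "\<eta> \<le> 1/2" "\<eta> \<le> \<delta>" using assms by (auto simp: \<eta>_def)
  define I where "I N = (\<integral>x. peak x ^ N \<partial>tor2)" for N
  have int: "integrable tor2 (\<lambda>x. peak x ^ N)" for N
    by (intro trig_integrable trig_power peak_trig)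
  have "isCont peak 0" using trig_differentiable[OF peak_trig] differentiable_imp_continuous_within by blast
  hence c: "\<forall>e>0. \<exists>d>0. \<forall>x. dist x 0 < d \<longrightarrow> dist (peak x) (peak 0) < e"
    unfolding continuous_at_eps_delta .
  have "\<eta> / 2 > 0" using \<eta> by simp
  from c[rule_format, OF this]
  have "\<exists>\<rho>>0. \<forall>x. dist x 0 < \<rho> \<longrightarrow> dist (peak x) (peak 0) < \<eta> / 2" .
  then obtain \<rho> where \<rho>': "\<rho> > 0" "\<And>x. dist x 0 < \<rho> \<Longrightarrow> dist (peak x) (peak 0) < \<eta> / 2"
    by blast
  have \<rho>: "\<rho> > 0" "\<And>x. dist x 0 < \<rho> \<Longrightarrow> peak x > 1 - \<eta> / 2"
  proof -
    have "peak 0 = 1" by (simp add: peak_def)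
    thus "peak x > 1 - \<eta> / 2" if "dist x 0 < \<rho>" for x
      using \<rho>'(2)[OF that] unfolding dist_real_def by linarith
  qed (rule \<rho>'(1))
  \<comment> \<open>Points of the square have norm below \<open>2 * r\<close>, hence lie in the ball
    of radius \<open>\<rho>\<close>; the cap 1 keeps the square inside the fundamental
    domain.\<close>
  define r where "r = min 1 (\<rho> / 2)"
  have r: "0 < r" "r \<le> 1" "2 * r \<le> \<rho>" using \<rho> by (auto simp: r_def)
  let ?S = "{0..<r} \<times> {0..<r}"
  have S: "peak x \<ge> 1 - \<eta> / 2" if "x \<in> ?S" for x
  proof -
    have "norm x \<le> \<bar>fst x\<bar> + \<bar>snd x\<bar>" using norm_Pair_le[of "fst x" "snd x"] by simp
    also have "\<dots> < \<rho>" using that r by auto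
    finally show ?thesis using \<rho>(2)[of x] by simp
  qed
  have [measurable]: "?S \<in> sets borel" by (intro borel_Times) auto
  have lower: "(1 - \<eta> / 2) ^ N * (r * r) \<le> I N" for N
  proof -
    have "(\<integral>x. (1 - \<eta> / 2) ^ N * indicator ?S x \<partial>tor2) \<le> I N"
      unfolding I_def
    proof (intro integral_mono int)
      show "integrable tor2 (\<lambda>x. (1 - \<eta> / 2) ^ N * indicator ?S x)"
        by (intro integrable_tor2_bounded[where B="\<bar>(1 - \<eta> / 2) ^ N\<bar>"]) (auto simp: indicator_def)
      show "(1 - \<eta> / 2) ^ N * indicator ?S x \<le> peak x ^ N" for x
        using S[of x] \<eta> peak_nonneg[of x] by (auto simp: indicator_def intro!: power_mono)
    qed
    thus ?thesis using measure_tor2_square[OF r(1,2)] by simp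
  qed
  have pos: "I N > 0" for N
    using \<eta> r by (intro less_le_trans[OF _ lower[of N]]) (auto intro!: mult_pos_pos)
  have "\<exists>N. I (Suc N) \<ge> (1 - \<eta>) * I N"
  proof (rule ccontr)
    assume "\<not> ?thesis"
    hence step: "I (Suc N) < (1 - \<eta>) * I N" for N by (auto simp: not_le)
    have upper: "I N \<le> (1 - \<eta>) ^ N" for N
    proof (induction N)
      case 0 show ?case by (simp add: I_def)
    next
      case (Suc N)
      have "I (Suc N) \<le> (1 - \<eta>) * (1 - \<eta>) ^ N"
        using step[of N] mult_left_mono[OF Suc, of "1 - \<eta>"] \<eta> by linarith
      thus ?case by simp
    qed
    have "(1 - \<eta>) / (1 - \<eta> / 2) < 1" using \<eta> by simp
    then obtain N where N: "((1 - \<eta>) / (1 - \<eta> / 2)) ^ N < r * r"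
      using real_arch_pow_inv[of "r * r"] r by auto
    hence "(1 - \<eta>) ^ N < (1 - \<eta> / 2) ^ N * (r * r)"
      using \<eta> by (simp add: power_divide pos_divide_less_eq mult.commute)
    with lower[of N] upper[of N] show False by simp
  qed
  then obtain N where N: "I (Suc N) \<ge> (1 - \<eta>) * I N" ..
  define K where "K = (\<lambda>x. (1 / I N) * peak x ^ N)"
  have "averaging_kernel K"
    unfolding averaging_kernel_def K_def
  proof (intro conjI allI trig.intros trig_power peak_trig)
    show "0 \<le> 1 / I N * peak x ^ N" for x using pos[of N] peak_nonneg by simp
    show "(\<integral>x. 1 / I N * peak x ^ N \<partial>tor2) = 1" using pos[of N] by (simp add: I_def[symmetric])
  qed
  moreover have "(\<integral>x. K x * (1 - peak x) \<partial>tor2) = (\<integral>x. (1 / I N) * (peak x ^ N - peak x ^ Suc N) \<partial>tor2)"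
    by (intro Bochner_Integration.integral_cong refl)
      (use pos[of N] in \<open>simp add: K_def field_simps\<close>)
  hence "(\<integral>x. K x * (1 - peak x) \<partial>tor2) = (1 / I N) * (I N - I (Suc N))"
    using int[of N] int[of "Suc N"] by (simp add: I_def del: power_Suc)
  moreover have "(1 / I N) * (I N - I (Suc N)) \<le> \<delta>"
  proof -
    have "I N - I (Suc N) \<le> \<eta> * I N" using N by (simp add: left_diff_distrib)
    also have "\<dots> \<le> \<delta> * I N" using \<eta> pos[of N] by (intro mult_right_mono) auto
    finally show ?thesis using pos[of N] by (simp add: pos_divide_le_eq)
  qed
  ultimately show ?thesis by (intro exI[of _ K]) simp
qed

text \<open>The functions of \<open>Lq_continuous_dense\<close> need not be periodic, so
  \<open>x\<close> must avoid the edges: for interior \<open>x\<close> and \<open>y\<close> in the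
  closed square the coordinates of \<open>x - y\<close> are smaller than 1 in absolute value, and
  \<open>peak (x - y)\<close> reaches 1 only at \<open>y = x\<close>.\<close>

lemma continuous_peak_bound:
  fixes g :: "real \<times> real \<Rightarrow> real"
  assumes g: "continuous_on UNIV g" and x: "x \<in> {0<..<1} \<times> {0<..<1}" and d: "\<delta> > 0"
  shows "\<exists>C\<ge>0. \<forall>y\<in>torus2. \<bar>g y - g x\<bar> \<le> \<delta> + C * (1 - peak (x - y))"
proof -
  have "isCont g x" using g unfolding continuous_on_eq_continuous_at[OF open_UNIV] by (rule bspec) simp
  then obtain r where r: "r > 0" "\<And>y. dist y x < r \<Longrightarrow> \<bar>g y - g x\<bar> < \<delta>"
  proof -
    have "\<exists>r>0. \<forall>y. dist y x < r \<longrightarrow> dist (g y) (g x) < \<delta>"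
      using \<open>isCont g x\<close> d unfolding continuous_at_eps_delta by (elim allE impE)
    thus ?thesis using that unfolding dist_real_def by metis
  qed
  let ?S = "({0..1} \<times> {0..1}) - ball x r"
  have S: "compact ?S" by (intro compact_diff compact_Times) auto
  have cp: "continuous_on ?S (\<lambda>y. 1 - peak (x - y))"
    by (intro continuous_on_diff continuous_on_const trig_continuous trig_reflect peak_trig)
  have sq: "torus2 \<subseteq> {0..1} \<times> {0..1}" by (auto simp: torus2_def)
  have "compact ((\<lambda>y. g y - g x) ` ?S)"
    by (intro compact_continuous_image S continuous_on_diff continuous_on_const continuous_on_subset[OF g]) auto
  then obtain M where M: "\<And>y. y \<in> ?S \<Longrightarrow> \<bar>g y - g x\<bar> \<le> M"
    using compact_imp_bounded[of "(\<lambda>y. g y - g x) ` ?S"] unfolding bounded_iff real_norm_def by (metis imageI)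
  show ?thesis
  proof (cases "?S = {}")
    case True
    hence "\<bar>g y - g x\<bar> \<le> \<delta>" if "y \<in> torus2" for y
    proof -
      have "y \<in> ball x r" using True that sq by blast
      thus ?thesis using r(2)[of y] by (simp add: dist_commute less_imp_le)
    qed
    thus ?thesis by (intro exI[of _ 0]) auto
  next
    case False
    then obtain z where z: "z \<in> ?S" "\<And>y. y \<in> ?S \<Longrightarrow> 1 - peak (x - z) \<le> 1 - peak (x - y)"
      using continuous_attains_inf[OF S False cp] by blast
    \<comment> \<open>Off the ball, \<open>c\<close> is the minimum of
      \<open>1 - peak (x - y)\<close> and \<open>M\<close> bounds the oscillation, so the factor
      \<open>M / c\<close> suffices there; inside the ball \<open>\<delta>\<close> suffices.\<close>
    define c where "c = 1 - peak (x - z)"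
    have "c > 0"
    proof -
      have "x - z \<noteq> 0" using z(1) r(1) by auto
      moreover have "\<bar>fst (x - z)\<bar> < 1" "\<bar>snd (x - z)\<bar> < 1"
        using z(1) x by (auto simp: abs_less_iff mem_Times_iff)
      ultimately have "peak (x - z) < 1" by (intro peak_less_1)
      thus ?thesis by (simp add: c_def)
    qed
    have M0: "M \<ge> 0" using M[OF z(1)] by simp
    show ?thesis
    proof (intro exI[of _ "M / c"] conjI ballI)
      show "0 \<le> M / c" using M0 \<open>c > 0\<close> by simp
      fix y assume y: "y \<in> torus2"
      show "\<bar>g y - g x\<bar> \<le> \<delta> + M / c * (1 - peak (x - y))"
      proof (cases "dist y x < r")
        case True
        have "0 \<le> M / c * (1 - peak (x - y))"
          using M0 \<open>c > 0\<close> peak_le_1[of "x - y"] by (intro mult_nonneg_nonneg) auto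
        thus ?thesis using r(2)[OF True] by linarith
      next
        case False
        hence yS: "y \<in> ?S" using y sq by (auto simp: dist_commute)
        have "M = M / c * c" using \<open>c > 0\<close> by simp
        also have "\<dots> \<le> M / c * (1 - peak (x - y))"
          using z(2)[OF yS] M0 \<open>c > 0\<close> by (intro mult_left_mono) (auto simp: c_def)
        finally show ?thesis using M[OF yS] d by linarith
      qed
    qed
  qed
qed

section \<open>Convergence of mollifications\<close>

lemma conv_diff_const:
  assumes K: "averaging_kernel K" and g: "integrable tor2 g"
  shows "conv K g x - c = (\<integral>y. (g y - c) * K (x - y) \<partial>tor2)"
proof -
  have K': "K \<in> trig" "(\<integral>y. K (x - y) \<partial>tor2) = 1" "integrable tor2 (\<lambda>y. K (x - y))"
    using K integral_trig_reflect[of K x] trig_integrable[OF trig_reflect[of K x]] by (auto simp: averaging_kernel_def)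
  show ?thesis
    using integrable_conv[OF g K'(1), of x] K'(2,3) by (simp add: conv_def left_diff_distrib)
qed

text \<open>A Korovkin type argument: the deviation of \<open>g\<close> from \<open>g x\<close> is
  at most a small constant plus a multiple of \<open>1 - peak (x - y)\<close>, and averaging turns
  the second term into the single number that is assumed to tend to 0.\<close>

lemma conv_tendsto_pointwise:
  fixes g :: "real \<times> real \<Rightarrow> real"
  assumes K: "\<And>n. averaging_kernel (K n)" "(\<lambda>n. \<integral>x. K n x * (1 - peak x) \<partial>tor2) \<longlonglongrightarrow> 0"
    and g: "continuous_on UNIV g" and x: "x \<in> {0<..<1} \<times> {0<..<1}"
  shows "(\<lambda>n. conv (K n) g x) \<longlonglongrightarrow> g x"
proof (rule LIMSEQ_I)
  fix r :: real assume "r > 0"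
  then obtain C where C: "C \<ge> 0" "\<And>y. y \<in> torus2 \<Longrightarrow> \<bar>g y - g x\<bar> \<le> r / 2 + C * (1 - peak (x - y))"
    using continuous_peak_bound[OF g x, of "r / 2"] by auto
  have bound: "\<bar>conv (K n) g x - g x\<bar> \<le> r / 2 + C * (\<integral>x. K n x * (1 - peak x) \<partial>tor2)" for n
  proof -
    have K': "K n \<in> trig" "\<And>y. 0 \<le> K n y" using K(1)[of n] by (auto simp: averaging_kernel_def)
    have t: "(\<lambda>y. r / 2 * K n y + C * (K n y * (1 - peak y))) \<in> trig"
      by (intro trig_add trig_mult trig_const trig_diff K' peak_trig)
    have "\<bar>conv (K n) g x - g x\<bar> \<le> (\<integral>y. \<bar>(g y - g x) * K n (x - y)\<bar> \<partial>tor2)"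
      unfolding conv_diff_const[OF K(1) integrable_tor2_continuous[OF g]] by (rule integral_abs_bound)
    also have "\<dots> \<le> (\<integral>y. r / 2 * K n (x - y) + C * (K n (x - y) * (1 - peak (x - y))) \<partial>tor2)"
    proof (intro integral_mono_AE)
      show "integrable tor2 (\<lambda>y. \<bar>(g y - g x) * K n (x - y)\<bar>)"
        by (intro integrable_abs integrable_tor2_continuous continuous_on_mult continuous_on_diff g
            continuous_on_const trig_continuous trig_reflect K')
      show "integrable tor2 (\<lambda>y. r / 2 * K n (x - y) + C * (K n (x - y) * (1 - peak (x - y))))"
        using trig_integrable[OF trig_reflect[OF t]] .
      show "AE y in tor2. \<bar>(g y - g x) * K n (x - y)\<bar> \<le> r / 2 * K n (x - y) + C * (K n (x - y) * (1 - peak (x - y)))"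
      proof (rule AE_tor2_torusI)
        fix y :: "real \<times> real" assume "y \<in> torus2"
        from mult_right_mono[OF C(2)[OF this] K'(2)[of "x - y"]]
        have "\<bar>g y - g x\<bar> * K n (x - y) \<le> r / 2 * K n (x - y) + C * (K n (x - y) * (1 - peak (x - y)))"
          by (simp add: algebra_simps)
        moreover have "\<bar>(g y - g x) * K n (x - y)\<bar> = \<bar>g y - g x\<bar> * K n (x - y)"
          using K'(2)[of "x - y"] by (simp only: abs_mult abs_of_nonneg)
        ultimately show "\<bar>(g y - g x) * K n (x - y)\<bar> \<le> r / 2 * K n (x - y) + C * (K n (x - y) * (1 - peak (x - y)))"
          by simp
      qed
    qed
    also have "\<dots> = (\<integral>y. r / 2 * K n y + C * (K n y * (1 - peak y)) \<partial>tor2)"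
      using integral_trig_reflect[OF t] by simp
    also have "\<dots> = r / 2 + C * (\<integral>x. K n x * (1 - peak x) \<partial>tor2)"
      using K(1)[of n] trig_integrable[OF K'(1)] trig_integrable[OF trig_mult[OF K'(1) trig_diff[OF trig_const[of 1] peak_trig]]]
      by (simp add: averaging_kernel_def)
    finally show ?thesis .
  qed
  have "(\<lambda>n. r / 2 + C * (\<integral>x. K n x * (1 - peak x) \<partial>tor2)) \<longlonglongrightarrow> r / 2 + C * 0"
    by (intro tendsto_intros K)
  hence "\<forall>\<^sub>F n in sequentially. r / 2 + C * (\<integral>x. K n x * (1 - peak x) \<partial>tor2) < r"
    by (rule order_tendstoD(2)) (use \<open>r > 0\<close> in simp)
  then obtain N where "\<And>n. n \<ge> N \<Longrightarrow> r / 2 + C * (\<integral>x. K n x * (1 - peak x) \<partial>tor2) < r"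
    by (auto simp: eventually_sequentially)
  thus "\<exists>N. \<forall>n\<ge>N. norm (conv (K n) g x - g x) < r"
    using bound by (intro exI[of _ N]) (auto intro: le_less_trans)
qed

lemma AE_tor2_interior: "AE x in tor2. x \<in> {0<..<1} \<times> {0<..<1}"
proof -
  have z: "emeasure tor1 {0} = 0" 
    by (simp add: tor1_def emeasure_density nn_integral_indicator_singleton)
  have "{0} \<times> UNIV \<in> null_sets tor2" "UNIV \<times> {0} \<in> null_sets tor2"
    by (auto simp: tor2_eq_prod null_sets_def T1.emeasure_pair_measure_Times z)
  from AE_not_in[OF this(1)] AE_not_in[OF this(2)] AE_tor2_torus
  show ?thesis by eventually_elim (auto simp: torus2_def order_less_le)
qed

text \<open>Pointwise convergence holds off the edges of the square, thus almost everywhere, and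
  averaging keeps the difference below \<open>2 * B\<close>; dominated convergence applies.\<close>

lemma conv_tendsto_Lq_continuous:
  fixes g :: "real \<times> real \<Rightarrow> real"
  assumes K: "\<And>n. averaging_kernel (K n)" "(\<lambda>n. \<integral>x. K n x * (1 - peak x) \<partial>tor2) \<longlonglongrightarrow> 0"
    and g: "continuous_on UNIV g" "\<And>x. \<bar>g x\<bar> \<le> B" and q: "q \<in> {2, 4::nat}"
  shows "(\<lambda>n. \<integral>x. (conv (K n) g x - g x) ^ q \<partial>tor2) \<longlonglongrightarrow> 0"
proof -
  have [measurable]: "g \<in> borel_measurable borel" by (intro borel_measurable_continuous_onI g)
  have gi: "integrable tor2 g" by (intro integrable_tor2_continuous g)
  have [measurable]: "conv (K n) g \<in> borel_measurable borel" for n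
    using K(1)[of n] gi by (intro trig_measurable conv_trig) (auto simp: averaging_kernel_def)
  have bnd: "\<bar>conv (K n) g x - g x\<bar> \<le> 2 * B" for n x
  proof -
    have K': "K n \<in> trig" "\<And>y. 0 \<le> K n y" "(\<integral>y. K n (x - y) \<partial>tor2) = 1"
      using K(1)[of n] integral_trig_reflect[of "K n" x] by (auto simp: averaging_kernel_def)
    have "\<bar>conv (K n) g x - g x\<bar> \<le> (\<integral>y. \<bar>(g y - g x) * K n (x - y)\<bar> \<partial>tor2)"
      unfolding conv_diff_const[OF K(1) gi] by (rule integral_abs_bound)
    also have "\<dots> \<le> (\<integral>y. (2 * B) * K n (x - y) \<partial>tor2)"
    proof (intro integral_mono)
      show "integrable tor2 (\<lambda>y. \<bar>(g y - g x) * K n (x - y)\<bar>)"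
        by (intro integrable_abs integrable_tor2_continuous continuous_on_mult continuous_on_diff g
            continuous_on_const trig_continuous trig_reflect K')
      show "integrable tor2 (\<lambda>y. (2 * B) * K n (x - y))"
        by (intro integrable_mult_right trig_integrable trig_reflect K')
      fix y
      have "\<bar>g y - g x\<bar> \<le> 2 * B" using g(2)[of x] g(2)[of y] by linarith
      thus "\<bar>(g y - g x) * K n (x - y)\<bar> \<le> 2 * B * K n (x - y)"
        using K'(2)[of "x - y"] by (simp add: abs_mult mult_right_mono)
    qed
    finally show ?thesis using K'(3) by simp
  qed
  have q0: "q > 0" using q by auto
  have "(\<lambda>n. \<integral>x. (conv (K n) g x - g x) ^ q \<partial>tor2) \<longlonglongrightarrow> (\<integral>x. 0 \<partial>tor2)"
  proof (rule integral_dominated_convergence[where w="\<lambda>x. (2 * B) ^ q"])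
    show "AE x in tor2. (\<lambda>n. (conv (K n) g x - g x) ^ q) \<longlonglongrightarrow> 0"
      using AE_tor2_interior
    proof eventually_elim
      case (elim x)
      have "(\<lambda>n. (conv (K n) g x - g x) ^ q) \<longlonglongrightarrow> (g x - g x) ^ q"
        by (intro tendsto_intros conv_tendsto_pointwise K g elim)
      thus ?case by (simp only: diff_self zero_power[OF q0])
    qed
    show "AE x in tor2. norm ((conv (K n) g x - g x) ^ q) \<le> (2 * B) ^ q" for n
    proof (rule AE_I2)
      fix x
      have "norm ((conv (K n) g x - g x) ^ q) = \<bar>conv (K n) g x - g x\<bar> ^ q" by (simp add: power_abs)
      also have "\<dots> \<le> (2 * B) ^ q" by (intro power_mono bnd) simp
      finally show "norm ((conv (K n) g x - g x) ^ q) \<le> (2 * B) ^ q" .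
    qed
  qed auto
  thus ?thesis by simp
qed

lemma integrable_even_power_add:
  fixes f g :: "real \<times> real \<Rightarrow> real"
  assumes [measurable]: "f \<in> borel_measurable borel" "g \<in> borel_measurable borel"
    and "integrable tor2 (\<lambda>x. f x ^ q)" "integrable tor2 (\<lambda>x. g x ^ q)" and q: "q \<in> {2, 4::nat}"
  shows "integrable tor2 (\<lambda>x. (f x + g x) ^ q)"
    and "(\<integral>x. (f x + g x) ^ q \<partial>tor2) \<le> 16 * ((\<integral>x. f x ^ q \<partial>tor2) + (\<integral>x. g x ^ q \<partial>tor2))"
proof -
  have ev: "even q" using q by auto
  show i: "integrable tor2 (\<lambda>x. (f x + g x) ^ q)"
  proof (rule Bochner_Integration.integrable_bound[where f="\<lambda>x. 16 * (f x ^ q + g x ^ q)"])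
    show "AE x in tor2. norm ((f x + g x) ^ q) \<le> norm (16 * (f x ^ q + g x ^ q))"
    proof (rule AE_I2)
      fix x
      have "norm ((f x + g x) ^ q) = (f x + g x) ^ q" using ev by (simp add: zero_le_even_power)
      also have "\<dots> \<le> norm (16 * (f x ^ q + g x ^ q))"
        unfolding real_norm_def by (rule order_trans[OF power_add_le[OF q] abs_ge_self])
      finally show "norm ((f x + g x) ^ q) \<le> norm (16 * (f x ^ q + g x ^ q))" .
    qed
  qed (use assms in auto)
  have "(\<integral>x. (f x + g x) ^ q \<partial>tor2) \<le> (\<integral>x. 16 * (f x ^ q + g x ^ q) \<partial>tor2)"
    using assms i by (intro integral_mono power_add_le q) auto
  thus "(\<integral>x. (f x + g x) ^ q \<partial>tor2) \<le> 16 * ((\<integral>x. f x ^ q \<partial>tor2) + (\<integral>x. g x ^ q \<partial>tor2))"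
    using assms by simp
qed

lemma conv_diff:
  assumes "integrable tor2 f" "integrable tor2 g" "K \<in> trig"
  shows "conv K (\<lambda>x. f x - g x) x = conv K f x - conv K g x"
  using integrable_conv[OF assms(1,3), of x] integrable_conv[OF assms(2,3), of x]
  by (simp add: conv_def left_diff_distrib)

lemma integrable_conv_power:
  "K \<in> trig \<Longrightarrow> integrable tor2 f \<Longrightarrow> integrable tor2 (\<lambda>x. conv K f x ^ q)"
  by (rule trig_integrable[OF trig_power[OF conv_trig]])

lemma conv_tendsto_Lq:
  fixes f :: "real \<times> real \<Rightarrow> real"
  assumes K: "\<And>n. averaging_kernel (K n)" "(\<lambda>n. \<integral>x. K n x * (1 - peak x) \<partial>tor2) \<longlonglongrightarrow> 0"
    and f: "f \<in> borel_measurable borel" "integrable tor2 (\<lambda>x. f x ^ q)" and q: "q \<in> {2, 4::nat}"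
  shows "(\<lambda>n. \<integral>x. (conv (K n) f x - f x) ^ q \<partial>tor2) \<longlonglongrightarrow> 0"
proof (rule LIMSEQ_I)
  fix r :: real assume "r > 0"
  then obtain g B where g: "continuous_on UNIV g" "\<And>x. \<bar>g x\<bar> \<le> B" 
      and fg: "(\<integral>x. (f x - g x) ^ q \<partial>tor2) < r / 1024"
    using Lq_continuous_dense[OF f q, of "r / 1024"] by auto
  have ev: "even q" using q by auto
  have [measurable]: "f \<in> borel_measurable borel" "g \<in> borel_measurable borel"
    using f g by (auto intro: borel_measurable_continuous_onI)
  have gi: "integrable tor2 g" "integrable tor2 (\<lambda>x. (- g x) ^ q)"
    by (intro integrable_tor2_continuous continuous_intros g)+
  have fi: "integrable tor2 f" using integrable_even_power[OF f q] .
  have fgi: "integrable tor2 (\<lambda>x. (f x - g x) ^ q)"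
    using integrable_even_power_add(1)[of f "\<lambda>x. - g x" q] f gi q by simp
  have gfi: "integrable tor2 (\<lambda>x. (g x - f x) ^ q)" and gf: "(\<integral>x. (g x - f x) ^ q \<partial>tor2) = (\<integral>x. (f x - g x) ^ q \<partial>tor2)"
  proof -
    have "(g x - f x) ^ q = (f x - g x) ^ q" for x
      using power_minus_even[OF ev, of "f x - g x"] by simp
    thus "integrable tor2 (\<lambda>x. (g x - f x) ^ q)" "(\<integral>x. (g x - f x) ^ q \<partial>tor2) = (\<integral>x. (f x - g x) ^ q \<partial>tor2)"
      using fgi by simp_all
  qed
  \<comment> \<open>The error is split into the mollified \<open>f - g\<close>, the error for
    \<open>g\<close>, and \<open>g - f\<close>. Two uses of \<open>power_add_le\<close> give the
    outer parts the factors 16 and 256; their sum 272 is rounded up to 512, which costs half of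
    \<open>r\<close>.\<close>
  have bound: "(\<integral>x. (conv (K n) f x - f x) ^ q \<partial>tor2) \<le> 512 * (r / 1024) + 256 * (\<integral>x. (conv (K n) g x - g x) ^ q \<partial>tor2)" for n
  proof -
    have K': "K n \<in> trig" using K(1)[of n] by (auto simp: averaging_kernel_def)
    have [measurable]: "conv (K n) h \<in> borel_measurable borel" if "integrable tor2 h" for h
      by (intro trig_measurable conv_trig K' that)
    note [measurable] = this[OF fi] this[OF gi(1)]
    let ?a = "\<lambda>x. conv (K n) (\<lambda>x. f x - g x) x" and ?b = "\<lambda>x. conv (K n) g x - g x" and ?c = "\<lambda>x. g x - f x"
    have [measurable]: "?a \<in> borel_measurable borel"
      by (intro trig_measurable conv_trig K' Bochner_Integration.integrable_diff fi gi)
    have ai: "integrable tor2 (\<lambda>x. ?a x ^ q)"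
      by (intro integrable_conv_power K' Bochner_Integration.integrable_diff fi gi)
    have bi: "integrable tor2 (\<lambda>x. ?b x ^ q)"
      by (intro integrable_tor2_continuous continuous_on_power continuous_on_diff g trig_continuous conv_trig K' gi)
    have bci: "integrable tor2 (\<lambda>x. (?b x + ?c x) ^ q)"
      by (rule integrable_even_power_add(1)[OF _ _ bi gfi q]) measurable
    have "(\<integral>x. (conv (K n) f x - f x) ^ q \<partial>tor2) = (\<integral>x. (?a x + (?b x + ?c x)) ^ q \<partial>tor2)"
      by (simp add: conv_diff fi gi K')
    also have "\<dots> \<le> 16 * ((\<integral>x. ?a x ^ q \<partial>tor2) + (\<integral>x. (?b x + ?c x) ^ q \<partial>tor2))"
      by (rule integrable_even_power_add(2)[OF _ _ ai bci q]) measurable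
    also have "(\<integral>x. (?b x + ?c x) ^ q \<partial>tor2) \<le> 16 * ((\<integral>x. ?b x ^ q \<partial>tor2) + (\<integral>x. ?c x ^ q \<partial>tor2))"
      by (rule integrable_even_power_add(2)[OF _ _ bi gfi q]) measurable
    also have "(\<integral>x. ?a x ^ q \<partial>tor2) \<le> (\<integral>x. (f x - g x) ^ q \<partial>tor2)"
      by (rule conv_Lq_le[OF K(1) _ fgi q]) measurable
    finally show ?thesis using fg gf \<open>r > 0\<close> by simp
  qed
  have "(\<lambda>n. 512 * (r / 1024) + 256 * (\<integral>x. (conv (K n) g x - g x) ^ q \<partial>tor2)) \<longlonglongrightarrow> 512 * (r / 1024) + 256 * 0"
    by (intro tendsto_intros conv_tendsto_Lq_continuous[OF K g q])
  hence "\<forall>\<^sub>F n in sequentially. 512 * (r / 1024) + 256 * (\<integral>x. (conv (K n) g x - g x) ^ q \<partial>tor2) < r"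
    by (rule order_tendstoD(2)) (use \<open>r > 0\<close> in simp)
  then obtain N where "\<And>n. n \<ge> N \<Longrightarrow> 512 * (r / 1024) + 256 * (\<integral>x. (conv (K n) g x - g x) ^ q \<partial>tor2) < r"
    by (auto simp: eventually_sequentially)
  moreover have "0 \<le> (\<integral>x. (conv (K n) f x - f x) ^ q \<partial>tor2)" for n
    by (intro Bochner_Integration.integral_nonneg zero_le_even_power ev)
  ultimately show "\<exists>N. \<forall>n\<ge>N. norm ((\<integral>x. (conv (K n) f x - f x) ^ q \<partial>tor2) - 0) < r"
    using bound by (intro exI[of _ N]) (auto intro: le_less_trans)
qed

text \<open>One sequence serves all functions and both exponents at once: a function and its weak
  derivatives have to be smoothed by the same kernels in order to remain derivatives of one
  another.\<close>

definition mollifying :: "(nat \<Rightarrow> real \<times> real \<Rightarrow> real) \<Rightarrow> bool" where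
  "mollifying K \<longleftrightarrow> (\<forall>n. averaging_kernel (K n)) \<and>
     (\<forall>f\<in>borel_measurable borel. \<forall>q\<in>{2, 4::nat}. integrable tor2 (\<lambda>x. f x ^ q) \<longrightarrow>
       (\<lambda>n. \<integral>x. (conv (K n) f x - f x) ^ q \<partial>tor2) \<longlonglongrightarrow> 0)"

lemma mollifyingD:
  assumes "mollifying K"
  shows "averaging_kernel (K n)"
    and "f \<in> borel_measurable borel \<Longrightarrow> integrable tor2 (\<lambda>x. f x ^ q) \<Longrightarrow> q \<in> {2, 4::nat} \<Longrightarrow>
     (\<lambda>n. \<integral>x. (conv (K n) f x - f x) ^ q \<partial>tor2) \<longlonglongrightarrow> 0"
  using assms unfolding mollifying_def by auto

lemma ex_mollifying: "\<exists>K. mollifying K"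
proof -
  have "\<forall>n. \<exists>K. averaging_kernel K \<and> (\<integral>x. K x * (1 - peak x) \<partial>tor2) \<le> inverse (real (Suc n))"
    by (intro allI ex_peaked_averaging_kernel) simp
  then obtain K where K: "\<And>n. averaging_kernel (K n)" "\<And>n. (\<integral>x. K n x * (1 - peak x) \<partial>tor2) \<le> inverse (real (Suc n))"
    by metis
  have "(\<lambda>n. \<integral>x. K n x * (1 - peak x) \<partial>tor2) \<longlonglongrightarrow> 0"
  proof (rule tendsto_sandwich[OF _ _ tendsto_const LIMSEQ_inverse_real_of_nat])
    show "\<forall>\<^sub>F n in sequentially. 0 \<le> (\<integral>x. K n x * (1 - peak x) \<partial>tor2)"
      using K(1) peak_le_1 by (intro always_eventually allI Bochner_Integration.integral_nonneg mult_nonneg_nonneg) (auto simp: averaging_kernel_def)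
  qed (use K in auto)
  from conv_tendsto_Lq[OF K(1) this] have "mollifying K"
    unfolding mollifying_def using K(1) by simp
  thus ?thesis by blast
qed

section \<open>Square-integrable functions and weak derivatives\<close>

lemma square_integrable_mult:
  fixes f g :: "'a \<Rightarrow> real"
  assumes [measurable]: "f \<in> borel_measurable M" "g \<in> borel_measurable M"
    and "integrable M (\<lambda>x. (f x)\<^sup>2)" "integrable M (\<lambda>x. (g x)\<^sup>2)"
  shows "integrable M (\<lambda>x. f x * g x)"
proof (rule Bochner_Integration.integrable_bound[where f="\<lambda>x. (f x)\<^sup>2 + (g x)\<^sup>2"])
  have "\<bar>a * b\<bar> \<le> a\<^sup>2 + b\<^sup>2" for a b :: real
  proof -
    have "2 * (\<bar>a\<bar> * \<bar>b\<bar>) \<le> \<bar>a\<bar>\<^sup>2 + \<bar>b\<bar>\<^sup>2" using sum_squares_bound[of "\<bar>a\<bar>" "\<bar>b\<bar>"] by simp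
    moreover have "0 \<le> \<bar>a\<bar> * \<bar>b\<bar>" by simp
    ultimately show ?thesis by (simp only: abs_mult power2_abs)
  qed
  thus "AE x in M. norm (f x * g x) \<le> norm ((f x)\<^sup>2 + (g x)\<^sup>2)"
    by (intro AE_I2) simp
qed (use assms in auto)

lemma square_integrable_lin:
  fixes f g :: "'a \<Rightarrow> real"
  assumes [measurable]: "f \<in> borel_measurable M" "g \<in> borel_measurable M"
    and "integrable M (\<lambda>x. (f x)\<^sup>2)" "integrable M (\<lambda>x. (g x)\<^sup>2)"
  shows "integrable M (\<lambda>x. (a * f x + b * g x)\<^sup>2)"
proof -
  have "(a * f x + b * g x)\<^sup>2 = a\<^sup>2 * (f x)\<^sup>2 + (2 * a * b) * (f x * g x) + b\<^sup>2 * (g x)\<^sup>2" for x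
    by (simp add: power2_eq_square algebra_simps)
  thus ?thesis using assms square_integrable_mult[OF assms] by simp
qed

lemma square_integrable_diff:
  fixes f g :: "'a \<Rightarrow> real"
  assumes "f \<in> borel_measurable M" "g \<in> borel_measurable M"
    and "integrable M (\<lambda>x. (f x)\<^sup>2)" "integrable M (\<lambda>x. (g x)\<^sup>2)"
  shows "integrable M (\<lambda>x. (f x - g x)\<^sup>2)"
  using square_integrable_lin[OF assms, of 1 "-1"] by simp

lemma Cauchy_Schwarz_integral:
  fixes f g :: "'a \<Rightarrow> real"
  assumes [measurable]: "f \<in> borel_measurable M" "g \<in> borel_measurable M"
    and f: "integrable M (\<lambda>x. (f x)\<^sup>2)" and g: "integrable M (\<lambda>x. (g x)\<^sup>2)"
  shows "(\<integral>x. f x * g x \<partial>M)\<^sup>2 \<le> (\<integral>x. (f x)\<^sup>2 \<partial>M) * (\<integral>x. (g x)\<^sup>2 \<partial>M)"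
proof -
  have fg: "integrable M (\<lambda>x. f x * g x)"
    using assms by (intro square_integrable_mult)
  define A where "A = (\<integral>x. (f x)\<^sup>2 \<partial>M)"
  define B where "B = (\<integral>x. (g x)\<^sup>2 \<partial>M)"
  define C where "C = (\<integral>x. f x * g x \<partial>M)"
  have ge: "0 \<le> A - 2 * l * C + l\<^sup>2 * B" for l
  proof -
    have "0 \<le> (\<integral>x. (f x - l * g x)\<^sup>2 \<partial>M)" by simp
    also have "(\<lambda>x. (f x - l * g x)\<^sup>2) = (\<lambda>x. (f x)\<^sup>2 - 2 * l * (f x * g x) + l\<^sup>2 * (g x)\<^sup>2)"
      by (simp add: fun_eq_iff power2_eq_square algebra_simps)
    also have "(\<integral>x. (f x)\<^sup>2 - 2 * l * (f x * g x) + l\<^sup>2 * (g x)\<^sup>2 \<partial>M) = A - 2 * l * C + l\<^sup>2 * B"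
      using f g fg by (simp add: A_def B_def C_def)
    finally show ?thesis .
  qed
  have "B \<ge> 0" by (simp add: B_def)
  show ?thesis
  proof (cases "B = 0")
    case True
    hence "AE x in M. (g x)\<^sup>2 = 0"
      using integral_nonneg_eq_0_iff_AE[OF g] by (simp add: B_def)
    hence "C = (\<integral>x. 0 \<partial>M)" unfolding C_def
      by (intro integral_cong_AE) (auto elim: eventually_mono)
    thus ?thesis by (simp add: C_def)
  next
    case False
    \<comment> \<open>\<open>C / B\<close> minimises the quadratic polynomial in
      \<open>l\<close>.\<close>
    have "0 \<le> B * (A - 2 * (C / B) * C + (C / B)\<^sup>2 * B)"
      using ge[of "C / B"] \<open>B \<ge> 0\<close> by simp
    also have "\<dots> = A * B - C\<^sup>2"
      using False by (simp add: field_simps power2_eq_square)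
    finally show ?thesis by (simp add: A_def B_def C_def)
  qed
qed

lemma Cauchy_Schwarz_integral_sqrt:
  fixes f g :: "'a \<Rightarrow> real"
  assumes "f \<in> borel_measurable M" "g \<in> borel_measurable M"
    and "integrable M (\<lambda>x. (f x)\<^sup>2)" "integrable M (\<lambda>x. (g x)\<^sup>2)"
  shows "\<bar>\<integral>x. f x * g x \<partial>M\<bar> \<le> sqrt (\<integral>x. (f x)\<^sup>2 \<partial>M) * sqrt (\<integral>x. (g x)\<^sup>2 \<partial>M)"
  using real_sqrt_le_mono[OF Cauchy_Schwarz_integral[OF assms]] by (simp add: real_sqrt_mult)

lemma L2_tendsto_integral_square:
  fixes f :: "nat \<Rightarrow> 'a \<Rightarrow> real"
  assumes [measurable]: "\<And>n. f n \<in> borel_measurable M" "g \<in> borel_measurable M"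
    and f: "\<And>n. integrable M (\<lambda>x. (f n x)\<^sup>2)" and g: "integrable M (\<lambda>x. (g x)\<^sup>2)"
    and lim: "(\<lambda>n. \<integral>x. (f n x - g x)\<^sup>2 \<partial>M) \<longlonglongrightarrow> 0"
  shows "(\<lambda>n. \<integral>x. (f n x)\<^sup>2 \<partial>M) \<longlonglongrightarrow> (\<integral>x. (g x)\<^sup>2 \<partial>M)"
proof -
  have d: "integrable M (\<lambda>x. (f n x - g x)\<^sup>2)" for n
    using f g by (intro square_integrable_diff) auto
  have dg: "integrable M (\<lambda>x. (f n x - g x) * g x)" for n
    using d g by (intro square_integrable_mult) auto
  have "(\<lambda>n. \<integral>x. (f n x - g x) * g x \<partial>M) \<longlonglongrightarrow> 0"
  proof (rule Lim_null_comparison)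
    show "\<forall>\<^sub>F n in sequentially. norm (\<integral>x. (f n x - g x) * g x \<partial>M) \<le> sqrt (\<integral>x. (f n x - g x)\<^sup>2 \<partial>M) * sqrt (\<integral>x. (g x)\<^sup>2 \<partial>M)"
      unfolding real_norm_def using d g by (intro always_eventually allI Cauchy_Schwarz_integral_sqrt) auto
    show "(\<lambda>n. sqrt (\<integral>x. (f n x - g x)\<^sup>2 \<partial>M) * sqrt (\<integral>x. (g x)\<^sup>2 \<partial>M)) \<longlonglongrightarrow> 0"
      using tendsto_mult_right[OF tendsto_real_sqrt[OF lim]] by simp
  qed
  hence "(\<lambda>n. (\<integral>x. (f n x - g x)\<^sup>2 \<partial>M) + 2 * (\<integral>x. (f n x - g x) * g x \<partial>M) + (\<integral>x. (g x)\<^sup>2 \<partial>M)) \<longlonglongrightarrow> 0 + 2 * 0 + (\<integral>x. (g x)\<^sup>2 \<partial>M)"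
    by (intro tendsto_intros lim)
  moreover have "(\<integral>x. (f n x)\<^sup>2 \<partial>M) = (\<integral>x. (f n x - g x)\<^sup>2 \<partial>M) + 2 * (\<integral>x. (f n x - g x) * g x \<partial>M) + (\<integral>x. (g x)\<^sup>2 \<partial>M)" for n
  proof -
    have "(\<integral>x. (f n x)\<^sup>2 \<partial>M) = (\<integral>x. (f n x - g x)\<^sup>2 + 2 * ((f n x - g x) * g x) + (g x)\<^sup>2 \<partial>M)"
      by (intro Bochner_Integration.integral_cong refl) (simp add: power2_eq_square algebra_simps)
    thus ?thesis using d dg g by simp
  qed
  ultimately show ?thesis by simp
qed

text \<open>With \<open>d = f n - g\<close> the difference of the squares is
  \<open>d\<^sup>2 + 2 * d * g\<close>, and both terms are small in L2 when \<open>d\<close> is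
  small in L4. This carries the convergence of the mollified \<open>w\<close> through the square in
  the Burgers term.\<close>

lemma square_tendsto_L2:
  fixes f :: "nat \<Rightarrow> 'a \<Rightarrow> real"
  assumes [measurable]: "\<And>n. f n \<in> borel_measurable M" "g \<in> borel_measurable M"
    and f: "\<And>n. integrable M (\<lambda>x. (f n x - g x) ^ 4)" and g: "integrable M (\<lambda>x. g x ^ 4)"
    and lim: "(\<lambda>n. \<integral>x. (f n x - g x) ^ 4 \<partial>M) \<longlonglongrightarrow> 0"
  shows "(\<lambda>n. \<integral>x. ((f n x)\<^sup>2 - (g x)\<^sup>2)\<^sup>2 \<partial>M) \<longlonglongrightarrow> 0"
proof -
  have sq4: "(a\<^sup>2)\<^sup>2 = a ^ 4" for a :: real by simp
  have i1: "integrable M (\<lambda>x. ((f n x - g x)\<^sup>2)\<^sup>2)" for n using f by (simp only: sq4)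
  have i2: "integrable M (\<lambda>x. ((g x)\<^sup>2)\<^sup>2)" using g by (simp only: sq4)
  have i3: "integrable M (\<lambda>x. (f n x - g x)\<^sup>2 * (g x)\<^sup>2)" for n
    by (intro square_integrable_mult i1 i2) auto
  have le: "((f n x)\<^sup>2 - (g x)\<^sup>2)\<^sup>2 \<le> 2 * (f n x - g x) ^ 4 + 8 * ((f n x - g x)\<^sup>2 * (g x)\<^sup>2)" for n x
  proof -
    define d where "d = f n x - g x"
    have "(f n x)\<^sup>2 - (g x)\<^sup>2 = d\<^sup>2 + 2 * d * g x" by (simp add: d_def power2_eq_square algebra_simps)
    moreover have "(a + b)\<^sup>2 \<le> 2 * a\<^sup>2 + 2 * b\<^sup>2" for a b :: real
      using zero_le_power2[of "a - b"] by (simp add: power2_eq_square algebra_simps)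
    from this[of "d\<^sup>2" "2 * d * g x"] have "(d\<^sup>2 + 2 * d * g x)\<^sup>2 \<le> 2 * d ^ 4 + 8 * (d\<^sup>2 * (g x)\<^sup>2)"
      by (simp add: power_mult_distrib)
    ultimately show ?thesis by (simp add: d_def)
  qed
  have "(\<lambda>n. \<integral>x. (f n x - g x)\<^sup>2 * (g x)\<^sup>2 \<partial>M) \<longlonglongrightarrow> 0"
  proof (rule Lim_null_comparison)
    show "\<forall>\<^sub>F n in sequentially. norm (\<integral>x. (f n x - g x)\<^sup>2 * (g x)\<^sup>2 \<partial>M) \<le> sqrt (\<integral>x. (f n x - g x) ^ 4 \<partial>M) * sqrt (\<integral>x. (g x) ^ 4 \<partial>M)"
      unfolding real_norm_def sq4[symmetric] by (intro always_eventually allI Cauchy_Schwarz_integral_sqrt i1 i2) auto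
    show "(\<lambda>n. sqrt (\<integral>x. (f n x - g x) ^ 4 \<partial>M) * sqrt (\<integral>x. (g x) ^ 4 \<partial>M)) \<longlonglongrightarrow> 0"
      using tendsto_mult_right[OF tendsto_real_sqrt[OF lim]] by simp
  qed
  hence "(\<lambda>n. 2 * (\<integral>x. (f n x - g x) ^ 4 \<partial>M) + 8 * (\<integral>x. (f n x - g x)\<^sup>2 * (g x)\<^sup>2 \<partial>M)) \<longlonglongrightarrow> 2 * 0 + 8 * 0"
    by (intro tendsto_intros lim)
  hence up: "(\<lambda>n. 2 * (\<integral>x. (f n x - g x) ^ 4 \<partial>M) + 8 * (\<integral>x. (f n x - g x)\<^sup>2 * (g x)\<^sup>2 \<partial>M)) \<longlonglongrightarrow> 0" by simp
  show ?thesis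
  proof (rule tendsto_sandwich[OF _ _ tendsto_const up])
    show "\<forall>\<^sub>F n in sequentially. 0 \<le> (\<integral>x. ((f n x)\<^sup>2 - (g x)\<^sup>2)\<^sup>2 \<partial>M)" by simp
    show "\<forall>\<^sub>F n in sequentially. (\<integral>x. ((f n x)\<^sup>2 - (g x)\<^sup>2)\<^sup>2 \<partial>M) \<le> 2 * (\<integral>x. (f n x - g x) ^ 4 \<partial>M) + 8 * (\<integral>x. (f n x - g x)\<^sup>2 * (g x)\<^sup>2 \<partial>M)"
    proof (intro always_eventually allI)
      fix n
      have "(\<integral>x. ((f n x)\<^sup>2 - (g x)\<^sup>2)\<^sup>2 \<partial>M) \<le> (\<integral>x. 2 * (f n x - g x) ^ 4 + 8 * ((f n x - g x)\<^sup>2 * (g x)\<^sup>2) \<partial>M)"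
        using f[of n] i3[of n] le by (intro integral_mono_AE') auto
      thus "(\<integral>x. ((f n x)\<^sup>2 - (g x)\<^sup>2)\<^sup>2 \<partial>M) \<le> 2 * (\<integral>x. (f n x - g x) ^ 4 \<partial>M) + 8 * (\<integral>x. (f n x - g x)\<^sup>2 * (g x)\<^sup>2 \<partial>M)"
        using f[of n] i3[of n] by simp
    qed
  qed
qed

text \<open>Each value \<open>conv K f x\<close> pairs \<open>f\<close> with a reflected translate
  of the kernel, which is a test function. All mollifications therefore vanish, and they converge to
  \<open>f\<close> in L2.\<close>

lemma AE_zero_if_orthogonal:
  fixes f :: "real \<times> real \<Rightarrow> real"
  assumes f: "f \<in> borel_measurable borel" "integrable tor2 (\<lambda>x. (f x)\<^sup>2)"
    and orth: "\<And>\<phi>. \<phi> \<in> test_functions \<Longrightarrow> (\<integral>x. f x * \<phi> x \<partial>tor2) = 0"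
  shows "AE x in tor2. f x = 0"
proof -
  obtain K where "mollifying K" using ex_mollifying by blast
  note K = mollifyingD(1)[OF this] and lim = mollifyingD(2)[OF this]
  have "conv (K n) f x = 0" for n x
    unfolding conv_def using K[of n] by (intro orth trig_test trig_reflect) (simp add: averaging_kernel_def)
  hence "(\<integral>x. (f x)\<^sup>2 \<partial>tor2) = 0" using lim[OF f] by (simp add: LIMSEQ_const_iff)
  thus ?thesis using integral_nonneg_eq_0_iff_AE[OF f(2)] by simp
qed

section \<open>Weak derivatives on the torus\<close>

lemma L2_torusD:
  assumes "u \<in> L2_torus"
  shows "periodic2 u" "u \<in> borel_measurable borel" "integrable tor2 (\<lambda>x. (u x)\<^sup>2)"
proof -
  show *: "periodic2 u" "u \<in> borel_measurable borel" using assms by (auto simp: L2_torus_def)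
  show "integrable tor2 (\<lambda>x. (u x)\<^sup>2)"
    using assms * by (subst set_integrable_torus2[symmetric]) (auto simp: L2_torus_def)
qed

lemma L2_torusI:
  assumes "periodic2 u" "u \<in> borel_measurable borel" "integrable tor2 (\<lambda>x. (u x)\<^sup>2)"
  shows "u \<in> L2_torus"
  using assms by (simp add: L2_torus_def set_integrable_torus2)

lemma integrable_if_square_integrable:
  fixes f :: "real \<times> real \<Rightarrow> real"
  assumes "f \<in> borel_measurable borel" "integrable tor2 (\<lambda>x. (f x)\<^sup>2)"
  shows "integrable tor2 f"
  using integrable_even_power[OF assms] by simp

lemma foldr_dir_deriv_test:
  "set es \<subseteq> {e1, e2} \<Longrightarrow> \<phi> \<in> test_functions \<Longrightarrow> foldr dir_deriv es \<phi> \<in> test_functions"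
  by (induction es) (auto intro: test_function_deriv)

lemma test_function_measurable: "\<phi> \<in> test_functions \<Longrightarrow> \<phi> \<in> borel_measurable borel"
  by (intro borel_measurable_continuous_onI test_functionsD(3))

lemma has_weak_deriv_iff:
  assumes "u \<in> borel_measurable borel" "w \<in> borel_measurable borel" "set es \<subseteq> {e1, e2}"
  shows "has_weak_deriv es u w \<longleftrightarrow> (\<forall>\<phi>\<in>test_functions.
     (\<integral>x. u x * foldr dir_deriv es \<phi> x \<partial>tor2) = (-1) ^ length es * (\<integral>x. w x * \<phi> x \<partial>tor2))"
proof -
  have "(LINT x:torus2|lborel. u x * foldr dir_deriv es \<phi> x) = (\<integral>x. u x * foldr dir_deriv es \<phi> x \<partial>tor2)"
    "(LINT x:torus2|lborel. w x * \<phi> x) = (\<integral>x. w x * \<phi> x \<partial>tor2)" if "\<phi> \<in> test_functions" for \<phi>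
    by (intro set_integral_torus2 borel_measurable_times assms(1,2)
        test_function_measurable foldr_dir_deriv_test[OF assms(3)] that)+
  thus ?thesis by (auto simp: has_weak_deriv_def)
qed

lemma integrable_mult_test:
  assumes "integrable tor2 f" "\<phi> \<in> test_functions"
  shows "integrable tor2 (\<lambda>x. f x * \<phi> x)"
proof -
  have [measurable]: "\<phi> \<in> borel_measurable borel" using assms(2) by (rule test_function_measurable)
  have [measurable]: "f \<in> borel_measurable borel"
    using borel_measurable_integrable[OF assms(1)] by simp
  have "bounded (\<phi> ` ({0..1} \<times> {0..1}))"
    by (intro compact_imp_bounded compact_continuous_image compact_Times
        continuous_on_subset[OF test_functionsD(3)[OF assms(2)]]) auto
  then obtain B where "\<forall>y\<in>\<phi> ` ({0..1} \<times> {0..1}). \<bar>y\<bar> \<le> B"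
    unfolding bounded_iff real_norm_def by (rule exE)
  hence B: "\<bar>\<phi> x\<bar> \<le> B" if "x \<in> {0..1} \<times> {0..1}" for x using that by (rule bspec[OF _ imageI])
  show ?thesis
  proof (rule Bochner_Integration.integrable_bound[where f="\<lambda>x. B * f x"])
    show "integrable tor2 (\<lambda>x. B * f x)" using assms by simp
    show "AE x in tor2. norm (f x * \<phi> x) \<le> norm (B * f x)"
    proof (rule AE_tor2_torusI)
      fix x :: "real \<times> real" assume "x \<in> torus2"
      hence "x \<in> {0..1} \<times> {0..1}" by (auto simp: torus2_def)
      from B[OF this] have "\<bar>\<phi> x\<bar> \<le> \<bar>B\<bar>" by linarith
      thus "norm (f x * \<phi> x) \<le> norm (B * f x)"
        using mult_right_mono[of "\<bar>\<phi> x\<bar>" "\<bar>B\<bar>" "\<bar>f x\<bar>"] by (simp add: abs_mult mult.commute)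
    qed
  qed simp
qed

text \<open>The consequence that matters: inside integrals, any concrete weak derivative may replace
  the one picked by \<open>weak_deriv\<close>.\<close>

lemma weak_deriv_AE_unique:
  assumes u: "u \<in> borel_measurable borel" and v: "v \<in> L2_torus" "has_weak_deriv es u v"
    and w: "w \<in> L2_torus" "has_weak_deriv es u w" and es: "set es \<subseteq> {e1, e2}"
  shows "AE x in tor2. v x = w x"
proof -
  note V = L2_torusD[OF v(1)] and W = L2_torusD[OF w(1)]
  have "AE x in tor2. v x - w x = 0"
  proof (rule AE_zero_if_orthogonal)
    show "(\<lambda>x. v x - w x) \<in> borel_measurable borel" using V W by auto
    show "integrable tor2 (\<lambda>x. (v x - w x)\<^sup>2)" using V W by (intro square_integrable_diff) auto
    fix \<phi> assume \<phi>: "\<phi> \<in> test_functions"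
    have "(-1) ^ length es * (\<integral>x. v x * \<phi> x \<partial>tor2) = (-1) ^ length es * (\<integral>x. w x * \<phi> x \<partial>tor2)"
      using bspec[OF iffD1[OF has_weak_deriv_iff[OF u V(2) es] v(2)] \<phi>]
        bspec[OF iffD1[OF has_weak_deriv_iff[OF u W(2) es] w(2)] \<phi>] by (rule trans[OF sym])
    hence "(\<integral>x. v x * \<phi> x \<partial>tor2) = (\<integral>x. w x * \<phi> x \<partial>tor2)" by simp
    thus "(\<integral>x. (v x - w x) * \<phi> x \<partial>tor2) = 0"
      using integrable_mult_test[OF integrable_if_square_integrable[OF V(2,3)] \<phi>]
        integrable_mult_test[OF integrable_if_square_integrable[OF W(2,3)] \<phi>]
      by (simp add: left_diff_distrib)
  qed
  thus ?thesis by (rule eventually_mono) simp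
qed

lemma weak_deriv_props:
  assumes "weak_deriv_in_L2 es u"
  shows "weak_deriv es u \<in> L2_torus" "has_weak_deriv es u (weak_deriv es u)"
proof -
  have "\<exists>w. w \<in> L2_torus \<and> has_weak_deriv es u w"
    using assms unfolding weak_deriv_in_L2_def Bex_def .
  from someI_ex[OF this] show "weak_deriv es u \<in> L2_torus" "has_weak_deriv es u (weak_deriv es u)"
    unfolding weak_deriv_def by (rule conjunct1, rule conjunct2)
qed

section \<open>Approximation by trigonometric polynomials with nearly the same energy\<close>

definition trig_energy :: "real \<Rightarrow> (real \<times> real \<Rightarrow> real) \<Rightarrow> real" where
  "trig_energy \<epsilon> U = 1 / 2 * (\<integral>x. 1 / \<epsilon> * (dir_deriv e2 U x - 1 / 2 * (dir_deriv e1 U x)\<^sup>2)\<^sup>2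
      + \<epsilon> * (dir_deriv e1 (dir_deriv e1 U) x)\<^sup>2 \<partial>tor2)"

text \<open>A real value where \<open>energy\<close> is extended, so that infima and limits are
  taken in the reals; it represents \<open>energy\<close> once both finiteness conditions of the
  latter are known. \<open>trig_energy\<close> is the counterpart with classical derivatives, free
  of any choice of representatives.\<close>

definition torus_energy :: "real \<Rightarrow> (real \<times> real \<Rightarrow> real) \<Rightarrow> real" where
  "torus_energy \<epsilon> u = 1 / 2 * (\<integral>x. 1 / \<epsilon> * (burgers_term u x)\<^sup>2 + \<epsilon> * (weak_deriv [e1, e1] u x)\<^sup>2 \<partial>tor2)"

lemma energy_eq_torus_energy:
  assumes "weak_deriv_in_L2 [e1, e1] u" "burgers_term u \<in> L2_torus"
  shows "energy \<epsilon> u = ennreal (torus_energy \<epsilon> u)"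
proof -
  have "(\<lambda>x. 1 / \<epsilon> * (burgers_term u x)\<^sup>2 + \<epsilon> * (weak_deriv [e1, e1] u x)\<^sup>2) \<in> borel_measurable borel"
    using L2_torusD(2)[OF weak_deriv_props(1)[OF assms(1)]] L2_torusD(2)[OF assms(2)] by measurable
  from set_integral_torus2[OF this] show ?thesis
    using assms by (simp only: energy_def torus_energy_def simp_thms if_True)
qed

text \<open>Mollification does not commute with squaring: the Burgers term of
  \<open>conv K u\<close> is \<open>conv K p - (conv K w)\<^sup>2 / 2\<close>, not the mollified
  Burgers term. Convergence of \<open>conv K w\<close> in L4 is what makes it tend to the Burgers
  term of \<open>u\<close> all the same.\<close>

lemma trig_approximation:
  assumes u: "u \<in> W12_torus" and u11: "weak_deriv_in_L2 [e1, e1] u" and bt: "burgers_term u \<in> L2_torus"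
    and d: "\<delta> > 0"
  shows "\<exists>U\<in>trig. (\<integral>x. (U x - u x)\<^sup>2 \<partial>tor2) < \<delta> \<and> trig_energy \<epsilon> U < torus_energy \<epsilon> u + \<delta>"
proof -
  define w where "w = weak_deriv [e1] u"
  define p where "p = weak_deriv [e2] u"
  define h where "h = weak_deriv [e1, e1] u"
  have u': "u \<in> L2_torus" "weak_deriv_in_L2 [e1] u" "weak_deriv_in_L2 [e2] u"
    using u by (auto simp: W12_torus_def)
  note U = L2_torusD(2,3)[OF u'(1)]
  note W = L2_torusD(2,3)[OF weak_deriv_props(1)[OF u'(2)], folded w_def]
  note P = L2_torusD(2,3)[OF weak_deriv_props(1)[OF u'(3)], folded p_def]
  note H = L2_torusD(2,3)[OF weak_deriv_props(1)[OF u11], folded h_def]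
  have bt_eq: "burgers_term u = (\<lambda>x. p x - 1 / 2 * (w x)\<^sup>2)"
    by (simp add: burgers_term_def p_def w_def)
  note B = L2_torusD(2,3)[OF bt, unfolded bt_eq]
  have "integrable tor2 (\<lambda>x. (2 * p x + (- 2) * (p x - 1 / 2 * (w x)\<^sup>2))\<^sup>2)"
    using P B by (intro square_integrable_lin) auto
  hence W4: "integrable tor2 (\<lambda>x. w x ^ 4)" by (simp add: algebra_simps)
  obtain K where "mollifying K" using ex_mollifying by blast
  note K = mollifyingD(1)[OF this] and lim = mollifyingD(2)[OF this]
  have K': "K n \<in> trig" for n using K by (simp add: averaging_kernel_def)
  note ui = integrable_if_square_integrable[OF U] and wi = integrable_if_square_integrable[OF W]
    and pi = integrable_if_square_integrable[OF P] and hi = integrable_if_square_integrable[OF H]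
  have D1: "dir_deriv e1 (conv (K n) u) = conv (K n) w" for n
    using conv_weak_deriv[OF K' U(1) W(1), of e1] weak_deriv_props(2)[OF u'(2)] dir_deriv_conv[OF K' ui, of e1]
    by (simp add: w_def)
  have D2: "dir_deriv e2 (conv (K n) u) = conv (K n) p" for n
    using conv_weak_deriv[OF K' U(1) P(1), of e2] weak_deriv_props(2)[OF u'(3)] dir_deriv_conv[OF K' ui, of e2]
    by (simp add: p_def)
  have D11: "dir_deriv e1 (conv (K n) w) = conv (K n) h" for n
    using conv_weak_deriv2[OF K' U(1) H(1)] weak_deriv_props(2)[OF u11] dir_deriv_conv[OF K' ui, of e1]
      dir_deriv_conv[OF trig_derivs(1)[OF K'] ui, of e1] by (simp add: h_def flip: D1)
  have ct: "conv (K n) u \<in> trig" "conv (K n) w \<in> trig" "conv (K n) p \<in> trig" "conv (K n) h \<in> trig" for n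
    by (intro conv_trig K' ui wi pi hi)+
  note [measurable] = ct[THEN trig_measurable]
  note [measurable] = U(1) W(1) P(1) H(1)
  define \<eta> where "\<eta> n x = conv (K n) p x - 1 / 2 * (conv (K n) w x)\<^sup>2" for n x
  have \<eta>t: "\<eta> n \<in> trig" for n
    unfolding \<eta>_def by (intro trig_diff trig_scale trig_power ct)
  have \<eta>m [measurable]: "\<eta> n \<in> borel_measurable borel" for n by (intro trig_measurable \<eta>t)
  have w4: "integrable tor2 (\<lambda>x. (conv (K n) w x - w x) ^ 4)" for n
    using integrable_even_power_add(1)[of "conv (K n) w" "\<lambda>x. - w x" 4]
      trig_integrable[OF trig_power[OF ct(2), of n 4]] W4 W(1) by simp
  have w2: "(\<lambda>n. \<integral>x. ((conv (K n) w x)\<^sup>2 - (w x)\<^sup>2)\<^sup>2 \<partial>tor2) \<longlonglongrightarrow> 0"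
    by (rule square_tendsto_L2[OF _ _ w4 W4 lim[OF W(1) W4]]) auto
  have lin: "(a - b)\<^sup>2 \<le> 2 * a\<^sup>2 + 2 * b\<^sup>2" for a b :: real
    using zero_le_power2[of "a + b"] by (simp add: power2_eq_square algebra_simps)
  have i1: "integrable tor2 (\<lambda>x. (conv (K n) p x - p x)\<^sup>2)" for n
    using trig_integrable[OF trig_power[OF ct(3), of n 2]] P by (intro square_integrable_diff) auto
  have i2: "integrable tor2 (\<lambda>x. ((conv (K n) w x)\<^sup>2 - (w x)\<^sup>2)\<^sup>2)" for n
    using trig_integrable[OF trig_power[OF ct(2), of n 4]] W4 by (intro square_integrable_diff) auto
  have "(\<lambda>n. \<integral>x. (\<eta> n x - (p x - 1 / 2 * (w x)\<^sup>2))\<^sup>2 \<partial>tor2) \<longlonglongrightarrow> 0"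
  proof (rule tendsto_sandwich[OF _ _ tendsto_const])
    have "(\<lambda>n. 2 * (\<integral>x. (conv (K n) p x - p x)\<^sup>2 \<partial>tor2) + 1 / 2 * (\<integral>x. ((conv (K n) w x)\<^sup>2 - (w x)\<^sup>2)\<^sup>2 \<partial>tor2)) \<longlonglongrightarrow> 2 * 0 + 1 / 2 * 0"
      by (intro tendsto_intros w2 lim P) auto
    thus "(\<lambda>n. 2 * (\<integral>x. (conv (K n) p x - p x)\<^sup>2 \<partial>tor2) + 1 / 2 * (\<integral>x. ((conv (K n) w x)\<^sup>2 - (w x)\<^sup>2)\<^sup>2 \<partial>tor2)) \<longlonglongrightarrow> 0" by simp
    show "\<forall>\<^sub>F n in sequentially. (\<integral>x. (\<eta> n x - (p x - 1 / 2 * (w x)\<^sup>2))\<^sup>2 \<partial>tor2) \<le>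
       2 * (\<integral>x. (conv (K n) p x - p x)\<^sup>2 \<partial>tor2) + 1 / 2 * (\<integral>x. ((conv (K n) w x)\<^sup>2 - (w x)\<^sup>2)\<^sup>2 \<partial>tor2)"
    proof (intro always_eventually allI)
      fix n
      have "(\<eta> n x - (p x - 1 / 2 * (w x)\<^sup>2))\<^sup>2 \<le> 2 * (conv (K n) p x - p x)\<^sup>2 + 1 / 2 * ((conv (K n) w x)\<^sup>2 - (w x)\<^sup>2)\<^sup>2" for x
      proof -
        have eq: "\<eta> n x - (p x - 1 / 2 * (w x)\<^sup>2) = (conv (K n) p x - p x) - 1 / 2 * ((conv (K n) w x)\<^sup>2 - (w x)\<^sup>2)"
          by (simp add: \<eta>_def diff_divide_distrib)
        show ?thesis unfolding eq using lin[of "conv (K n) p x - p x" "1 / 2 * ((conv (K n) w x)\<^sup>2 - (w x)\<^sup>2)"]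
          by (simp add: power_divide)
      qed
      hence "(\<integral>x. (\<eta> n x - (p x - 1 / 2 * (w x)\<^sup>2))\<^sup>2 \<partial>tor2) \<le>
         (\<integral>x. 2 * (conv (K n) p x - p x)\<^sup>2 + 1 / 2 * ((conv (K n) w x)\<^sup>2 - (w x)\<^sup>2)\<^sup>2 \<partial>tor2)"
        using i1 i2 by (intro integral_mono_AE') auto
      thus "(\<integral>x. (\<eta> n x - (p x - 1 / 2 * (w x)\<^sup>2))\<^sup>2 \<partial>tor2) \<le>
         2 * (\<integral>x. (conv (K n) p x - p x)\<^sup>2 \<partial>tor2) + 1 / 2 * (\<integral>x. ((conv (K n) w x)\<^sup>2 - (w x)\<^sup>2)\<^sup>2 \<partial>tor2)"
        using i1[of n] i2[of n] by simp
    qed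
  qed simp
  hence \<eta>lim: "(\<lambda>n. \<integral>x. (\<eta> n x)\<^sup>2 \<partial>tor2) \<longlonglongrightarrow> (\<integral>x. (burgers_term u x)\<^sup>2 \<partial>tor2)"
    unfolding bt_eq using B trig_integrable[OF trig_power[OF \<eta>t]]
    by (intro L2_tendsto_integral_square) auto
  have hlim: "(\<lambda>n. \<integral>x. (conv (K n) h x)\<^sup>2 \<partial>tor2) \<longlonglongrightarrow> (\<integral>x. (h x)\<^sup>2 \<partial>tor2)"
    using H trig_integrable[OF trig_power[OF ct(4)]] lim[OF H]
    by (intro L2_tendsto_integral_square) auto
  have te: "trig_energy \<epsilon> (conv (K n) u) = 1 / 2 * (1 / \<epsilon> * (\<integral>x. (\<eta> n x)\<^sup>2 \<partial>tor2) + \<epsilon> * (\<integral>x. (conv (K n) h x)\<^sup>2 \<partial>tor2))" for n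
  proof -
    have "trig_energy \<epsilon> (conv (K n) u) = 1 / 2 * (\<integral>x. 1 / \<epsilon> * (\<eta> n x)\<^sup>2 + \<epsilon> * (conv (K n) h x)\<^sup>2 \<partial>tor2)"
      by (simp only: trig_energy_def D1 D2 D11 \<eta>_def)
    thus ?thesis
      using trig_integrable[OF trig_power[OF \<eta>t, of n 2]] trig_integrable[OF trig_power[OF ct(4), of n 2]]
      by simp
  qed
  have toe: "torus_energy \<epsilon> u = 1 / 2 * (1 / \<epsilon> * (\<integral>x. (burgers_term u x)\<^sup>2 \<partial>tor2) + \<epsilon> * (\<integral>x. (h x)\<^sup>2 \<partial>tor2))"
    using L2_torusD(3)[OF bt] H by (simp add: torus_energy_def flip: h_def)
  have "(\<lambda>n. trig_energy \<epsilon> (conv (K n) u)) \<longlonglongrightarrow> torus_energy \<epsilon> u"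
    unfolding te toe by (intro tendsto_intros \<eta>lim hlim)
  hence "\<forall>\<^sub>F n in sequentially. trig_energy \<epsilon> (conv (K n) u) < torus_energy \<epsilon> u + \<delta>"
    by (rule order_tendstoD(2)) (use d in simp)
  moreover have "\<forall>\<^sub>F n in sequentially. (\<integral>x. (conv (K n) u x - u x)\<^sup>2 \<partial>tor2) < \<delta>"
    using lim[OF U] d by (intro order_tendstoD(2)) auto
  ultimately have "\<forall>\<^sub>F n in sequentially. (\<integral>x. (conv (K n) u x - u x)\<^sup>2 \<partial>tor2) < \<delta> \<and> trig_energy \<epsilon> (conv (K n) u) < torus_energy \<epsilon> u + \<delta>"
    by eventually_elim simp
  then obtain n where "(\<integral>x. (conv (K n) u x - u x)\<^sup>2 \<partial>tor2) < \<delta> \<and> trig_energy \<epsilon> (conv (K n) u) < torus_energy \<epsilon> u + \<delta>"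
    by (auto simp: eventually_sequentially)
  thus ?thesis by (rule bexI[OF _ ct(1)])
qed

section \<open>A priori estimates\<close>

lemma measurable_comp_fst:
  assumes "f \<in> borel_measurable borel"
  shows "(\<lambda>x :: real \<times> real. f (fst x)) \<in> borel_measurable borel"
  by (rule measurable_compose[OF borel_measurable_continuous_onI assms]) (intro continuous_intros)

lemma measurable_comp_snd:
  assumes "f \<in> borel_measurable borel"
  shows "(\<lambda>x :: real \<times> real. f (snd x)) \<in> borel_measurable borel"
  by (rule measurable_compose[OF borel_measurable_continuous_onI assms]) (intro continuous_intros)

lemma integral_indicator_tor1:
  assumes "0 \<le> a" "a \<le> b" "b \<le> 1"
  shows "(\<integral>s. indicator {a..b} s \<partial>tor1) = b - a"
  using FTC_tor1_indicator[of "\<lambda>s. s" "\<lambda>_. 1", OF _ _ assms] by simp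

lemma integral_tor1_square_le:
  fixes f :: "real \<Rightarrow> real"
  assumes "continuous_on UNIV f"
  shows "(\<integral>s. \<bar>f s\<bar> \<partial>tor1)\<^sup>2 \<le> (\<integral>s. (f s)\<^sup>2 \<partial>tor1)"
proof -
  have [measurable]: "f \<in> borel_measurable borel" using assms by (rule borel_measurable_continuous_onI)
  have "integrable tor1 (\<lambda>s. (f s)\<^sup>2)"
    by (intro integrable_tor1_continuous continuous_on_power assms)
  thus ?thesis using Cauchy_Schwarz_integral[of "\<lambda>s. \<bar>f s\<bar>" tor1 "\<lambda>_. 1"] by simp
qed

locale trig_function =
  fixes U :: "real \<times> real \<Rightarrow> real"
  assumes U: "U \<in> trig"
begin

abbreviation "W \<equiv> dir_deriv e1 U"
abbreviation "P \<equiv> dir_deriv e2 U"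
abbreviation "H \<equiv> dir_deriv e1 W"
abbreviation "\<eta> x \<equiv> P x - 1 / 2 * (W x)\<^sup>2"

lemma W: "W \<in> trig" and P: "P \<in> trig" and H: "H \<in> trig"
  using trig_derivs U by auto

lemma eta: "\<eta> \<in> trig"
  by (intro trig_diff trig_scale trig_power W P)

lemmas cont = trig_continuous[OF U] trig_continuous[OF W] trig_continuous[OF P] trig_continuous[OF H] trig_continuous[OF eta]

lemma measurable [measurable]: "U \<in> borel_measurable borel" "W \<in> borel_measurable borel" "P \<in> borel_measurable borel"
  "H \<in> borel_measurable borel" "\<eta> \<in> borel_measurable borel"
  by (intro trig_measurable U W P H eta)+

lemma square_integrable: "integrable tor2 (\<lambda>x. (U x)\<^sup>2)" "integrable tor2 (\<lambda>x. (W x)\<^sup>2)" "integrable tor2 (\<lambda>x. (P x)\<^sup>2)"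
  "integrable tor2 (\<lambda>x. (H x)\<^sup>2)" "integrable tor2 (\<lambda>x. (\<eta> x)\<^sup>2)"
  by (intro trig_integrable trig_power U W P H eta)+

lemma slice1: "((\<lambda>s. U (s, t)) has_real_derivative W (s, t)) (at s)"
  "((\<lambda>s. W (s, t)) has_real_derivative H (s, t)) (at s)"
  by (intro partial1 trig_differentiable U W)+

definition B :: "real \<Rightarrow> real" where "B t = (\<integral>s. (H (s, t))\<^sup>2 \<partial>tor1)"
definition A :: "real \<Rightarrow> real" where "A t = (\<integral>s. (W (s, t))\<^sup>2 \<partial>tor1)"

text \<open>Periodicity of \<open>U\<close> along the line gives a zero of \<open>W\<close> by the
  mean value theorem, and \<open>H\<close> is integrated from this zero to \<open>s\<close>.\<close>

lemma W_abs_le: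
  assumes s: "s \<in> {0..1}"
  shows "\<bar>W (s, t)\<bar> \<le> (\<integral>r. \<bar>H (r, t)\<bar> \<partial>tor1)"
proof -
  have Hc: "continuous_on UNIV (\<lambda>r. H (r, t))" by (intro continuous_on_slice1 cont)
  hence [measurable]: "(\<lambda>r. H (r, t)) \<in> borel_measurable borel" by (rule borel_measurable_continuous_onI)
  have "\<exists>z>0. z < 1 \<and> U (1, t) - U (0, t) = (1 - 0) * W (z, t)"
    using slice1 by (intro MVT2) auto
  then obtain z where z: "0 < z" "z < 1" "W (z, t) = 0"
    using periodic2_wrap(1)[OF trig_periodic[OF U], of t] by auto
  have main: "\<bar>W (b, t) - W (a, t)\<bar> \<le> (\<integral>r. \<bar>H (r, t)\<bar> \<partial>tor1)" if "0 \<le> a" "a \<le> b" "b \<le> 1" for a b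
  proof -
    have "W (b, t) - W (a, t) = (\<integral>r. indicator {a..b} r * H (r, t) \<partial>tor1)"
      using FTC_tor1_indicator[OF slice1(2) Hc that] by simp
    also have "\<bar>\<dots>\<bar> \<le> (\<integral>r. \<bar>indicator {a..b} r * H (r, t)\<bar> \<partial>tor1)" by (rule integral_abs_bound)
    also have "\<dots> \<le> (\<integral>r. \<bar>H (r, t)\<bar> \<partial>tor1)"
      using integrable_abs[OF integrable_tor1_continuous[OF Hc]]
      by (intro integral_mono_AE') (auto simp: indicator_def)
    finally show ?thesis .
  qed
  show ?thesis
  proof (cases "s \<le> z")
    case True
    thus ?thesis using main[of s z] s z by auto
  next
    case False
    thus ?thesis using main[of z s] s z by auto
  qed
qed

text \<open>\<open>tor1\<close> has mass 1, so the L1 norm of \<open>H\<close> on the line is at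
  most its L2 norm. This supremum bound on a line is what gains the fourth power in
  \<open>W4_bound\<close>.\<close>

lemma W_square_le:
  assumes s: "s \<in> {0..1}"
  shows "(W (s, t))\<^sup>2 \<le> B t"
proof -
  have "(W (s, t))\<^sup>2 \<le> (\<integral>r. \<bar>H (r, t)\<bar> \<partial>tor1)\<^sup>2"
    using power_mono[OF W_abs_le[OF s], of t 2] by simp
  also have "\<dots> \<le> B t" unfolding B_def
    by (intro integral_tor1_square_le continuous_on_slice1 cont)
  finally show ?thesis .
qed

lemma integral_B: "(\<integral>t. B t \<partial>tor1) = (\<integral>x. (H x)\<^sup>2 \<partial>tor2)" "integrable tor1 B"
  using integral_tor2_iterated1[OF square_integrable(4)] by (simp_all add: B_def[abs_def])

lemma integral_A: "(\<integral>t. A t \<partial>tor1) = (\<integral>x. (W x)\<^sup>2 \<partial>tor2)" "integrable tor1 A"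
  using integral_tor2_iterated1[OF square_integrable(2)] by (simp_all add: A_def[abs_def])

lemma integrable_slice: "f \<in> trig \<Longrightarrow> integrable tor1 (\<lambda>s. f (s, t))" "f \<in> trig \<Longrightarrow> integrable tor1 (\<lambda>t. f (s, t))"
  by (intro integrable_tor1_continuous continuous_on_slice1 continuous_on_slice2 trig_continuous; assumption)+

lemma A_le_B: "A t \<le> B t"
proof -
  have "A t \<le> (\<integral>s. B t \<partial>tor1)"
    unfolding A_def using integrable_slice(1)[OF trig_power[OF W, of 2], of t] W_square_le
    by (intro integral_mono_AE AE_tor1_unitI) auto
  thus ?thesis by simp
qed

text \<open>The cubic flux does not contribute: \<open>W\<^sup>2 H\<close> is a derivative in the first variable.\<close>

lemma A_diff:
  assumes ab: "0 \<le> a" "a \<le> b" "b \<le> 1"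
  shows "\<bar>A b - A a\<bar> \<le> (\<integral>x. (H x)\<^sup>2 \<partial>tor2) + (\<integral>x. (\<eta> x)\<^sup>2 \<partial>tor2)"
proof -
  define G where "G x = 2 * (W x * dir_deriv e2 W x)" for x
  \<comment> \<open>\<open>R\<close> is the flux in the balance law for \<open>W\<^sup>2\<close>:
    since \<open>G\<close> is the second-variable derivative of \<open>W\<^sup>2\<close> and equals
    \<open>2 * W\<close> times the first-variable derivative of \<open>P\<close>, differentiating
    \<open>R\<close> in the first variable gives \<open>G + 2 * H * \<eta>\<close>.\<close>
  define R where "R x = 2 * (W x * P x) - 1 / 3 * (W x * W x * W x)" for x
  have D2W: "dir_deriv e2 W \<in> trig" using trig_derivs W by auto
  have G: "G \<in> trig" unfolding G_def by (intro trig_scale trig_mult W D2W)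
  have R: "R \<in> trig" unfolding R_def by (intro trig_diff trig_scale trig_mult W P)
  have dW2: "((\<lambda>t. (W (s, t))\<^sup>2) has_real_derivative G (s, t)) (at t)" for s t
    using DERIV_power[OF partial2[OF trig_differentiable[OF W], of s t], of 2] by (simp add: G_def mult.commute)
  have dR: "dir_deriv e1 R x = G x + 2 * (H x * \<eta> x)" for x
  proof -
    have t: "(\<lambda>x. W x * P x) \<in> trig" "(\<lambda>x. W x * W x * W x) \<in> trig" "(\<lambda>x. W x * W x) \<in> trig"
      by (intro trig_mult W P)+
    have "R = (\<lambda>x. 2 * (W x * P x) + (- 1 / 3) * (W x * W x * W x))" by (simp add: R_def fun_eq_iff)
    hence "dir_deriv e1 R x = 2 * dir_deriv e1 (\<lambda>x. W x * P x) x + (- 1 / 3) * dir_deriv e1 (\<lambda>x. W x * W x * W x) x"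
      using t by (simp only: dir_deriv_add_trig dir_deriv_scale_trig trig_scale)
    also have "dir_deriv e1 (\<lambda>x. W x * P x) x = W x * dir_deriv e1 P x + H x * P x"
      by (intro dir_deriv_mult trig_differentiable W P)
    also have "dir_deriv e1 P = dir_deriv e2 W" using trig_mixed_partials[OF U] by simp
    also have "dir_deriv e1 (\<lambda>x. W x * W x * W x) x = W x * W x * H x + dir_deriv e1 (\<lambda>x. W x * W x) x * W x"
      by (intro dir_deriv_mult trig_differentiable W t)
    also have "dir_deriv e1 (\<lambda>x. W x * W x) x = W x * H x + H x * W x"
      by (intro dir_deriv_mult trig_differentiable W)
    finally show ?thesis by (simp add: G_def power2_eq_square algebra_simps)
  qed
  have [measurable]: "(\<lambda>x :: real \<times> real. indicator {a..b} (snd x) :: real) \<in> borel_measurable borel"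
    by (rule measurable_comp_snd) measurable
  have ind: "integrable tor2 (\<lambda>x. f x * indicator {a..b} (snd x))" if "f \<in> trig" for f
    using trig_integrable[OF that] by (intro integrable_mult_bounded[where B=1]) auto
  \<comment> \<open>The increment becomes an integral of \<open>G\<close> over the strip between the
    heights \<open>a\<close> and \<open>b\<close>. The indicator of the strip depends on the second
    variable alone, so the derivative of \<open>R\<close> still integrates to zero on each
    line.\<close>
  have "A b - A a = (\<integral>s. (W (s, b))\<^sup>2 - (W (s, a))\<^sup>2 \<partial>tor1)"
    using integrable_slice(1)[OF trig_power[OF W, of 2]] by (simp add: A_def)
  also have "\<dots> = (\<integral>s. (\<integral>t. G (s, t) * indicator {a..b} t \<partial>tor1) \<partial>tor1)"
    using FTC_tor1_indicator[OF dW2 continuous_on_slice2[OF trig_continuous[OF G]] ab]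
    by (simp add: mult.commute)
  also have "\<dots> = (\<integral>x. G x * indicator {a..b} (snd x) \<partial>tor2)"
    using integral_tor2_iterated2[OF ind[OF G]] by simp
  also have "\<dots> = (\<integral>x. dir_deriv e1 R x * indicator {a..b} (snd x) - 2 * (H x * \<eta> x) * indicator {a..b} (snd x) \<partial>tor2)"
    by (intro Bochner_Integration.integral_cong refl) (simp add: dR algebra_simps)
  also have "\<dots> = (\<integral>x. dir_deriv e1 R x * indicator {a..b} (snd x) \<partial>tor2) - (\<integral>x. 2 * (H x * \<eta> x) * indicator {a..b} (snd x) \<partial>tor2)"
    by (intro Bochner_Integration.integral_diff ind trig_scale trig_mult H eta trig_derivs(1)[OF R])
  also have "(\<integral>x. dir_deriv e1 R x * indicator {a..b} (snd x) \<partial>tor2) = 0"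
    using integral_tor2_iterated1(1)[OF ind[OF trig_derivs(1)[OF R]]]
      integral_dir_deriv1_zero[OF trig_periodic[OF R] trig_differentiable[OF R] trig_continuous[OF trig_derivs(1)[OF R]]]
    by simp
  finally have "\<bar>A b - A a\<bar> = \<bar>\<integral>x. 2 * (H x * \<eta> x) * indicator {a..b} (snd x) \<partial>tor2\<bar>" by simp
  also have "\<dots> \<le> (\<integral>x. \<bar>2 * (H x * \<eta> x) * indicator {a..b} (snd x)\<bar> \<partial>tor2)" by (rule integral_abs_bound)
  also have "\<dots> \<le> (\<integral>x. (H x)\<^sup>2 + (\<eta> x)\<^sup>2 \<partial>tor2)"
  proof (intro integral_mono_AE' AE_I2)
    fix x
    have "2 * \<bar>H x\<bar> * \<bar>\<eta> x\<bar> \<le> (H x)\<^sup>2 + (\<eta> x)\<^sup>2" using sum_squares_bound[of "\<bar>H x\<bar>" "\<bar>\<eta> x\<bar>"] by simp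
    thus "\<bar>2 * (H x * \<eta> x) * indicator {a..b} (snd x)\<bar> \<le> (H x)\<^sup>2 + (\<eta> x)\<^sup>2"
      by (auto simp: indicator_def abs_mult)
    show "0 \<le> (H x)\<^sup>2 + (\<eta> x)\<^sup>2" by simp
  qed (use square_integrable in auto)
  also have "\<dots> = (\<integral>x. (H x)\<^sup>2 \<partial>tor2) + (\<integral>x. (\<eta> x)\<^sup>2 \<partial>tor2)"
    using square_integrable by simp
  finally show ?thesis .
qed

end

locale trig_function_bounded = trig_function +
  fixes M :: real
  assumes H_bound: "(\<integral>x. (H x)\<^sup>2 \<partial>tor2) \<le> M" and eta_bound: "(\<integral>x. (\<eta> x)\<^sup>2 \<partial>tor2) \<le> M"
begin

lemma M_nonneg: "0 \<le> M"
  using H_bound by (rule order_trans[rotated]) simp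

text \<open>The mean of \<open>A\<close> over all heights is at most that of \<open>B\<close>, hence
  at most \<open>M\<close>, and by \<open>A_diff\<close> two values of \<open>A\<close> differ by at
  most \<open>2 * M\<close>.\<close>

lemma A_bound:
  assumes b: "b \<in> {0..1}"
  shows "A b \<le> 3 * M"
proof -
  have "\<bar>A t - A b\<bar> \<le> 2 * M" if "t \<in> {0..1}" for t
    using A_diff[of t b] A_diff[of b t] H_bound eta_bound b that by (cases "t \<le> b") (auto simp: abs_minus_commute)
  hence "A b \<le> A t + 2 * M" if "t \<in> {0..1}" for t using that by fastforce
  hence "(\<integral>t. A b \<partial>tor1) \<le> (\<integral>t. A t + 2 * M \<partial>tor1)"
    using integral_A(2) by (intro integral_mono_AE AE_tor1_unitI) auto
  also have "\<dots> = (\<integral>t. A t \<partial>tor1) + 2 * M" using integral_A(2) by simp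
  also have "(\<integral>t. A t \<partial>tor1) \<le> (\<integral>t. B t \<partial>tor1)"
    using integral_A(2) integral_B(2) A_le_B by (intro integral_mono)
  finally show ?thesis using integral_B(1) H_bound by simp
qed

text \<open>On each line one factor \<open>W\<^sup>2\<close> is estimated by its supremum bound
  \<open>B t\<close>, while the other integrates to \<open>A t\<close>, at most
  \<open>3 * M\<close>. Integration of \<open>B\<close> over the heights supplies the second
  \<open>M\<close>.\<close>

lemma W4_bound: "(\<integral>x. W x ^ 4 \<partial>tor2) \<le> 3 * M\<^sup>2"
proof -
  have W4: "(\<lambda>x. W x ^ 4) \<in> trig" by (intro trig_power W)
  have le: "(\<integral>s. W (s, t) ^ 4 \<partial>tor1) \<le> 3 * M * B t" if t: "0 \<le> t" "t < 1" for t
  proof -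
    have B0: "0 \<le> B t" by (simp add: B_def)
    have "(\<integral>s. W (s, t) ^ 4 \<partial>tor1) \<le> (\<integral>s. B t * (W (s, t))\<^sup>2 \<partial>tor1)"
    proof (intro integral_mono_AE AE_tor1_unitI)
      fix s :: real assume s: "0 \<le> s" "s < 1"
      have "W (s, t) ^ 4 = (W (s, t))\<^sup>2 * (W (s, t))\<^sup>2" by (simp flip: power_add)
      also have "\<dots> \<le> B t * (W (s, t))\<^sup>2" using s by (intro mult_right_mono W_square_le) auto
      finally show "W (s, t) ^ 4 \<le> B t * (W (s, t))\<^sup>2" .
    qed (use integrable_slice(1)[OF W4] integrable_slice(1)[OF trig_power[OF W, of 2]] in auto)
    also have "\<dots> = B t * A t" by (simp add: A_def)
    also have "\<dots> \<le> B t * (3 * M)" using A_bound[of t] t B0 by (intro mult_left_mono) auto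
    finally show ?thesis by (simp add: mult_ac)
  qed
  have "(\<integral>x. W x ^ 4 \<partial>tor2) = (\<integral>t. (\<integral>s. W (s, t) ^ 4 \<partial>tor1) \<partial>tor1)"
    by (rule integral_tor2_iterated1(1)[OF trig_integrable[OF W4]])
  also have "\<dots> \<le> (\<integral>t. 3 * M * B t \<partial>tor1)"
    using integral_tor2_iterated1(2)[OF trig_integrable[OF W4]] integral_B(2) le
    by (intro integral_mono_AE AE_tor1_unitI) auto
  also have "\<dots> = 3 * M * (\<integral>x. (H x)\<^sup>2 \<partial>tor2)" by (simp add: integral_B)
  also have "\<dots> \<le> 3 * M * M" using M_nonneg H_bound by (intro mult_left_mono) auto
  finally show ?thesis by (simp add: power2_eq_square)
qed

text \<open>The bound for \<open>P\<close>, from \<open>P = \<eta> + W\<^sup>2 / 2\<close>: twice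
  the bound for \<open>\<eta>\<close> plus half of the bound in \<open>W4_bound\<close>. It depends
  on \<open>M\<close> alone and so is common to all functions of a sequence.\<close>

definition N :: real where "N = 2 * M + 3 / 2 * M\<^sup>2"

lemma N_nonneg: "0 \<le> N" using M_nonneg by (simp add: N_def)

lemma P_bound: "(\<integral>x. (P x)\<^sup>2 \<partial>tor2) \<le> N"
proof -
  have "(P x)\<^sup>2 \<le> 2 * (\<eta> x)\<^sup>2 + 1 / 2 * W x ^ 4" for x
  proof -
    define e where "e = \<eta> x"
    have "P x = e + 1 / 2 * (W x)\<^sup>2" by (simp add: e_def)
    moreover have "(e + c)\<^sup>2 \<le> 2 * e\<^sup>2 + 2 * c\<^sup>2" for c :: real
      using zero_le_power2[of "e - c"] by (simp add: power2_eq_square algebra_simps)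
    from this[of "1 / 2 * (W x)\<^sup>2"] have "(e + 1 / 2 * (W x)\<^sup>2)\<^sup>2 \<le> 2 * e\<^sup>2 + 1 / 2 * W x ^ 4"
      by (simp add: power_divide)
    ultimately show ?thesis by (simp only: e_def)
  qed
  hence "(\<integral>x. (P x)\<^sup>2 \<partial>tor2) \<le> (\<integral>x. 2 * (\<eta> x)\<^sup>2 + 1 / 2 * W x ^ 4 \<partial>tor2)"
    using square_integrable trig_integrable[OF trig_power[OF W, of 4]]
    by (intro integral_mono) auto
  also have "\<dots> = 2 * (\<integral>x. (\<eta> x)\<^sup>2 \<partial>tor2) + 1 / 2 * (\<integral>x. W x ^ 4 \<partial>tor2)"
    using square_integrable(5) trig_integrable[OF trig_power[OF W, of 4]] by simp
  also have "\<dots> \<le> N" using eta_bound W4_bound by (simp add: N_def)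
  finally show ?thesis .
qed

text \<open>Cauchy-Schwarz against the indicator of \<open>{a..b}\<close>. Since
  \<open>A_bound\<close> holds at every height, this is a Hoelder estimate with exponent 1/2,
  uniform in \<open>t\<close>.\<close>

lemma U_diff1:
  assumes ab: "0 \<le> a" "a \<le> b" "b \<le> 1" and t: "t \<in> {0..1}"
  shows "\<bar>U (b, t) - U (a, t)\<bar> \<le> sqrt (3 * M * (b - a))"
proof -
  have Wc: "continuous_on UNIV (\<lambda>s. W (s, t))" by (intro continuous_on_slice1 cont)
  hence [measurable]: "(\<lambda>s. W (s, t)) \<in> borel_measurable borel" by (rule borel_measurable_continuous_onI)
  have "U (b, t) - U (a, t) = (\<integral>s. indicator {a..b} s * W (s, t) \<partial>tor1)"
    using FTC_tor1_indicator[OF slice1(1) Wc ab] by simp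
  also have "\<bar>\<dots>\<bar> \<le> sqrt (\<integral>s. (indicator {a..b} s)\<^sup>2 \<partial>tor1) * sqrt (\<integral>s. (W (s, t))\<^sup>2 \<partial>tor1)"
    by (intro Cauchy_Schwarz_integral_sqrt integrable_slice(1)[OF trig_power[OF W]] integrable_tor1_bounded[where B=1])
       (auto simp: indicator_def)
  also have "(\<lambda>s. (indicator {a..b} s)\<^sup>2 :: real) = indicator {a..b}" by (auto simp: indicator_def)
  also have "(\<integral>s. (indicator {a..b} s) \<partial>tor1) = b - a" by (rule integral_indicator_tor1[OF ab])
  also have "sqrt (b - a) * sqrt (\<integral>s. (W (s, t))\<^sup>2 \<partial>tor1) \<le> sqrt (b - a) * sqrt (3 * M)"
    using A_bound[OF t] ab by (intro mult_left_mono real_sqrt_le_mono) (auto simp: A_def)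
  finally show ?thesis by (simp add: real_sqrt_mult mult.commute)
qed

lemma U_diff1':
  assumes "s \<in> {0..1}" "s' \<in> {0..1}" and t: "t \<in> {0..1}"
  shows "\<bar>U (s, t) - U (s', t)\<bar> \<le> sqrt (3 * M * \<bar>s - s'\<bar>)"
  using U_diff1[of s s' t] U_diff1[of s' s t] assms by (cases "s \<le> s'") (auto simp: abs_minus_commute)

text \<open>No pointwise bound on the second partial derivative is available, so the increment in the second
  variable is averaged over an interval of length \<open>\<delta>\<close> in the first variable.\<close>

lemma U_diff2:
  assumes ab: "0 \<le> a" "a \<le> b" "b \<le> 1" and s: "s \<in> {0..1}" and d: "0 < \<delta>" "\<delta> \<le> 1"
  shows "\<bar>U (s, b) - U (s, a)\<bar> \<le> 2 * sqrt (3 * M * \<delta>) + sqrt (N * (b - a)) / \<delta>"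
proof -
  \<comment> \<open>The interval from \<open>c\<close> to \<open>c + \<delta>\<close> contains
    \<open>s\<close> and stays inside the unit interval even when \<open>s\<close> is close to
    1.\<close>
  define c where "c = min s (1 - \<delta>)"
  have c: "0 \<le> c" "c + \<delta> \<le> 1" "c \<le> s" "s \<le> c + \<delta>" using s d by (auto simp: c_def)
  define L where "L = \<bar>U (s, b) - U (s, a)\<bar>"
  define I where "I r = (indicator {c..c + \<delta>} r :: real)" for r
  define J where "J t = (indicator {a..b} t :: real)" for t
  have IJm [measurable]: "I \<in> borel_measurable borel" "J \<in> borel_measurable borel" unfolding I_def J_def by measurable
  have [measurable]: "(\<lambda>x :: real \<times> real. I (fst x) * J (snd x)) \<in> borel_measurable borel"
    by (intro borel_measurable_times measurable_comp_fst measurable_comp_snd IJm)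
  have IJb: "\<bar>I r * J t\<bar> \<le> 1" for r t by (auto simp: I_def J_def indicator_def)
  have IJsq: "(I r * J t)\<^sup>2 = I r * J t" for r t by (auto simp: I_def J_def indicator_def)
  have IJP: "integrable tor2 (\<lambda>x. \<bar>P x\<bar> * (I (fst x) * J (snd x)))"
    using integrable_abs[OF trig_integrable[OF P]] IJb by (intro integrable_mult_bounded[where B=1]) auto
  have IJ2: "integrable tor2 (\<lambda>x. (I (fst x) * J (snd x))\<^sup>2)"
  proof (rule integrable_tor2_bounded[where B=1])
    fix x show "\<bar>(I (fst x) * J (snd x))\<^sup>2\<bar> \<le> 1"
      by (auto simp: I_def J_def indicator_def)
  qed measurable
  have "(\<integral>x. (I (fst x) * J (snd x))\<^sup>2 \<partial>tor2) = (\<integral>t. (\<integral>r. I r * J t \<partial>tor1) \<partial>tor1)"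
    using integral_tor2_iterated1(1)[OF IJ2] by (simp only: IJsq fst_conv snd_conv)
  also have "\<dots> = \<delta> * (b - a)"
    using integral_indicator_tor1[of c "c + \<delta>"] integral_indicator_tor1[OF ab] c d by (simp add: I_def[abs_def] J_def[abs_def])
  finally have IJ: "(\<integral>x. (I (fst x) * J (snd x))\<^sup>2 \<partial>tor2) = \<delta> * (b - a)" .
  \<comment> \<open>For \<open>r\<close> in the interval the increment at \<open>s\<close> is
    compared with the one at \<open>r\<close>: two horizontal moves, one at each height, are paid
    for by \<open>U_diff1'\<close>, and the vertical move at \<open>r\<close> by the integral of
    \<open>P\<close>. Integration over \<open>r\<close> then allows the L2 bound on
    \<open>P\<close>.\<close>
  have step: "I r * L \<le> I r * (2 * sqrt (3 * M * \<delta>)) + (\<integral>t. \<bar>P (r, t)\<bar> * (I r * J t) \<partial>tor1)" if "0 \<le> r" "r < 1" for r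
  proof (cases "r \<in> {c..c + \<delta>}")
    case False
    thus ?thesis by (simp add: I_def)
  next
    case True
    have Pc: "continuous_on UNIV (\<lambda>t. P (r, t))" by (intro continuous_on_slice2 cont)
    have "U (r, b) - U (r, a) = (\<integral>t. J t * P (r, t) \<partial>tor1)"
      using FTC_tor1_indicator[OF partial2[OF trig_differentiable[OF U]] Pc ab] by (simp add: J_def)
    hence "\<bar>U (r, b) - U (r, a)\<bar> \<le> (\<integral>t. \<bar>J t * P (r, t)\<bar> \<partial>tor1)" by (simp add: integral_abs_bound)
    also have "(\<lambda>t. \<bar>J t * P (r, t)\<bar>) = (\<lambda>t. \<bar>P (r, t)\<bar> * (I r * J t))"
      using True by (auto simp: I_def J_def indicator_def)
    finally have 1: "\<bar>U (r, b) - U (r, a)\<bar> \<le> (\<integral>t. \<bar>P (r, t)\<bar> * (I r * J t) \<partial>tor1)" .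
    have "\<bar>s - r\<bar> \<le> \<delta>" using True c by auto
    hence le: "sqrt (3 * M * \<bar>s - r\<bar>) \<le> sqrt (3 * M * \<delta>)"
      using M_nonneg by (intro real_sqrt_le_mono mult_left_mono) auto
    have 2: "\<bar>U (s, t) - U (r, t)\<bar> \<le> sqrt (3 * M * \<delta>)" if "t \<in> {0..1}" for t
      using \<open>0 \<le> r\<close> \<open>r < 1\<close> by (intro order_trans[OF U_diff1'[OF s _ that, of r] le]) simp
    have "L \<le> 2 * sqrt (3 * M * \<delta>) + \<bar>U (r, b) - U (r, a)\<bar>"
      using 2[of a] 2[of b] ab unfolding L_def by auto
    thus ?thesis using 1 True by (simp add: I_def)
  qed
  have Ii: "integrable tor1 I" by (intro integrable_tor1_bounded[where B=1]) (auto simp: I_def indicator_def)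
  have II: "(\<integral>r. I r \<partial>tor1) = \<delta>"
    using integral_indicator_tor1[of c "c + \<delta>"] c d by (simp add: I_def[abs_def])
  have IP1: "integrable tor1 (\<lambda>r. \<integral>t. \<bar>P (r, t)\<bar> * (I r * J t) \<partial>tor1)"
    using TT.integrable_fst[of "\<lambda>r t. \<bar>P (r, t)\<bar> * (I r * J t)"] IJP
    by (simp add: tor2_eq_prod case_prod_unfold)
  have "\<delta> * L = (\<integral>r. I r * L \<partial>tor1)" using II by simp
  also have "\<dots> \<le> (\<integral>r. I r * (2 * sqrt (3 * M * \<delta>)) + (\<integral>t. \<bar>P (r, t)\<bar> * (I r * J t) \<partial>tor1) \<partial>tor1)"
    using Ii IP1 step by (intro integral_mono_AE AE_tor1_unitI) auto
  also have "\<dots> = \<delta> * (2 * sqrt (3 * M * \<delta>)) + (\<integral>x. \<bar>P x\<bar> * (I (fst x) * J (snd x)) \<partial>tor2)"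
    using Ii IP1 II integral_tor2_iterated2[OF IJP] by simp
  also have "(\<integral>x. \<bar>P x\<bar> * (I (fst x) * J (snd x)) \<partial>tor2) \<le> \<bar>\<integral>x. \<bar>P x\<bar> * (I (fst x) * J (snd x)) \<partial>tor2\<bar>" by simp
  also have "\<dots> \<le> sqrt (\<integral>x. \<bar>P x\<bar>\<^sup>2 \<partial>tor2) * sqrt (\<integral>x. (I (fst x) * J (snd x))\<^sup>2 \<partial>tor2)"
    using square_integrable(3) IJ2 by (intro Cauchy_Schwarz_integral_sqrt) auto
  also have "\<dots> = sqrt ((\<integral>x. (P x)\<^sup>2 \<partial>tor2) * (\<delta> * (b - a)))" unfolding IJ by (simp add: real_sqrt_mult)
  \<comment> \<open>A factor \<open>\<delta> \<le> 1\<close> is discarded under the root; this is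
    why the final estimate divides by \<open>\<delta>\<close> and not by its root.\<close>
  also have "\<dots> \<le> sqrt (N * (b - a))"
  proof (intro real_sqrt_le_mono mult_mono P_bound N_nonneg)
    show "\<delta> * (b - a) \<le> b - a" using mult_right_mono[OF d(2), of "b - a"] ab by simp
  qed (use d ab in auto)
  finally have "L \<le> 2 * sqrt (3 * M * \<delta>) + sqrt (N * (b - a)) / \<delta>"
    using d by (simp add: field_simps)
  thus ?thesis by (simp add: L_def)
qed

lemma U_diff2':
  assumes "t \<in> {0..1}" "t' \<in> {0..1}" "s \<in> {0..1}" "0 < \<delta>" "\<delta> \<le> 1"
  shows "\<bar>U (s, t) - U (s, t')\<bar> \<le> 2 * sqrt (3 * M * \<delta>) + sqrt (N * \<bar>t - t'\<bar>) / \<delta>"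
  using U_diff2[of t t' s \<delta>] U_diff2[of t' t s \<delta>] assms by (cases "t \<le> t'") (auto simp: abs_minus_commute)

text \<open>\<open>\<delta>\<close> stays free so that it can be fixed first, to make the middle
  term small, before the distance of \<open>x\<close> and \<open>y\<close> is restricted in terms of
  it.\<close>

lemma U_modulus:
  assumes "x \<in> {0..1} \<times> {0..1}" "y \<in> {0..1} \<times> {0..1}" "0 < \<delta>" "\<delta> \<le> 1"
  shows "\<bar>U x - U y\<bar> \<le> sqrt (3 * M * norm (x - y)) + (2 * sqrt (3 * M * \<delta>) + sqrt (N * norm (x - y)) / \<delta>)"
proof -
  obtain s t s' t' where xy: "x = (s, t)" "y = (s', t')" by (cases x, cases y)
  have n: "\<bar>s - s'\<bar> \<le> norm (x - y)" "\<bar>t - t'\<bar> \<le> norm (x - y)"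
    using norm_fst_le[of "s - s'" "t - t'"] norm_snd_le[of "t - t'" "s - s'"] by (auto simp: xy)
  have "\<bar>U x - U y\<bar> \<le> \<bar>U (s, t) - U (s', t)\<bar> + \<bar>U (s', t) - U (s', t')\<bar>" by (simp add: xy)
  also have "\<dots> \<le> sqrt (3 * M * \<bar>s - s'\<bar>) + (2 * sqrt (3 * M * \<delta>) + sqrt (N * \<bar>t - t'\<bar>) / \<delta>)"
    using assms by (intro add_mono U_diff1' U_diff2') (auto simp: xy)
  also have "\<dots> \<le> sqrt (3 * M * norm (x - y)) + (2 * sqrt (3 * M * \<delta>) + sqrt (N * norm (x - y)) / \<delta>)"
    using n M_nonneg N_nonneg assms
    by (intro add_mono order_refl divide_right_mono real_sqrt_le_mono mult_left_mono) auto
  finally show ?thesis .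
qed

text \<open>On the square distances are at most 2, so \<open>U_modulus\<close> with
  \<open>\<delta> = 1\<close> bounds the oscillation. The mean has to enter separately, because the
  hypotheses see derivatives only and ignore additive constants.\<close>

lemma U_bound:
  assumes "x \<in> {0..1} \<times> {0..1}"
  shows "\<bar>U x\<bar> \<le> \<bar>\<integral>x. U x \<partial>tor2\<bar> + (3 * sqrt (6 * M) + sqrt (2 * N))"
proof -
  have osc: "\<bar>U x - U y\<bar> \<le> 3 * sqrt (6 * M) + sqrt (2 * N)" if "y \<in> torus2" for y
  proof -
    have y: "y \<in> {0..1} \<times> {0..1}" using that by (auto simp: torus2_def)
    have "norm (x - y) \<le> \<bar>fst (x - y)\<bar> + \<bar>snd (x - y)\<bar>" using norm_Pair_le[of "fst (x - y)" "snd (x - y)"] by (simp add: minus_prod_def)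
    also have "\<dots> \<le> 2" using assms y by auto
    finally have n: "norm (x - y) \<le> 2" .
    have *: "sqrt (3 * M * norm (x - y)) \<le> sqrt (6 * M)" "sqrt (N * norm (x - y)) \<le> sqrt (2 * N)" "sqrt (3 * M) \<le> sqrt (6 * M)"
      using mult_left_mono[OF n, of "3 * M"] mult_left_mono[OF n, of N] M_nonneg N_nonneg
      by (intro real_sqrt_le_mono; simp)+
    have "\<bar>U x - U y\<bar> \<le> sqrt (3 * M * norm (x - y)) + (2 * sqrt (3 * M) + sqrt (N * norm (x - y)))"
      using U_modulus[OF assms y, of 1] by simp
    with * show ?thesis by linarith
  qed
  have "\<bar>\<integral>y. U x - U y \<partial>tor2\<bar> \<le> (\<integral>y. \<bar>U x - U y\<bar> \<partial>tor2)" by (rule integral_abs_bound)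
  also have "\<dots> \<le> (\<integral>y. 3 * sqrt (6 * M) + sqrt (2 * N) \<partial>tor2)"
    using trig_integrable[OF U] osc by (intro integral_mono_AE AE_tor2_torusI) auto
  also have "\<dots> = 3 * sqrt (6 * M) + sqrt (2 * N)" by simp
  finally have "\<bar>\<integral>y. U x - U y \<partial>tor2\<bar> \<le> 3 * sqrt (6 * M) + sqrt (2 * N)" .
  moreover have "U x = (\<integral>y. U y \<partial>tor2) + (\<integral>y. U x - U y \<partial>tor2)"
    using trig_integrable[OF U] by simp
  ultimately show ?thesis by linarith
qed

end

section \<open>Compactness\<close>

lemma periodic2_of_int:
  assumes "periodic2 f"
  shows "f (s + of_int m, t + of_int n) = f (s, t)"
proof -
  have 1: "f (s + of_int m, t) = f (s, t)" for s t m
  proof (induction m rule: int_induct[where k=0])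
    case (step1 i)
    thus ?case using assms by (simp add: periodic2_def add.assoc[symmetric])
  next
    case (step2 i)
    have "s + of_int (i - 1) + 1 = s + of_int i" by simp
    hence "f (s + of_int i, t) = f (s + of_int (i - 1), t)" using assms unfolding periodic2_def by metis
    thus ?case using step2 by (simp only:)
  qed simp
  have 2: "f (s, t + of_int n) = f (s, t)" for s t n
  proof (induction n rule: int_induct[where k=0])
    case (step1 i)
    thus ?case using assms by (simp add: periodic2_def add.assoc[symmetric])
  next
    case (step2 i)
    have "t + of_int (i - 1) + 1 = t + of_int i" by simp
    hence "f (s, t + of_int i) = f (s, t + of_int (i - 1))" using assms unfolding periodic2_def by metis
    thus ?case using step2 by (simp only:)
  qed simp
  show ?thesis by (simp only: 1 2)
qed

definition frac2 :: "real \<times> real \<Rightarrow> real \<times> real" where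
  "frac2 x = (frac (fst x), frac (snd x))"

lemma frac2_torus: "frac2 x \<in> torus2"
  by (simp add: frac2_def torus2_def frac_lt_1)

lemma periodic2_frac2:
  assumes "periodic2 f"
  shows "f (frac2 x) = f x"
  using periodic2_of_int[OF assms, of "fst x" "- \<lfloor>fst x\<rfloor>" "snd x" "- \<lfloor>snd x\<rfloor>"]
  by (simp add: frac2_def frac_def)

lemma periodic2_frac2I: "periodic2 (\<lambda>x. f (frac2 x))"
  by (simp add: periodic2_def frac2_def frac_1_eq)

text \<open>The summand 1 keeps the denominator positive when \<open>c = 0\<close>.\<close>

lemma sqrt_mult_less:
  assumes "0 \<le> c" "0 \<le> z" "z < r\<^sup>2 / (c + 1)" "0 < r"
  shows "sqrt (c * z) < r"
proof -
  have "c * z \<le> (c + 1) * z" using assms by (intro mult_right_mono) auto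
  also have "\<dots> < r\<^sup>2" using assms by (simp add: pos_less_divide_eq mult.commute)
  finally have "sqrt (c * z) < sqrt (r\<^sup>2)" by (rule real_sqrt_less_mono)
  thus ?thesis using assms by simp
qed

lemma trig_functions_equicontinuous:
  assumes F: "\<And>n. trig_function_bounded (F n) M" and e: "e > 0"
  shows "\<exists>d>0. \<forall>n. \<forall>x\<in>{0..1} \<times> {0..1}. \<forall>y\<in>{0..1} \<times> {0..1}. norm (x - y) < d \<longrightarrow> \<bar>F n x - F n y\<bar> < e"
proof -
  define N where "N = trig_function_bounded.N M"
  have M: "0 \<le> M" using trig_function_bounded.M_nonneg[OF F] .
  have N: "0 \<le> N" using trig_function_bounded.N_nonneg[OF F] by (simp add: N_def)
  \<comment> \<open>Order of choice: \<open>\<delta>\<close> below \<open>z\<close> brings twice the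
    middle root under \<open>e / 3\<close>; then \<open>d\<close>, which depends on
    \<open>\<delta>\<close>, does the same for each of the two remaining terms.\<close>
  define z where "z = (e / 6)\<^sup>2 / (3 * M + 1)"
  define \<delta> where "\<delta> = min 1 (z / 2)"
  have "0 < z" using e M by (simp add: z_def)
  hence "0 < \<delta>" "\<delta> \<le> 1" "\<delta> < z" by (auto simp: \<delta>_def)
  hence \<delta>: "0 < \<delta>" "\<delta> \<le> 1" "\<delta> < (e / 6)\<^sup>2 / (3 * M + 1)" by (simp_all add: z_def)
  define d where "d = min ((e / 3)\<^sup>2 / (3 * M + 1)) ((\<delta> * e / 3)\<^sup>2 / (N + 1))"
  have d: "d > 0" using e M N \<delta> by (simp add: d_def)
  have "\<bar>F n x - F n y\<bar> < e" if xy: "x \<in> {0..1} \<times> {0..1}" "y \<in> {0..1} \<times> {0..1}" "norm (x - y) < d" for n x y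
  proof -
    have "sqrt (3 * M * norm (x - y)) < e / 3"
      using xy(3) e M by (intro sqrt_mult_less) (auto simp: d_def)
    moreover have "sqrt (3 * M * \<delta>) < e / 6"
      using \<delta> e M by (intro sqrt_mult_less) auto
    moreover have "sqrt (N * norm (x - y)) < \<delta> * e / 3"
      using xy(3) e N \<delta> by (intro sqrt_mult_less) (auto simp: d_def)
    hence "sqrt (N * norm (x - y)) / \<delta> < e / 3" using \<delta> by (simp add: pos_divide_less_eq mult.commute)
    moreover have "\<bar>F n x - F n y\<bar> \<le> sqrt (3 * M * norm (x - y)) + (2 * sqrt (3 * M * \<delta>) + sqrt (N * norm (x - y)) / \<delta>)"
      unfolding N_def by (rule trig_function_bounded.U_modulus[OF F xy(1,2) \<delta>(1,2)])
    ultimately show ?thesis by linarith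
  qed
  with d show ?thesis by (intro exI[of _ d]) simp
qed

lemma trig_functions_uniform_limit:
  fixes F :: "nat \<Rightarrow> real \<times> real \<Rightarrow> real"
  assumes F: "\<And>n. trig_function_bounded (F n) M" and L: "\<And>n. \<bar>\<integral>x. F n x \<partial>tor2\<bar> \<le> L"
  shows "\<exists>k u. strict_mono k \<and> periodic2 u \<and> continuous_on UNIV u \<and> uniform_limit UNIV (\<lambda>n. F (k n)) u sequentially"
proof -
  define N where "N = trig_function_bounded.N M"
  have Ft: "F n \<in> trig" for n using F[of n] by (simp add: trig_function_bounded_def trig_function_def)
  have per: "periodic2 (F n)" for n by (intro trig_periodic Ft)
  have "\<exists>g k. strict_mono (k :: nat \<Rightarrow> nat) \<and>
    (\<forall>e>0. \<exists>N. \<forall>n x. n \<ge> N \<and> x \<in> {0..1} \<times> {0..1} \<longrightarrow> norm (F (k n) x - g x) < e)"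
  proof (rule Arzela_Ascoli[of "{0..1} \<times> {0..1}" F "L + (3 * sqrt (6 * M) + sqrt (2 * N))"])
    show "compact ({0..1} \<times> {0..1} :: (real \<times> real) set)" by (intro compact_Times) auto
    show "norm (F n x) \<le> L + (3 * sqrt (6 * M) + sqrt (2 * N))" if "x \<in> {0..1} \<times> {0..1}" for n x
      using trig_function_bounded.U_bound[OF F that, of n] L[of n] unfolding N_def by simp
    show "\<exists>d>0. \<forall>n y. y \<in> {0..1} \<times> {0..1} \<and> norm (x - y) < d \<longrightarrow> norm (F n x - F n y) < e"
      if x: "x \<in> {0..1} \<times> {0..1}" and e: "0 < e" for x e
    proof -
      obtain d where d: "d > 0" "\<forall>n. \<forall>x\<in>{0..1} \<times> {0..1}. \<forall>y\<in>{0..1} \<times> {0..1}. norm (x - y) < d \<longrightarrow> \<bar>F n x - F n y\<bar> < e"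
        using trig_functions_equicontinuous[of F M e, OF F e] by blast
      show ?thesis
      proof (intro exI[of _ d] conjI allI impI)
        fix n y assume y: "y \<in> {0..1} \<times> {0..1} \<and> norm (x - y) < d"
        have "\<bar>F n x - F n y\<bar> < e" using d(2)[rule_format, OF x conjunct1[OF y] conjunct2[OF y]] .
        thus "norm (F n x - F n y) < e" by simp
      qed (rule d(1))
    qed
    fix g and k :: "nat \<Rightarrow> nat"
    assume "strict_mono k" and l: "\<And>e. 0 < e \<Longrightarrow> \<exists>N. \<forall>n x. n \<ge> N \<and> x \<in> {0..1} \<times> {0..1} \<longrightarrow> norm (F (k n) x - g x) < e"
    thus "\<exists>g k. strict_mono (k :: nat \<Rightarrow> nat) \<and>
      (\<forall>e>0. \<exists>N. \<forall>n x. n \<ge> N \<and> x \<in> {0..1} \<times> {0..1} \<longrightarrow> norm (F (k n) x - g x) < e)"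
      by (intro exI[of _ g] exI[of _ k] conjI allI impI l)
  qed
  then obtain g and k :: "nat \<Rightarrow> nat" where k: "strict_mono k"
    and l: "\<forall>e>0. \<exists>N. \<forall>n x. n \<ge> N \<and> x \<in> {0..1} \<times> {0..1} \<longrightarrow> norm (F (k n) x - g x) < e"
    by (elim exE conjE)
  \<comment> \<open>Values of \<open>g\<close> on the half-open square are extended periodically.
    Continuity across the seams comes from uniform convergence of the periodic functions on the
    whole plane.\<close>
  define u where "u x = g (frac2 x)" for x
  have sq: "frac2 x \<in> {0..1} \<times> {0..1}" for x using frac2_torus[of x] by (auto simp: torus2_def)
  have ul: "uniform_limit UNIV (\<lambda>n. F (k n)) u sequentially"
  proof (rule uniform_limitI)
    fix e :: real assume "e > 0"
    from l this obtain N where N: "\<forall>n x. n \<ge> N \<and> x \<in> {0..1} \<times> {0..1} \<longrightarrow> norm (F (k n) x - g x) < e"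
      by (elim allE[of _ e] impE exE)
    show "\<forall>\<^sub>F n in sequentially. \<forall>x\<in>UNIV. dist (F (k n) x) (u x) < e"
    proof (intro eventually_sequentiallyI[of N] ballI)
      fix n x assume "N \<le> n"
      hence "norm (F (k n) (frac2 x) - g (frac2 x)) < e" using N sq by blast
      thus "dist (F (k n) x) (u x) < e" using periodic2_frac2[OF per, of "k n" x] by (simp add: u_def dist_norm)
    qed
  qed
  have "continuous_on UNIV u"
    by (rule uniform_limit_theorem[OF _ ul]) (auto intro!: always_eventually trig_continuous Ft)
  moreover have "periodic2 u" unfolding u_def by (rule periodic2_frac2I)
  ultimately show ?thesis using k ul by blast
qed

section \<open>Strong convergence of the first derivatives\<close>

lemma trig_interpolation:
  assumes f: "f \<in> trig"
  shows "(\<integral>x. (dir_deriv e1 f x)\<^sup>2 \<partial>tor2) = - (\<integral>x. f x * dir_deriv e1 (dir_deriv e1 f) x \<partial>tor2)"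
  using integration_by_parts_test[OF trig_test[OF trig_derivs(1)[OF f]] trig_test[OF f], of e1]
  by (simp add: power2_eq_square)

lemma integral_abs_le_square:
  fixes f :: "real \<times> real \<Rightarrow> real"
  assumes [measurable]: "f \<in> borel_measurable borel" and f: "integrable tor2 (\<lambda>x. (f x)\<^sup>2)"
  shows "(\<integral>x. \<bar>f x\<bar> \<partial>tor2) \<le> sqrt (\<integral>x. (f x)\<^sup>2 \<partial>tor2)"
  using Cauchy_Schwarz_integral_sqrt[of "\<lambda>x. \<bar>f x\<bar>" tor2 "\<lambda>_. 1"] f by simp

text \<open>For a difference \<open>G\<close> of two members, \<open>trig_interpolation\<close>
  pairs the uniformly small \<open>G\<close> with second derivatives whose L1 norms are at most
  \<open>sqrt M\<close> each.\<close>

lemma trig_derivs_Cauchy: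
  assumes F: "\<And>n. trig_function_bounded (F n) M" and ul: "uniform_limit UNIV F u sequentially" and e: "e > 0"
  shows "\<exists>N. \<forall>m\<ge>N. \<forall>n\<ge>N. (\<integral>x. (dir_deriv e1 (F m) x - dir_deriv e1 (F n) x)\<^sup>2 \<partial>tor2) < e"
proof -
  have Ft: "F n \<in> trig" for n using F[of n] by (simp add: trig_function_bounded_def trig_function_def)
  have M: "0 \<le> M" using trig_function_bounded.M_nonneg[OF F] .
  \<comment> \<open>The summand 1 keeps \<open>q\<close> positive. With \<open>G\<close> bounded by
    \<open>2 * c\<close> the estimate ends at \<open>4 * c * sqrt M\<close>, which is below
    \<open>8 * c * q = e\<close>.\<close>
  define q where "q = sqrt M + 1"
  have q: "q > 0" using M by (simp add: q_def add_nonneg_pos)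
  define c where "c = e / (8 * q)"
  have c: "c > 0" using e q by (simp add: c_def)
  obtain N where N: "\<forall>n\<ge>N. \<forall>x. dist (F n x) (u x) < c"
    using uniform_limitD[OF ul c] by (auto simp: eventually_sequentially)
  have H: "(\<integral>x. \<bar>dir_deriv e1 (dir_deriv e1 (F n)) x\<bar> \<partial>tor2) \<le> sqrt M"
    and Hi: "integrable tor2 (\<lambda>x. \<bar>dir_deriv e1 (dir_deriv e1 (F n)) x\<bar>)" for n
  proof -
    have t: "dir_deriv e1 (dir_deriv e1 (F n)) \<in> trig" by (intro trig_derivs Ft)
    have "(\<integral>x. \<bar>dir_deriv e1 (dir_deriv e1 (F n)) x\<bar> \<partial>tor2) \<le> sqrt (\<integral>x. (dir_deriv e1 (dir_deriv e1 (F n)) x)\<^sup>2 \<partial>tor2)"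
      by (intro integral_abs_le_square trig_measurable trig_integrable trig_power t)
    also have "\<dots> \<le> sqrt M" by (intro real_sqrt_le_mono trig_function_bounded.H_bound F)
    finally show "(\<integral>x. \<bar>dir_deriv e1 (dir_deriv e1 (F n)) x\<bar> \<partial>tor2) \<le> sqrt M" .
    show "integrable tor2 (\<lambda>x. \<bar>dir_deriv e1 (dir_deriv e1 (F n)) x\<bar>)"
      by (intro integrable_abs trig_integrable t)
  qed
  have "(\<integral>x. (dir_deriv e1 (F m) x - dir_deriv e1 (F n) x)\<^sup>2 \<partial>tor2) < e" if mn: "m \<ge> N" "n \<ge> N" for m n
  proof -
    define G where "G x = F m x + (- 1) * F n x" for x
    have G: "G \<in> trig" unfolding G_def by (intro trig_add trig_scale Ft)
    have D: "dir_deriv e1 G = (\<lambda>x. dir_deriv e1 (F m) x + (- 1) * dir_deriv e1 (F n) x)"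
      unfolding G_def by (simp only: dir_deriv_add_trig dir_deriv_scale_trig Ft trig_scale)
    have DD: "dir_deriv e1 (dir_deriv e1 G) = (\<lambda>x. dir_deriv e1 (dir_deriv e1 (F m)) x + (- 1) * dir_deriv e1 (dir_deriv e1 (F n)) x)"
      unfolding D by (simp only: dir_deriv_add_trig dir_deriv_scale_trig Ft trig_scale trig_derivs(1))
    have Gc: "\<bar>G x\<bar> \<le> 2 * c" for x
    proof -
      have "dist (F m x) (u x) < c" "dist (F n x) (u x) < c" using N mn by blast+
      thus ?thesis unfolding G_def dist_real_def by linarith
    qed
    have "(\<integral>x. (dir_deriv e1 (F m) x - dir_deriv e1 (F n) x)\<^sup>2 \<partial>tor2) = - (\<integral>x. G x * dir_deriv e1 (dir_deriv e1 G) x \<partial>tor2)"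
      using trig_interpolation[OF G] by (simp add: D)
    also have "\<dots> \<le> \<bar>\<integral>x. G x * dir_deriv e1 (dir_deriv e1 G) x \<partial>tor2\<bar>" by simp
    also have "\<dots> \<le> (\<integral>x. \<bar>G x * dir_deriv e1 (dir_deriv e1 G) x\<bar> \<partial>tor2)" by (rule integral_abs_bound)
    also have "\<dots> \<le> (\<integral>x. 2 * c * (\<bar>dir_deriv e1 (dir_deriv e1 (F m)) x\<bar> + \<bar>dir_deriv e1 (dir_deriv e1 (F n)) x\<bar>) \<partial>tor2)"
    proof (rule integral_mono)
      show "integrable tor2 (\<lambda>x. \<bar>G x * dir_deriv e1 (dir_deriv e1 G) x\<bar>)"
        by (intro integrable_abs trig_integrable trig_mult G trig_derivs(1))
      show "integrable tor2 (\<lambda>x. 2 * c * (\<bar>dir_deriv e1 (dir_deriv e1 (F m)) x\<bar> + \<bar>dir_deriv e1 (dir_deriv e1 (F n)) x\<bar>))"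
        by (intro integrable_mult_right Bochner_Integration.integrable_add Hi)
      fix x
      have "\<bar>dir_deriv e1 (dir_deriv e1 G) x\<bar> \<le> \<bar>dir_deriv e1 (dir_deriv e1 (F m)) x\<bar> + \<bar>dir_deriv e1 (dir_deriv e1 (F n)) x\<bar>"
        unfolding DD by simp
      thus "\<bar>G x * dir_deriv e1 (dir_deriv e1 G) x\<bar> \<le> 2 * c * (\<bar>dir_deriv e1 (dir_deriv e1 (F m)) x\<bar> + \<bar>dir_deriv e1 (dir_deriv e1 (F n)) x\<bar>)"
        unfolding abs_mult using Gc c by (intro mult_mono) auto
    qed
    also have "\<dots> = 2 * c * ((\<integral>x. \<bar>dir_deriv e1 (dir_deriv e1 (F m)) x\<bar> \<partial>tor2) + (\<integral>x. \<bar>dir_deriv e1 (dir_deriv e1 (F n)) x\<bar> \<partial>tor2))"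
      using Hi by simp
    also have "\<dots> \<le> 2 * c * (sqrt M + sqrt M)"
      using c H by (intro mult_left_mono add_mono) auto
    also have "\<dots> < 8 * c * q"
    proof -
      have "0 \<le> c * sqrt M" using c M by simp
      thus ?thesis using c by (simp add: q_def algebra_simps)
    qed
    also have "\<dots> = e" using q by (simp add: c_def)
    finally show ?thesis .
  qed
  thus ?thesis by blast
qed

section \<open>Fatou's lemma and completeness\<close>

lemma Fatou_real:
  fixes h :: "nat \<Rightarrow> 'a \<Rightarrow> real"
  assumes [measurable]: "\<And>n. h n \<in> borel_measurable M" "g \<in> borel_measurable M"
    and h: "\<And>n. integrable M (h n)" "\<And>n x. 0 \<le> h n x" "\<And>n. (\<integral>x. h n x \<partial>M) \<le> C"
    and lim: "AE x in M. (\<lambda>n. h n x) \<longlonglongrightarrow> g x"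
  shows "integrable M g" "(\<integral>x. g x \<partial>M) \<le> C"
proof -
  have C: "0 \<le> C" using h(3)[of 0] h(2) by (intro order_trans[OF _ h(3)[of 0]]) simp
  have g0: "AE x in M. 0 \<le> g x"
    using lim by eventually_elim (use h(2) in \<open>auto intro: LIMSEQ_le_const\<close>)
  have "(\<integral>\<^sup>+x. ennreal (g x) \<partial>M) = (\<integral>\<^sup>+x. liminf (\<lambda>n. ennreal (h n x)) \<partial>M)"
  proof (rule nn_integral_cong_AE)
    show "AE x in M. ennreal (g x) = liminf (\<lambda>n. ennreal (h n x))"
      using lim
    proof eventually_elim
      case (elim x)
      have "(\<lambda>n. ennreal (h n x)) \<longlonglongrightarrow> ennreal (g x)" using elim by (rule tendsto_ennrealI)
      thus ?case using lim_imp_Liminf[OF sequentially_bot] by metis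
    qed
  qed
  also have "\<dots> \<le> liminf (\<lambda>n. \<integral>\<^sup>+x. ennreal (h n x) \<partial>M)"
    by (rule nn_integral_liminf) measurable
  also have "\<dots> \<le> ennreal C"
  proof (rule Liminf_le)
    show "\<forall>\<^sub>F n in sequentially. (\<integral>\<^sup>+x. ennreal (h n x) \<partial>M) \<le> ennreal C"
      using h by (intro always_eventually allI) (simp add: nn_integral_eq_integral ennreal_leI)
  qed simp
  finally have le: "(\<integral>\<^sup>+x. ennreal (g x) \<partial>M) \<le> ennreal C" .
  show gi: "integrable M g"
    using g0 le by (intro integrableI_nonneg) (auto simp: less_top[symmetric] top_unique)
  show "(\<integral>x. g x \<partial>M) \<le> C"
    using le C g0 nn_integral_eq_integral[OF gi g0] by (simp add: ennreal_le_iff)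
qed

text \<open>The Riesz-Fischer theorem with both outputs that the limit passage needs: L2 convergence
  of the whole sequence and convergence almost everywhere along a subsequence.\<close>

lemma L2_torus_complete:
  fixes f :: "nat \<Rightarrow> real \<times> real \<Rightarrow> real"
  assumes f: "\<And>n. f n \<in> L2_torus"
    and Cauchy: "\<And>e. e > 0 \<Longrightarrow> \<exists>N. \<forall>m\<ge>N. \<forall>n\<ge>N. (\<integral>x. (f m x - f n x)\<^sup>2 \<partial>tor2) < e"
  shows "\<exists>r g. strict_mono r \<and> g \<in> L2_torus \<and> (AE x in tor2. (\<lambda>n. f (r n) x) \<longlonglongrightarrow> g x)
     \<and> (\<lambda>n. \<integral>x. (f n x - g x)\<^sup>2 \<partial>tor2) \<longlonglongrightarrow> 0"
proof -
  note fD = L2_torusD[OF f]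
  note [measurable] = fD(2)
  have sqd: "integrable tor2 (\<lambda>x. (f m x - f n x)\<^sup>2)" for m n
    using fD by (intro square_integrable_diff) auto
  \<comment> \<open>The rate is chosen for its root: successive increments along the subsequence
    have L1 norms at most \<open>(1 / 2) ^ n\<close>, which are summable.\<close>
  have "\<forall>i. \<exists>N. \<forall>m\<ge>N. \<forall>n\<ge>N. (\<integral>x. (f m x - f n x)\<^sup>2 \<partial>tor2) < (1 / 4) ^ i"
    by (intro allI Cauchy) simp
  from choice[OF this] obtain N where "\<forall>i. \<forall>m\<ge>N i. \<forall>n\<ge>N i. (\<integral>x. (f m x - f n x)\<^sup>2 \<partial>tor2) < (1 / 4) ^ i" ..
  hence N: "N i \<le> m \<Longrightarrow> N i \<le> n \<Longrightarrow> (\<integral>x. (f m x - f n x)\<^sup>2 \<partial>tor2) < (1 / 4) ^ i" for i m n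
    by simp
  \<comment> \<open>The sum guarantees \<open>r n \<ge> N n\<close>, the summand \<open>n\<close>
    strict growth.\<close>
  define r where "r n = n + (\<Sum>i\<le>n. N i)" for n
  have r: "strict_mono r" by (rule strict_monoI_Suc) (simp add: r_def)
  have rN: "N n \<le> r n" for n
    using member_le_sum[of n "{..n}" N] by (simp add: r_def)
  have rN': "N n \<le> r (Suc n)" for n
    using rN[of n] strict_monoD[OF r, of n "Suc n"] by simp
  define d where "d n x = \<bar>f (r (Suc n)) x - f (r n) x\<bar>" for n x
  have [measurable]: "d n \<in> borel_measurable borel" for n unfolding d_def by measurable
  have di: "integrable tor2 (d n)" for n
    unfolding d_def by (intro integrable_abs Bochner_Integration.integrable_diff
        integrable_if_square_integrable[OF fD(2,3)])
  have dle: "(\<integral>x. d n x \<partial>tor2) \<le> (1 / 2) ^ n" for n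
  proof -
    have "(\<integral>x. d n x \<partial>tor2) \<le> sqrt (\<integral>x. (f (r (Suc n)) x - f (r n) x)\<^sup>2 \<partial>tor2)"
      unfolding d_def by (intro integral_abs_le_square sqd) measurable
    also have "\<dots> \<le> sqrt ((1 / 4) ^ n)" by (intro real_sqrt_le_mono less_imp_le N rN rN')
    also have "\<dots> = (1 / 2) ^ n" by (simp add: real_sqrt_power real_sqrt_divide)
    finally show ?thesis .
  qed
  have "(\<integral>\<^sup>+x. (\<Sum>n. ennreal (d n x)) \<partial>tor2) = (\<Sum>n. \<integral>\<^sup>+x. ennreal (d n x) \<partial>tor2)"
    by (rule nn_integral_suminf) measurable
  also have "\<dots> = (\<Sum>n. ennreal (\<integral>x. d n x \<partial>tor2))"
    by (intro suminf_cong nn_integral_eq_integral di) (simp add: d_def)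
  also have "\<dots> \<le> (\<Sum>n. ennreal ((1 / 2) ^ n))"
    by (intro suminf_le ennreal_leI dle) auto
  also have "\<dots> = ennreal (\<Sum>n. (1 / 2) ^ n)"
    by (intro suminf_ennreal2 summable_geometric) auto
  also have "\<dots> < \<infinity>" by simp
  finally have "AE x in tor2. (\<Sum>n. ennreal (d n x)) \<noteq> \<infinity>"
    by (intro nn_integral_PInf_AE) auto
  hence conv: "AE x in tor2. convergent (\<lambda>n. f (r n) x)"
  proof eventually_elim
    case (elim x)
    have "summable (\<lambda>n. d n x)"
      using elim by (intro summable_suminf_not_top) (auto simp: d_def)
    hence "summable (\<lambda>n. f (r (Suc n)) x - f (r n) x)"
      unfolding d_def by (rule summable_rabs_cancel)
    hence "(\<lambda>n. \<Sum>i<n. f (r (Suc i)) x - f (r i) x) \<longlonglongrightarrow> (\<Sum>n. f (r (Suc n)) x - f (r n) x)"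
      by (rule summable_LIMSEQ)
    hence "(\<lambda>n. f (r n) x - f (r 0) x) \<longlonglongrightarrow> (\<Sum>n. f (r (Suc n)) x - f (r n) x)"
      by (simp only: sum_lessThan_telescope[of "\<lambda>i. f (r i) x"])
    hence "(\<lambda>n. f (r n) x - f (r 0) x + f (r 0) x) \<longlonglongrightarrow> (\<Sum>n. f (r (Suc n)) x - f (r n) x) + f (r 0) x"
      by (intro tendsto_intros)
    hence "(\<lambda>n. f (r n) x) \<longlonglongrightarrow> (\<Sum>n. f (r (Suc n)) x - f (r n) x) + f (r 0) x" by simp
    thus ?case by (rule convergentI)
  qed
  \<comment> \<open>\<open>L2_torus\<close> asks for a Borel function that is periodic at every
    point. The set of convergence is Borel and periodic, so the default value 0 off it respects
    both.\<close>
  define g where "g x = (if Cauchy (\<lambda>n. f (r n) x) then lim (\<lambda>n. f (r n) x) else 0)" for x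
  have gm [measurable]: "g \<in> borel_measurable borel" unfolding g_def by (intro measurable_If borel_measurable_lim_metric sets_Collect_Cauchy) auto
  have lim: "AE x in tor2. (\<lambda>n. f (r n) x) \<longlonglongrightarrow> g x"
    using conv by eventually_elim (simp add: g_def Cauchy_convergent_iff convergent_LIMSEQ_iff)
  have gp: "periodic2 g"
    using fD(1) unfolding periodic2_def g_def by simp
  \<comment> \<open>Fatou's lemma along the subsequence for fixed \<open>m\<close>; the shift by
    \<open>i\<close> moves all its indices beyond \<open>N i\<close>.\<close>
  have close: "integrable tor2 (\<lambda>x. (f m x - g x)\<^sup>2) \<and> (\<integral>x. (f m x - g x)\<^sup>2 \<partial>tor2) \<le> (1 / 4) ^ i" if m: "m \<ge> N i" for m i
  proof -
    have le: "(\<integral>x. (f m x - f (r (n + i)) x)\<^sup>2 \<partial>tor2) \<le> (1 / 4) ^ i" for n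
    proof -
      have "N i \<le> r (n + i)" using rN[of i] strict_mono_leD[OF r, of i "n + i"] by simp
      thus ?thesis using N[OF m] by (simp add: less_imp_le)
    qed
    have l: "AE x in tor2. (\<lambda>n. (f m x - f (r (n + i)) x)\<^sup>2) \<longlonglongrightarrow> (f m x - g x)\<^sup>2"
      using lim by eventually_elim (intro tendsto_intros LIMSEQ_ignore_initial_segment)
    show ?thesis
      using Fatou_real[of "\<lambda>n x. (f m x - f (r (n + i)) x)\<^sup>2" tor2 "\<lambda>x. (f m x - g x)\<^sup>2", OF _ _ sqd _ le l] by simp
  qed
  have "integrable tor2 (\<lambda>x. (f (N 0) x - (f (N 0) x - g x))\<^sup>2)"
    using close[of 0 "N 0"] fD(2,3) by (intro square_integrable_diff[of "f (N 0)" tor2 "\<lambda>x. f (N 0) x - g x"]) auto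
  hence "g \<in> L2_torus" using gp gm by (intro L2_torusI) auto
  moreover have "(\<lambda>n. \<integral>x. (f n x - g x)\<^sup>2 \<partial>tor2) \<longlonglongrightarrow> 0"
  proof (rule LIMSEQ_I)
    fix e :: real assume "e > 0"
    then obtain i where i: "(1 / 4 :: real) ^ i < e"
      using real_arch_pow_inv[of e "1 / 4"] by auto
    show "\<exists>no. \<forall>n\<ge>no. norm ((\<integral>x. (f n x - g x)\<^sup>2 \<partial>tor2) - 0) < e"
    proof (intro exI[of _ "N i"] allI impI)
      fix n assume "N i \<le> n"
      from le_less_trans[OF conjunct2[OF close[OF this]] i]
      show "norm ((\<integral>x. (f n x - g x)\<^sup>2 \<partial>tor2) - 0) < e" by simp
    qed
  qed
  ultimately show ?thesis using r lim by (intro exI[of _ r] exI[of _ g] conjI)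
qed

section \<open>Convex combinations in place of weak limits\<close>

lemma parallelogram_midpoint:
  fixes a b :: "'a :: real_inner"
  shows "(norm (a - b))\<^sup>2 = 2 * (norm a)\<^sup>2 + 2 * (norm b)\<^sup>2 - 4 * (norm ((1 / 2) *\<^sub>R (a + b)))\<^sup>2"
proof -
  have "(norm ((1 / 2) *\<^sub>R (a + b)))\<^sup>2 = 1 / 4 * (norm (a + b))\<^sup>2"
    by (simp add: power_mult_distrib power_divide)
  moreover have "(norm (a - b))\<^sup>2 = 2 * (norm a)\<^sup>2 + 2 * (norm b)\<^sup>2 - (norm (a + b))\<^sup>2"
    unfolding power2_norm_eq_inner inner_add_left inner_add_right inner_diff_left inner_diff_right inner_commute[of b a]
    by simp
  ultimately show ?thesis by simp
qed

text \<open>Elements of nearly minimal norm in a decreasing sequence of midpoint-convex sets form a Cauchy sequence.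
  Applied to the convex hulls of the tails of a bounded sequence, this replaces weak compactness.\<close>

lemma near_minimal_Cauchy:
  fixes S :: "nat \<Rightarrow> (real \<times> real \<Rightarrow> 'b :: euclidean_space) set"
  assumes ne: "\<And>n. S n \<noteq> {}" and dec: "\<And>m n. m \<le> n \<Longrightarrow> S n \<subseteq> S m"
    and mid: "\<And>n f g. f \<in> S n \<Longrightarrow> g \<in> S n \<Longrightarrow> (\<lambda>x. (1 / 2) *\<^sub>R (f x + g x)) \<in> S n"
    and cont: "\<And>n f. f \<in> S n \<Longrightarrow> continuous_on UNIV f"
    and bound: "\<And>n f. f \<in> S n \<Longrightarrow> (\<integral>x. (norm (f x))\<^sup>2 \<partial>tor2) \<le> C"
  shows "\<exists>f. (\<forall>n. f n \<in> S n) \<and> (\<forall>e>0. \<exists>N. \<forall>m\<ge>N. \<forall>n\<ge>N. (\<integral>x. (norm (f m x - f n x))\<^sup>2 \<partial>tor2) < e)"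
proof -
  define \<nu> where "\<nu> f = (\<integral>x. (norm (f x))\<^sup>2 \<partial>tor2)" for f :: "real \<times> real \<Rightarrow> 'b"
  have \<nu>0: "0 \<le> \<nu> f" for f by (simp add: \<nu>_def)
  have bdd: "bdd_below (\<nu> ` S n)" for n using \<nu>0 by (intro bdd_belowI[of _ 0]) auto
  define d where "d n = Inf (\<nu> ` S n)" for n
  have d_le: "d n \<le> \<nu> f" if "f \<in> S n" for f n
    unfolding d_def using that bdd by (intro cInf_lower) auto
  have d_C: "d n \<le> C" for n
  proof -
    obtain f where "f \<in> S n" using ne by blast
    thus ?thesis using d_le[of f n] bound[of f n] by (simp add: \<nu>_def)
  qed
  have ex: "\<exists>f. f \<in> S n \<and> \<nu> f < d n + inverse (real (Suc n))" for n
  proof -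
    have "Inf (\<nu> ` S n) < d n + inverse (real (Suc n))" by (simp add: d_def)
    from cInf_lessD[OF _ this] ne show ?thesis by auto
  qed
  obtain f where f: "f n \<in> S n" "\<nu> (f n) < d n + inverse (real (Suc n))" for n
    using choice[of "\<lambda>n f. f \<in> S n \<and> \<nu> f < d n + inverse (real (Suc n))"] ex by auto
  have ni: "integrable tor2 (\<lambda>x. (norm (g x))\<^sup>2)" if "continuous_on UNIV g" for g :: "real \<times> real \<Rightarrow> 'b"
    by (intro integrable_tor2_continuous continuous_intros that)
  have par: "(\<integral>x. (norm (f m x - f n x))\<^sup>2 \<partial>tor2) = 2 * \<nu> (f m) + 2 * \<nu> (f n) - 4 * \<nu> (\<lambda>x. (1 / 2) *\<^sub>R (f m x + f n x))" for m n
  proof -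
    have c: "continuous_on UNIV (f m)" "continuous_on UNIV (f n)" "continuous_on UNIV (\<lambda>x. (1 / 2) *\<^sub>R (f m x + f n x))"
      using cont[OF f(1)] by (auto intro!: continuous_intros)
    have "(\<integral>x. (norm (f m x - f n x))\<^sup>2 \<partial>tor2) =
      (\<integral>x. 2 * (norm (f m x))\<^sup>2 + 2 * (norm (f n x))\<^sup>2 - 4 * (norm ((1 / 2) *\<^sub>R (f m x + f n x)))\<^sup>2 \<partial>tor2)"
      by (simp only: parallelogram_midpoint)
    also have "\<dots> = 2 * \<nu> (f m) + 2 * \<nu> (f n) - 4 * \<nu> (\<lambda>x. (1 / 2) *\<^sub>R (f m x + f n x))"
      unfolding \<nu>_def using ni[OF c(1)] ni[OF c(2)] ni[OF c(3)]
      by (simp only: Bochner_Integration.integral_diff Bochner_Integration.integral_add integral_mult_right_zero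
          Bochner_Integration.integrable_add integrable_mult_right)
    finally show ?thesis .
  qed
  have bdda: "bdd_above (range d)" using d_C by (intro bdd_aboveI[of _ C]) auto
  have "\<exists>N. \<forall>m\<ge>N. \<forall>n\<ge>N. (\<integral>x. (norm (f m x - f n x))\<^sup>2 \<partial>tor2) < e" if e: "e > 0" for e
  proof -
    have "Sup (range d) - e / 10 < Sup (range d)" using e by simp
    then obtain y where "y \<in> range d" "Sup (range d) - e / 10 < y"
      by (rule less_cSupE) simp
    then obtain N1 where N1: "Sup (range d) - e / 10 < d N1" by (elim rangeE) simp
    obtain N2 where N2: "inverse (real (Suc N2)) < e / 10"
      using reals_Archimedean[of "e / 10"] e by auto
    \<comment> \<open>\<open>N1\<close> nearly attains the supremum of the infima, which is finite
      because all of them are at most \<open>C\<close>. Late elements then exceed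
      \<open>d N1\<close> by at most \<open>e / 10 + e / 10\<close>, while their midpoints lie in
      \<open>S N1\<close> and do not fall below \<open>d N1\<close>; the parallelogram identity
      leaves at most \<open>4 * e / 5\<close>.\<close>
    have *: "\<nu> (f n) \<le> d N1 + e / 5" if n: "n \<ge> max N1 N2" for n
    proof -
      have "d n \<le> Sup (range d)" using bdda by (intro cSup_upper) auto
      moreover have "inverse (real (Suc n)) \<le> inverse (real (Suc N2))" using n by (simp add: le_imp_inverse_le)
      ultimately show ?thesis using f(2)[of n] N1 N2 by linarith
    qed
    have "(\<integral>x. (norm (f m x - f n x))\<^sup>2 \<partial>tor2) < e" if mn: "m \<ge> max N1 N2" "n \<ge> max N1 N2" for m n
    proof -
      have "N1 \<le> m" "N1 \<le> n" using mn by auto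
      hence "f m \<in> S N1" "f n \<in> S N1"
        using f(1)[of m] f(1)[of n] dec[of N1 m] dec[of N1 n] by blast+
      hence "d N1 \<le> \<nu> (\<lambda>x. (1 / 2) *\<^sub>R (f m x + f n x))" by (intro d_le mid)
      hence "2 * \<nu> (f m) + 2 * \<nu> (f n) - 4 * \<nu> (\<lambda>x. (1 / 2) *\<^sub>R (f m x + f n x)) \<le>
          2 * (d N1 + e / 5) + 2 * (d N1 + e / 5) - 4 * d N1"
        by (intro diff_mono add_mono mult_left_mono *[OF mn(1)] *[OF mn(2)]) simp_all
      also have "\<dots> < e" using e by simp
      finally show ?thesis unfolding par .
    qed
    thus ?thesis by (intro exI[of _ "max N1 N2"] allI impI)
  qed
  thus ?thesis using f(1) by (intro exI[of _ f] conjI allI impI)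
qed

text \<open>Dyadic convex combinations of the tail from index \<open>n\<close>. Midpoints are what
  the parallelogram argument consumes, and generating the hull by them replaces bookkeeping of
  coefficients by induction.\<close>

inductive_set midpoint_hull :: "(nat \<Rightarrow> 'a \<Rightarrow> 'b :: real_vector) \<Rightarrow> nat \<Rightarrow> ('a \<Rightarrow> 'b) set"
  for F :: "nat \<Rightarrow> 'a \<Rightarrow> 'b" and n :: nat where
  base: "n \<le> k \<Longrightarrow> F k \<in> midpoint_hull F n"
| mid: "f \<in> midpoint_hull F n \<Longrightarrow> g \<in> midpoint_hull F n \<Longrightarrow> (\<lambda>x. (1 / 2) *\<^sub>R (f x + g x)) \<in> midpoint_hull F n"

lemma midpoint_hull_antimono: "m \<le> n \<Longrightarrow> midpoint_hull F n \<subseteq> midpoint_hull F m"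
proof
  fix f assume "m \<le> n" "f \<in> midpoint_hull F n"
  from this(2,1) show "f \<in> midpoint_hull F m"
    by induction (auto intro: midpoint_hull.intros)
qed

text \<open>The general principle behind the transfer of bounds from the sequence to its
  combinations; \<open>\<Phi>\<close> will be the squared norm, the energy, and the distance of a
  component at a point from a fixed number.\<close>

lemma midpoint_hull_convex:
  assumes "f \<in> midpoint_hull F n"
    and "\<And>k. n \<le> k \<Longrightarrow> \<Phi> (F k) \<le> (c :: real)"
    and "\<And>f g. f \<in> midpoint_hull F n \<Longrightarrow> g \<in> midpoint_hull F n \<Longrightarrow> \<Phi> (\<lambda>x. (1 / 2) *\<^sub>R (f x + g x)) \<le> (\<Phi> f + \<Phi> g) / 2"
  shows "\<Phi> f \<le> c"
  using assms(1)
proof induction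
  case (base k)
  thus ?case by (rule assms(2))
next
  case (mid f g)
  thus ?case using assms(3)[of f g] by simp
qed

lemma midpoint_hull_continuous:
  fixes F :: "nat \<Rightarrow> 'a :: topological_space \<Rightarrow> 'b :: real_normed_vector"
  assumes "f \<in> midpoint_hull F n" "\<And>k. continuous_on UNIV (F k)"
  shows "continuous_on UNIV f"
  using assms(1) by induction (auto intro!: continuous_intros assms(2))

lemma norm_midpoint_square_le:
  fixes a b :: "'a :: real_inner"
  shows "(norm ((1 / 2) *\<^sub>R (a + b)))\<^sup>2 \<le> ((norm a)\<^sup>2 + (norm b)\<^sup>2) / 2"
proof -
  have "0 \<le> 2 * (norm a)\<^sup>2 + 2 * (norm b)\<^sup>2 - 4 * (norm ((1 / 2) *\<^sub>R (a + b)))\<^sup>2"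
    unfolding parallelogram_midpoint[symmetric] by simp
  thus ?thesis by (simp add: field_simps)
qed

text \<open>Values in a Euclidean space allow one combination to act on all components of a tuple.
  Separate combinations for separate components would destroy the relations between a function and
  its derivatives.\<close>

lemma ex_Cauchy_midpoint_hull:
  fixes F :: "nat \<Rightarrow> real \<times> real \<Rightarrow> 'b :: euclidean_space"
  assumes cont: "\<And>k. continuous_on UNIV (F k)" and bound: "\<And>k. (\<integral>x. (norm (F k x))\<^sup>2 \<partial>tor2) \<le> C"
  shows "\<exists>f. (\<forall>n. f n \<in> midpoint_hull F n) \<and> (\<forall>e>0. \<exists>N. \<forall>m\<ge>N. \<forall>n\<ge>N. (\<integral>x. (norm (f m x - f n x))\<^sup>2 \<partial>tor2) < e)"
proof (rule near_minimal_Cauchy[where C=C])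
  show "midpoint_hull F n \<noteq> {}" for n using midpoint_hull.base[of n n F] by auto
  show "midpoint_hull F n \<subseteq> midpoint_hull F m" if "m \<le> n" for m n using that by (rule midpoint_hull_antimono)
  show "(\<lambda>x. (1 / 2) *\<^sub>R (f x + g x)) \<in> midpoint_hull F n" if "f \<in> midpoint_hull F n" "g \<in> midpoint_hull F n" for n f g
    using that by (rule midpoint_hull.mid)
  show c: "continuous_on UNIV f" if "f \<in> midpoint_hull F n" for n f
    using that cont by (rule midpoint_hull_continuous)
  show "(\<integral>x. (norm (f x))\<^sup>2 \<partial>tor2) \<le> C" if f: "f \<in> midpoint_hull F n" for n f
  proof (rule midpoint_hull_convex[OF f, of "\<lambda>f. \<integral>x. (norm (f x))\<^sup>2 \<partial>tor2"])
    fix f g assume fg: "f \<in> midpoint_hull F n" "g \<in> midpoint_hull F n"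
    have i: "integrable tor2 (\<lambda>x. (norm (h x))\<^sup>2)" if "h \<in> midpoint_hull F n" for h
      by (intro integrable_tor2_continuous continuous_intros c[OF that])
    have "(\<integral>x. (norm ((1 / 2) *\<^sub>R (f x + g x)))\<^sup>2 \<partial>tor2) \<le> (\<integral>x. ((norm (f x))\<^sup>2 + (norm (g x))\<^sup>2) / 2 \<partial>tor2)"
      using i[OF fg(1)] i[OF fg(2)] i[OF midpoint_hull.mid[OF fg]]
      by (intro integral_mono norm_midpoint_square_le) auto
    also have "\<dots> = ((\<integral>x. (norm (f x))\<^sup>2 \<partial>tor2) + (\<integral>x. (norm (g x))\<^sup>2 \<partial>tor2)) / 2"
      using i[OF fg(1)] i[OF fg(2)] by simp
    finally show "(\<integral>x. (norm ((1 / 2) *\<^sub>R (f x + g x)))\<^sup>2 \<partial>tor2) \<le> \<dots>" .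
  qed (rule bound)
qed

section \<open>The minimiser\<close>

lemma trig_L2_torus: "f \<in> trig \<Longrightarrow> f \<in> L2_torus"
  by (intro L2_torusI trig_periodic trig_measurable trig_integrable trig_power)

lemma continuous_L2_torus: "periodic2 f \<Longrightarrow> continuous_on UNIV f \<Longrightarrow> f \<in> L2_torus"
  by (intro L2_torusI borel_measurable_continuous_onI integrable_tor2_continuous continuous_on_power)

lemma L2_tendsto_integral_mult:
  fixes f :: "nat \<Rightarrow> real \<times> real \<Rightarrow> real"
  assumes f: "\<And>n. f n \<in> L2_torus" and g: "g \<in> L2_torus"
    and lim: "(\<lambda>n. \<integral>x. (f n x - g x)\<^sup>2 \<partial>tor2) \<longlonglongrightarrow> 0" and a: "continuous_on UNIV a"
  shows "(\<lambda>n. \<integral>x. f n x * a x \<partial>tor2) \<longlonglongrightarrow> (\<integral>x. g x * a x \<partial>tor2)"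
proof -
  note F = L2_torusD[OF f] and G = L2_torusD[OF g]
  note [measurable] = F(2) G(2)
  have [measurable]: "a \<in> borel_measurable borel" using a by (rule borel_measurable_continuous_onI)
  have a2: "integrable tor2 (\<lambda>x. (a x)\<^sup>2)" by (intro integrable_tor2_continuous continuous_intros a)
  have d: "integrable tor2 (\<lambda>x. (f n x - g x)\<^sup>2)" for n using F G by (intro square_integrable_diff) auto
  have fa: "integrable tor2 (\<lambda>x. f n x * a x)" "integrable tor2 (\<lambda>x. g x * a x)" for n
    using F(3) G(3) a2 by (intro square_integrable_mult; simp)+
  have "(\<lambda>n. \<integral>x. (f n x - g x) * a x \<partial>tor2) \<longlonglongrightarrow> 0"
  proof (rule Lim_null_comparison)
    show "\<forall>\<^sub>F n in sequentially. norm (\<integral>x. (f n x - g x) * a x \<partial>tor2) \<le> sqrt (\<integral>x. (f n x - g x)\<^sup>2 \<partial>tor2) * sqrt (\<integral>x. (a x)\<^sup>2 \<partial>tor2)"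
      unfolding real_norm_def using d a2 by (intro always_eventually allI Cauchy_Schwarz_integral_sqrt) auto
    show "(\<lambda>n. sqrt (\<integral>x. (f n x - g x)\<^sup>2 \<partial>tor2) * sqrt (\<integral>x. (a x)\<^sup>2 \<partial>tor2)) \<longlonglongrightarrow> 0"
      using tendsto_mult_right[OF tendsto_real_sqrt[OF lim]] by simp
  qed
  hence "(\<lambda>n. (\<integral>x. (f n x - g x) * a x \<partial>tor2) + (\<integral>x. g x * a x \<partial>tor2)) \<longlonglongrightarrow> 0 + (\<integral>x. g x * a x \<partial>tor2)"
    by (intro tendsto_intros)
  thus ?thesis using fa by (simp add: left_diff_distrib)
qed

lemma uniform_tendsto_L2:
  fixes f :: "nat \<Rightarrow> real \<times> real \<Rightarrow> real"
  assumes f: "\<And>n. continuous_on UNIV (f n)" and g: "continuous_on UNIV g"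
    and ul: "\<And>e. e > 0 \<Longrightarrow> \<exists>N. \<forall>n\<ge>N. \<forall>x. \<bar>f n x - g x\<bar> \<le> e"
  shows "(\<lambda>n. \<integral>x. (f n x - g x)\<^sup>2 \<partial>tor2) \<longlonglongrightarrow> 0"
proof (rule LIMSEQ_I)
  fix r :: real assume r: "r > 0"
  define e where "e = sqrt (r / 2)"
  have e: "e > 0" "e\<^sup>2 < r" using r by (simp_all add: e_def)
  from ul[OF e(1)] obtain N where N: "\<forall>n\<ge>N. \<forall>x. \<bar>f n x - g x\<bar> \<le> e" ..
  show "\<exists>no. \<forall>n\<ge>no. norm ((\<integral>x. (f n x - g x)\<^sup>2 \<partial>tor2) - 0) < r"
  proof (intro exI[of _ N] allI impI)
    fix n assume n: "N \<le> n"
    have "(\<integral>x. (f n x - g x)\<^sup>2 \<partial>tor2) \<le> (\<integral>x. e\<^sup>2 \<partial>tor2)"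
    proof (rule integral_mono)
      show "integrable tor2 (\<lambda>x. (f n x - g x)\<^sup>2)"
        by (intro integrable_tor2_continuous continuous_intros f g)
      show "(f n x - g x)\<^sup>2 \<le> e\<^sup>2" for x
        using power_mono[of "\<bar>f n x - g x\<bar>" e 2] N n by simp
    qed simp
    thus "norm ((\<integral>x. (f n x - g x)\<^sup>2 \<partial>tor2) - 0) < r" using e(2) by simp
  qed
qed

text \<open>Linear relations in integrated form survive combination. With \<open>A\<close> built
  from a test function, such relations express weak derivatives.\<close>

lemma midpoint_hull_integral_inner:
  fixes F :: "nat \<Rightarrow> real \<times> real \<Rightarrow> 'b :: euclidean_space"
  assumes f: "f \<in> midpoint_hull F n" and F: "\<And>k. continuous_on UNIV (F k)" and A: "continuous_on UNIV A"
    and zero: "\<And>k. (\<integral>x. F k x \<bullet> A x \<partial>tor2) = 0"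
  shows "(\<integral>x. f x \<bullet> A x \<partial>tor2) = 0"
  using f
proof induction
  case (mid f g)
  have "integrable tor2 (\<lambda>x. h x \<bullet> A x)" if "h \<in> midpoint_hull F n" for h
    by (intro integrable_tor2_continuous continuous_on_inner A midpoint_hull_continuous[OF that F])
  from this[OF mid.hyps(1)] this[OF mid.hyps(2)] show ?case
    by (simp add: inner_add_left mid.IH)
qed (rule zero)

lemma midpoint_hull_shift:
  assumes "f \<in> midpoint_hull F n" "\<And>k x. F k (x + z) = F k x"
  shows "f (x + z) = f x"
  using assms(1) by (induction arbitrary: x) (simp_all add: assms(2))

text \<open>Both parts of the doubled energy are nonnegative, so each is at most
  \<open>2 * E\<close>; removing the weights \<open>1 / \<epsilon>\<close> and
  \<open>\<epsilon>\<close> gives the two entries of the maximum, for \<open>\<eta>\<close> and for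
  \<open>H\<close>.\<close>

lemma trig_energy_bounded:
  assumes U: "U \<in> trig" and \<epsilon>: "\<epsilon> > 0" and E: "trig_energy \<epsilon> U \<le> E"
  shows "trig_function_bounded U (max (2 * \<epsilon> * E) (2 * E / \<epsilon>))"
proof -
  interpret trig_function U using U by unfold_locales
  have i: "integrable tor2 (\<lambda>x. 1 / \<epsilon> * (\<eta> x)\<^sup>2)" "integrable tor2 (\<lambda>x. \<epsilon> * (H x)\<^sup>2)"
    by (intro integrable_mult_right square_integrable)+
  have "(\<integral>x. 1 / \<epsilon> * (\<eta> x)\<^sup>2 \<partial>tor2) + (\<integral>x. \<epsilon> * (H x)\<^sup>2 \<partial>tor2) \<le> 2 * E"
    using E Bochner_Integration.integral_add[OF i] by (simp add: trig_energy_def)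
  hence sum: "1 / \<epsilon> * (\<integral>x. (\<eta> x)\<^sup>2 \<partial>tor2) + \<epsilon> * (\<integral>x. (H x)\<^sup>2 \<partial>tor2) \<le> 2 * E"
    by (simp only: integral_mult_right_zero)
  have "0 \<le> 1 / \<epsilon> * (\<integral>x. (\<eta> x)\<^sup>2 \<partial>tor2)" "0 \<le> \<epsilon> * (\<integral>x. (H x)\<^sup>2 \<partial>tor2)"
    using \<epsilon> by (intro mult_nonneg_nonneg Bochner_Integration.integral_nonneg; simp)+
  hence "1 / \<epsilon> * (\<integral>x. (\<eta> x)\<^sup>2 \<partial>tor2) \<le> 2 * E" "\<epsilon> * (\<integral>x. (H x)\<^sup>2 \<partial>tor2) \<le> 2 * E"
    using sum by linarith+
  hence "(\<integral>x. (\<eta> x)\<^sup>2 \<partial>tor2) \<le> 2 * \<epsilon> * E" "(\<integral>x. (H x)\<^sup>2 \<partial>tor2) \<le> 2 * E / \<epsilon>"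
    using \<epsilon> by (simp_all add: field_simps)
  thus ?thesis using U by unfold_locales (auto simp: le_max_iff_disj)
qed

section \<open>Tuples of derivatives and their combinations\<close>

lemma norm_quadruple:
  fixes a b c d :: real
  shows "(norm (a, b, c, d))\<^sup>2 = a\<^sup>2 + b\<^sup>2 + c\<^sup>2 + d\<^sup>2"
  by (simp add: norm_Pair)

text \<open>Defined on arbitrary tuples because midpoints of tuples of derivatives are no longer of
  that kind: their second entry is an average of squares and in general not a square of a
  derivative.\<close>

definition quad_energy :: "real \<Rightarrow> (real \<times> real \<Rightarrow> real \<times> real \<times> real \<times> real) \<Rightarrow> real" where
  "quad_energy \<epsilon> f = 1 / 2 * (\<integral>x. 1 / \<epsilon> * (fst (snd (snd (f x))) - 1 / 2 * fst (snd (f x)))\<^sup>2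
      + \<epsilon> * (snd (snd (snd (f x))))\<^sup>2 \<partial>tor2)"

text \<open>The integrand is a sum of squares of linear expressions in the tuple, with weights that
  are positive by \<open>\<epsilon> > 0\<close>, hence convex.\<close>

lemma quad_energy_midpoint:
  assumes \<epsilon>: "\<epsilon> > 0" and f: "continuous_on UNIV f" and g: "continuous_on UNIV g"
  shows "quad_energy \<epsilon> (\<lambda>x. (1 / 2) *\<^sub>R (f x + g x)) \<le> (quad_energy \<epsilon> f + quad_energy \<epsilon> g) / 2"
proof -
  define I where "I h x = 1 / \<epsilon> * (fst (snd (snd (h x))) - 1 / 2 * fst (snd (h x)))\<^sup>2
      + \<epsilon> * (snd (snd (snd (h x))))\<^sup>2" for h :: "real \<times> real \<Rightarrow> real \<times> real \<times> real \<times> real" and x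
  have i: "integrable tor2 (I h)" if "continuous_on UNIV h" for h
    unfolding I_def by (intro integrable_tor2_continuous continuous_intros that)
  have sq: "((a + b) / 2)\<^sup>2 \<le> (a\<^sup>2 + b\<^sup>2) / 2" for a b :: real
    using zero_le_power2[of "a - b"] by (simp add: power2_eq_square field_simps)
  have "I (\<lambda>x. (1 / 2) *\<^sub>R (f x + g x)) x \<le> (I f x + I g x) / 2" for x
  proof -
    obtain a b c d a' b' c' d' where fg: "f x = (a, b, c, d)" "g x = (a', b', c', d')"
      by (cases "f x", cases "g x")
    have "(c + c') / 2 - 1 / 2 * ((b + b') / 2) = ((c - 1 / 2 * b) + (c' - 1 / 2 * b')) / 2" by (simp add: field_simps)
    hence 1: "((c + c') / 2 - 1 / 2 * ((b + b') / 2))\<^sup>2 \<le> ((c - 1 / 2 * b)\<^sup>2 + (c' - 1 / 2 * b')\<^sup>2) / 2"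
      using sq[of "c - 1 / 2 * b" "c' - 1 / 2 * b'"] by (simp only:)
    have "1 / \<epsilon> * ((c + c') / 2 - 1 / 2 * ((b + b') / 2))\<^sup>2 + \<epsilon> * ((d + d') / 2)\<^sup>2 \<le>
      1 / \<epsilon> * (((c - 1 / 2 * b)\<^sup>2 + (c' - 1 / 2 * b')\<^sup>2) / 2) + \<epsilon> * ((d\<^sup>2 + d'\<^sup>2) / 2)"
      using \<epsilon> 1 sq[of d d'] by (intro add_mono mult_left_mono) auto
    also have "\<dots> = (I f x + I g x) / 2" by (simp add: I_def fg add_divide_distrib distrib_left)
    finally show ?thesis by (simp add: I_def fg)
  qed
  hence "(\<integral>x. I (\<lambda>x. (1 / 2) *\<^sub>R (f x + g x)) x \<partial>tor2) \<le> (\<integral>x. (I f x + I g x) / 2 \<partial>tor2)"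
    using i[OF f] i[OF g] by (intro integral_mono i continuous_intros f g) auto
  also have "\<dots> = ((\<integral>x. I f x \<partial>tor2) + (\<integral>x. I g x \<partial>tor2)) / 2"
    using i[OF f] i[OF g] by simp
  finally have le: "(\<integral>x. I (\<lambda>x. (1 / 2) *\<^sub>R (f x + g x)) x \<partial>tor2) \<le> \<dots>" .
  have qe: "quad_energy \<epsilon> h = 1 / 2 * (\<integral>x. I h x \<partial>tor2)" for h
    by (simp only: quad_energy_def I_def)
  show ?thesis unfolding qe using le by simp
qed

text \<open>The data of a sequence that carries everything needed in the limit. The second component is the square of
  the first partial derivative: recorded separately, it makes the Burgers term linear in the components.\<close>

definition quad :: "(real \<times> real \<Rightarrow> real) \<Rightarrow> real \<times> real \<Rightarrow> real \<times> real \<times> real \<times> real" where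
  "quad U x = (U x, (dir_deriv e1 U x)\<^sup>2, dir_deriv e2 U x, dir_deriv e1 (dir_deriv e1 U) x)"

lemma quad_energy_quad: "quad_energy \<epsilon> (quad U) = trig_energy \<epsilon> U"
  by (simp add: quad_energy_def quad_def trig_energy_def)

lemma continuous_quad: "U \<in> trig \<Longrightarrow> continuous_on UNIV (quad U)"
  unfolding quad_def by (intro continuous_intros trig_continuous trig_derivs)

lemma quad_shift:
  assumes "U \<in> trig" "z \<in> {e1, e2}"
  shows "quad U (x + z) = quad U x"
proof -
  have "f (x + z) = f x" if "f \<in> trig" for f
    using trig_periodic[OF that] assms(2) by (cases x) (auto simp: periodic2_def)
  from this[of U] this[of "dir_deriv e1 U"] this[of "dir_deriv e2 U"] this[of "dir_deriv e1 (dir_deriv e1 U)"]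
  show ?thesis using trig_derivs assms(1) by (simp add: quad_def)
qed

text \<open>The second entry contributes the fourth power of \<open>W\<close>, which is where the L4
  bound enters. The right-hand side depends on \<open>M\<close> and \<open>L\<close> alone and is
  thus uniform along a sequence.\<close>

lemma quad_norm_bound:
  assumes "trig_function_bounded U M" "\<bar>\<integral>x. U x \<partial>tor2\<bar> \<le> L"
  shows "(\<integral>x. (norm (quad U x))\<^sup>2 \<partial>tor2) \<le> (L + (3 * sqrt (6 * M) + sqrt (2 * trig_function_bounded.N M)))\<^sup>2
     + 3 * M\<^sup>2 + trig_function_bounded.N M + M"
proof -
  interpret trig_function_bounded U M by (rule assms(1))
  let ?b = "L + (3 * sqrt (6 * M) + sqrt (2 * N))"
  have W4: "integrable tor2 (\<lambda>x. W x ^ 4)" by (intro trig_integrable trig_power W)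
  have "(\<integral>x. (U x)\<^sup>2 \<partial>tor2) \<le> (\<integral>x. ?b\<^sup>2 \<partial>tor2)"
  proof (intro integral_mono_AE square_integrable AE_tor2_torusI)
    fix x :: "real \<times> real" assume "x \<in> torus2"
    hence "x \<in> {0..1} \<times> {0..1}" by (auto simp: torus2_def)
    from U_bound[OF this] assms(2) have "\<bar>U x\<bar> \<le> ?b" by simp
    from power_mono[OF this, of 2] show "(U x)\<^sup>2 \<le> ?b\<^sup>2" by simp
  qed simp
  hence 1: "(\<integral>x. (U x)\<^sup>2 \<partial>tor2) \<le> ?b\<^sup>2" by simp
  have "(norm (quad U x))\<^sup>2 = (U x)\<^sup>2 + W x ^ 4 + (P x)\<^sup>2 + (H x)\<^sup>2" for x
    unfolding quad_def norm_quadruple by simp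
  hence "(\<integral>x. (norm (quad U x))\<^sup>2 \<partial>tor2) = (\<integral>x. (U x)\<^sup>2 \<partial>tor2) + (\<integral>x. W x ^ 4 \<partial>tor2) + (\<integral>x. (P x)\<^sup>2 \<partial>tor2) + (\<integral>x. (H x)\<^sup>2 \<partial>tor2)"
    using square_integrable W4 by simp
  thus ?thesis using 1 W4_bound P_bound H_bound by linarith
qed

text \<open>For a fixed test function both sides of the defining identity are continuous with
  respect to L2 convergence.\<close>

lemma has_weak_deriv_limit:
  assumes f: "\<And>n. f n \<in> L2_torus" and u: "u \<in> L2_torus" and fu: "(\<lambda>n. \<integral>x. (f n x - u x)\<^sup>2 \<partial>tor2) \<longlonglongrightarrow> 0"
    and h: "\<And>n. h n \<in> L2_torus" and w: "w \<in> L2_torus" and hw: "(\<lambda>n. \<integral>x. (h n x - w x)\<^sup>2 \<partial>tor2) \<longlonglongrightarrow> 0"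
    and es: "set es \<subseteq> {e1, e2}" and d: "\<And>n. has_weak_deriv es (f n) (h n)"
  shows "has_weak_deriv es u w"
  unfolding has_weak_deriv_iff[OF L2_torusD(2)[OF u] L2_torusD(2)[OF w] es]
proof
  fix \<phi> assume \<phi>: "\<phi> \<in> test_functions"
  have c: "continuous_on UNIV (foldr dir_deriv es \<phi>)" "continuous_on UNIV \<phi>"
    using foldr_dir_deriv_test[OF es \<phi>] \<phi> by (auto intro: test_functionsD(3))
  have "(\<lambda>n. (-1) ^ length es * (\<integral>x. h n x * \<phi> x \<partial>tor2)) \<longlonglongrightarrow> (-1) ^ length es * (\<integral>x. w x * \<phi> x \<partial>tor2)"
    by (intro tendsto_intros L2_tendsto_integral_mult h w hw c)
  moreover have "(-1) ^ length es * (\<integral>x. h n x * \<phi> x \<partial>tor2) = (\<integral>x. f n x * foldr dir_deriv es \<phi> x \<partial>tor2)" for n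
    using bspec[OF iffD1[OF has_weak_deriv_iff[OF L2_torusD(2)[OF f] L2_torusD(2)[OF h] es] d] \<phi>] by simp
  ultimately have "(\<lambda>n. \<integral>x. f n x * foldr dir_deriv es \<phi> x \<partial>tor2) \<longlonglongrightarrow> (-1) ^ length es * (\<integral>x. w x * \<phi> x \<partial>tor2)" by simp
  moreover have "(\<lambda>n. \<integral>x. f n x * foldr dir_deriv es \<phi> x \<partial>tor2) \<longlonglongrightarrow> (\<integral>x. u x * foldr dir_deriv es \<phi> x \<partial>tor2)"
    by (intro L2_tendsto_integral_mult f u fu c)
  ultimately show "(\<integral>x. u x * foldr dir_deriv es \<phi> x \<partial>tor2) = (-1) ^ length es * (\<integral>x. w x * \<phi> x \<partial>tor2)"
    by (rule LIMSEQ_unique[rotated])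
qed

text \<open>Both identities are linear in the tuple and tested with vectors whose second entry is 0.
  There is no such statement for \<open>[e1]\<close>: the tuple records only the square of that
  derivative, and so \<open>w\<close> has to be obtained from the sequence itself.\<close>

lemma midpoint_hull_quad_weak_deriv:
  assumes f: "f \<in> midpoint_hull (\<lambda>k. quad (F k)) n" and F: "\<And>k. F k \<in> trig"
  shows "has_weak_deriv [e2] (\<lambda>x. fst (f x)) (\<lambda>x. fst (snd (snd (f x))))"
    and "has_weak_deriv [e1, e1] (\<lambda>x. fst (f x)) (\<lambda>x. snd (snd (snd (f x))))"
proof -
  have c: "continuous_on UNIV f" by (rule midpoint_hull_continuous[OF f]) (intro continuous_quad F)
  have m: "(\<lambda>x. fst (f x)) \<in> borel_measurable borel" "(\<lambda>x. fst (snd (snd (f x)))) \<in> borel_measurable borel"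
    "(\<lambda>x. snd (snd (snd (f x)))) \<in> borel_measurable borel"
    by (intro borel_measurable_continuous_onI continuous_intros c)+
  have zero: "(\<integral>x. f x \<bullet> (a x, 0, b x, d x) \<partial>tor2) = 0"
    if "continuous_on UNIV a" "continuous_on UNIV b" "continuous_on UNIV d"
      "\<And>k. (\<integral>x. F k x * a x + dir_deriv e2 (F k) x * b x + dir_deriv e1 (dir_deriv e1 (F k)) x * d x \<partial>tor2) = 0" for a b d
  proof (rule midpoint_hull_integral_inner[OF f])
    show "continuous_on UNIV (quad (F k))" for k by (intro continuous_quad F)
    show "continuous_on UNIV (\<lambda>x. (a x, 0 :: real, b x, d x))" by (intro continuous_intros that)
    show "(\<integral>x. quad (F k) x \<bullet> (a x, 0, b x, d x) \<partial>tor2) = 0" for k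
      using that(4)[of k] by (simp add: quad_def inner_Pair add.assoc)
  qed
  have i: "integrable tor2 (\<lambda>x. a x * b x)" if "continuous_on UNIV a" "continuous_on UNIV b" for a b :: "real \<times> real \<Rightarrow> real"
    by (intro integrable_tor2_continuous continuous_on_mult that)
  have cc: "continuous_on UNIV (\<lambda>x. fst (f x))" "continuous_on UNIV (\<lambda>x. fst (snd (snd (f x))))"
    "continuous_on UNIV (\<lambda>x. snd (snd (snd (f x))))"
    by (intro continuous_intros c)+
  show "has_weak_deriv [e2] (\<lambda>x. fst (f x)) (\<lambda>x. fst (snd (snd (f x))))"
    unfolding has_weak_deriv_iff[OF m(1,2), of "[e2]", simplified]
  proof (intro ballI)
    fix \<phi> assume \<phi>: "\<phi> \<in> test_functions"
    note \<phi>' = test_function_deriv[OF \<phi>, of e2, simplified]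
    have "(\<integral>x. f x \<bullet> (dir_deriv e2 \<phi> x, 0, \<phi> x, 0) \<partial>tor2) = 0"
    proof (rule zero)
      show "(\<integral>x. F k x * dir_deriv e2 \<phi> x + dir_deriv e2 (F k) x * \<phi> x + dir_deriv e1 (dir_deriv e1 (F k)) x * 0 \<partial>tor2) = 0" for k
        using integration_by_parts_test[OF \<phi> trig_test[OF F], of e2 k] 
          i[OF trig_continuous[OF F] test_functionsD(3)[OF \<phi>'], of k]
          i[OF trig_continuous[OF trig_derivs(2)[OF F]] test_functionsD(3)[OF \<phi>], of k] by simp
    qed (intro test_functionsD(3) \<phi> \<phi>' continuous_on_const)+
    thus "(\<integral>x. fst (f x) * dir_deriv e2 \<phi> x \<partial>tor2) = - (\<integral>x. fst (snd (snd (f x))) * \<phi> x \<partial>tor2)"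
      using i[OF cc(1) test_functionsD(3)[OF \<phi>']] i[OF cc(2) test_functionsD(3)[OF \<phi>]]
      by (simp add: inner_prod_def)
  qed
  show "has_weak_deriv [e1, e1] (\<lambda>x. fst (f x)) (\<lambda>x. snd (snd (snd (f x))))"
    unfolding has_weak_deriv_iff[OF m(1,3), of "[e1, e1]", simplified]
  proof (intro ballI)
    fix \<phi> assume \<phi>: "\<phi> \<in> test_functions"
    note \<phi>' = test_function_deriv[OF \<phi>, of e1, simplified]
    note \<phi>'' = test_function_deriv[OF \<phi>', of e1, simplified]
    have "(\<integral>x. f x \<bullet> (dir_deriv e1 (dir_deriv e1 \<phi>) x, 0, 0, - \<phi> x) \<partial>tor2) = 0"
    proof (rule zero)
      show "(\<integral>x. F k x * dir_deriv e1 (dir_deriv e1 \<phi>) x + dir_deriv e2 (F k) x * 0 + dir_deriv e1 (dir_deriv e1 (F k)) x * (- \<phi> x) \<partial>tor2) = 0" for k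
        using integration_by_parts_test[OF \<phi>' trig_test[OF F], of e1 k]
          integration_by_parts_test[OF \<phi> trig_test[OF trig_derivs(1)[OF F]], of e1 k] 
          i[OF trig_continuous[OF F] test_functionsD(3)[OF \<phi>''], of k]
          i[OF trig_continuous[OF trig_derivs(1)[OF trig_derivs(1)[OF F]]] test_functionsD(3)[OF \<phi>], of k] by simp
    qed (intro test_functionsD(3) \<phi> \<phi>'' continuous_on_const continuous_on_minus)+
    thus "(\<integral>x. fst (f x) * dir_deriv e1 (dir_deriv e1 \<phi>) x \<partial>tor2) = (\<integral>x. snd (snd (snd (f x))) * \<phi> x \<partial>tor2)"
      using i[OF cc(1) test_functionsD(3)[OF \<phi>'']] i[OF cc(3) test_functionsD(3)[OF \<phi>]]
      by (simp add: inner_prod_def)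
  qed
qed


text \<open>The distance to a fixed number is midpoint convex, so closeness of a whole tail passes
  to its combinations. Combinations of later and later tails therefore inherit the limit of the
  sequence.\<close>

lemma midpoint_hull_quad_value:
  assumes "f \<in> midpoint_hull (\<lambda>k. quad (F k)) n" "\<And>k. n \<le> k \<Longrightarrow> \<bar>F k x - y\<bar> \<le> e"
  shows "\<bar>fst (f x) - y\<bar> \<le> e"
proof (rule midpoint_hull_convex[OF assms(1), of "\<lambda>f. \<bar>fst (f x) - y\<bar>"])
  show "\<bar>fst (quad (F k) x) - y\<bar> \<le> e" if "n \<le> k" for k using assms(2)[OF that] by (simp add: quad_def)
  show "\<bar>fst ((1 / 2) *\<^sub>R (f x + g x)) - y\<bar> \<le> (\<bar>fst (f x) - y\<bar> + \<bar>fst (g x) - y\<bar>) / 2" for f g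
    by (simp add: field_simps)
qed

lemma midpoint_hull_quad_square:
  assumes "f \<in> midpoint_hull (\<lambda>k. quad (F k)) n" "\<And>k. n \<le> k \<Longrightarrow> \<bar>(dir_deriv e1 (F k) x)\<^sup>2 - y\<bar> \<le> e"
  shows "\<bar>fst (snd (f x)) - y\<bar> \<le> e"
proof (rule midpoint_hull_convex[OF assms(1), of "\<lambda>f. \<bar>fst (snd (f x)) - y\<bar>"])
  show "\<bar>fst (snd (quad (F k) x)) - y\<bar> \<le> e" if "n \<le> k" for k using assms(2)[OF that] by (simp add: quad_def)
  show "\<bar>fst (snd ((1 / 2) *\<^sub>R (f x + g x))) - y\<bar> \<le> (\<bar>fst (snd (f x)) - y\<bar> + \<bar>fst (snd (g x)) - y\<bar>) / 2" for f g
    by (simp add: field_simps)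
qed

lemma midpoint_hull_quad_energy:
  assumes \<epsilon>: "\<epsilon> > 0" and F: "\<And>k. F k \<in> trig"
    and f: "f \<in> midpoint_hull (\<lambda>k. quad (F k)) n" and E: "\<And>k. n \<le> k \<Longrightarrow> trig_energy \<epsilon> (F k) \<le> E"
  shows "quad_energy \<epsilon> f \<le> E"
proof (rule midpoint_hull_convex[OF f, of "quad_energy \<epsilon>"])
  show "quad_energy \<epsilon> (quad (F k)) \<le> E" if "n \<le> k" for k using E[OF that] by (simp add: quad_energy_quad)
  show "quad_energy \<epsilon> (\<lambda>x. (1 / 2) *\<^sub>R (f x + g x)) \<le> (quad_energy \<epsilon> f + quad_energy \<epsilon> g) / 2"
    if "f \<in> midpoint_hull (\<lambda>k. quad (F k)) n" "g \<in> midpoint_hull (\<lambda>k. quad (F k)) n" for f g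
    by (intro quad_energy_midpoint \<epsilon> midpoint_hull_continuous[OF that(1)] midpoint_hull_continuous[OF that(2)] continuous_quad F)
qed

lemma midpoint_hull_quad_L2:
  assumes F: "\<And>k. F k \<in> trig" and f: "f \<in> midpoint_hull (\<lambda>k. quad (F k)) n"
  shows "(\<lambda>x. fst (f x)) \<in> L2_torus" "(\<lambda>x. fst (snd (snd (f x)))) \<in> L2_torus" "(\<lambda>x. snd (snd (snd (f x)))) \<in> L2_torus"
proof -
  have c: "continuous_on UNIV f" by (rule midpoint_hull_continuous[OF f]) (intro continuous_quad F)
  have "f (x + z) = f x" if "z \<in> {e1, e2}" for x z
    by (rule midpoint_hull_shift[OF f]) (intro quad_shift F that)
  from this[of e1 "(_, _)"] this[of e2 "(_, _)"]
  have "f (s + 1, t) = f (s, t)" "f (s, t + 1) = f (s, t)" for s t by simp_all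
  hence p: "periodic2 (\<lambda>x. g (f x))" for g :: "_ \<Rightarrow> real" by (simp add: periodic2_def)
  show "(\<lambda>x. fst (f x)) \<in> L2_torus"
    by (rule continuous_L2_torus[OF p[of fst]]) (intro continuous_intros c)
  show "(\<lambda>x. fst (snd (snd (f x)))) \<in> L2_torus"
    by (rule continuous_L2_torus[OF p[of "\<lambda>y. fst (snd (snd y))"]]) (intro continuous_intros c)
  show "(\<lambda>x. snd (snd (snd (f x)))) \<in> L2_torus"
    by (rule continuous_L2_torus[OF p[of "\<lambda>y. snd (snd (snd y))"]]) (intro continuous_intros c)
qed

lemma component_le_norm_quadruple:
  fixes y :: "real \<times> real \<times> real \<times> real"
  shows "(fst (snd (snd y)))\<^sup>2 \<le> (norm y)\<^sup>2" "(snd (snd (snd y)))\<^sup>2 \<le> (norm y)\<^sup>2"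
  by (cases y; simp add: norm_quadruple)+

text \<open>Completeness is applied to the third and fourth entries of a Cauchy sequence of
  combinations. The limits of the first two entries will come from the convergence of the
  \<open>F k\<close> themselves.\<close>

lemma midpoint_hull_quad_limit:
  assumes F: "\<And>k. F k \<in> trig" and bound: "\<And>k. (\<integral>x. (norm (quad (F k) x))\<^sup>2 \<partial>tor2) \<le> C"
  shows "\<exists>g p h. (\<forall>n. g n \<in> midpoint_hull (\<lambda>k. quad (F k)) n) \<and> p \<in> L2_torus \<and> h \<in> L2_torus
    \<and> (\<lambda>n. \<integral>x. (fst (snd (snd (g n x))) - p x)\<^sup>2 \<partial>tor2) \<longlonglongrightarrow> 0
    \<and> (\<lambda>n. \<integral>x. (snd (snd (snd (g n x))) - h x)\<^sup>2 \<partial>tor2) \<longlonglongrightarrow> 0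
    \<and> (AE x in tor2. (\<lambda>n. fst (snd (snd (g n x)))) \<longlonglongrightarrow> p x)
    \<and> (AE x in tor2. (\<lambda>n. snd (snd (snd (g n x)))) \<longlonglongrightarrow> h x)"
proof -
  let ?T = "\<lambda>k. quad (F k)"
  have Tc: "continuous_on UNIV (?T k)" for k by (intro continuous_quad F)
  obtain f where f: "\<And>n. f n \<in> midpoint_hull ?T n"
    and Cauchy: "\<And>e. e > 0 \<Longrightarrow> \<exists>N. \<forall>m\<ge>N. \<forall>n\<ge>N. (\<integral>x. (norm (f m x - f n x))\<^sup>2 \<partial>tor2) < e"
    using ex_Cauchy_midpoint_hull[of ?T C, OF Tc bound] by auto
  have fc: "continuous_on UNIV (f n)" for n by (rule midpoint_hull_continuous[OF f Tc])
  define p' where "p' n x = fst (snd (snd (f n x)))" for n x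
  define h' where "h' n x = snd (snd (snd (f n x)))" for n x
  have L2: "p' n \<in> L2_torus" "h' n \<in> L2_torus" for n
    using midpoint_hull_quad_L2[OF F f] unfolding p'_def h'_def by auto
  have c': "continuous_on UNIV (p' n)" "continuous_on UNIV (h' n)" for n
    unfolding p'_def h'_def by (intro continuous_intros fc)+
  have i: "integrable tor2 (\<lambda>x. (norm (f m x - f n x))\<^sup>2)" for m n
    by (intro integrable_tor2_continuous continuous_intros fc)
  have le: "(\<integral>x. (p' m x - p' n x)\<^sup>2 \<partial>tor2) \<le> (\<integral>x. (norm (f m x - f n x))\<^sup>2 \<partial>tor2)"
    "(\<integral>x. (h' m x - h' n x)\<^sup>2 \<partial>tor2) \<le> (\<integral>x. (norm (f m x - f n x))\<^sup>2 \<partial>tor2)" for m n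
  proof -
    have "(p' m x - p' n x)\<^sup>2 \<le> (norm (f m x - f n x))\<^sup>2" "(h' m x - h' n x)\<^sup>2 \<le> (norm (f m x - f n x))\<^sup>2" for x
      using component_le_norm_quadruple[of "f m x - f n x"] by (simp_all add: p'_def h'_def)
    moreover have "integrable tor2 (\<lambda>x. (p' m x - p' n x)\<^sup>2)" "integrable tor2 (\<lambda>x. (h' m x - h' n x)\<^sup>2)"
      by (intro integrable_tor2_continuous continuous_intros c')+
    ultimately show "(\<integral>x. (p' m x - p' n x)\<^sup>2 \<partial>tor2) \<le> (\<integral>x. (norm (f m x - f n x))\<^sup>2 \<partial>tor2)"
      "(\<integral>x. (h' m x - h' n x)\<^sup>2 \<partial>tor2) \<le> (\<integral>x. (norm (f m x - f n x))\<^sup>2 \<partial>tor2)"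
      using i[of m n] by (intro integral_mono; simp)+
  qed
  have pC: "\<exists>N. \<forall>m\<ge>N. \<forall>n\<ge>N. (\<integral>x. (p' m x - p' n x)\<^sup>2 \<partial>tor2) < e" if "e > 0" for e
    using Cauchy[OF that] le(1) by (meson le_less_trans)
  have "\<exists>r p. strict_mono r \<and> p \<in> L2_torus \<and> (AE x in tor2. (\<lambda>n. p' (r n) x) \<longlonglongrightarrow> p x)
      \<and> (\<lambda>n. \<integral>x. (p' n x - p x)\<^sup>2 \<partial>tor2) \<longlonglongrightarrow> 0"
    by (rule L2_torus_complete[OF L2(1)]) (rule pC)
  then obtain r1 p where r1: "strict_mono r1" and p: "p \<in> L2_torus"
    "AE x in tor2. (\<lambda>n. p' (r1 n) x) \<longlonglongrightarrow> p x" "(\<lambda>n. \<integral>x. (p' n x - p x)\<^sup>2 \<partial>tor2) \<longlonglongrightarrow> 0"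
    by (elim exE conjE)
  \<comment> \<open>The second extraction runs along \<open>r1\<close>, so that one common
    subsequence gives convergence almost everywhere for both entries.\<close>
  have hC: "\<exists>N. \<forall>m\<ge>N. \<forall>n\<ge>N. (\<integral>x. (h' (r1 m) x - h' (r1 n) x)\<^sup>2 \<partial>tor2) < e" if e: "e > 0" for e
  proof -
    from Cauchy[OF e] obtain N where N: "\<forall>m\<ge>N. \<forall>n\<ge>N. (\<integral>x. (norm (f m x - f n x))\<^sup>2 \<partial>tor2) < e" ..
    show ?thesis
    proof (intro exI[of _ N] allI impI)
      fix m n assume "N \<le> m" "N \<le> n"
      hence "N \<le> r1 m" "N \<le> r1 n" using seq_suble[OF r1, of m] seq_suble[OF r1, of n] by auto
      thus "(\<integral>x. (h' (r1 m) x - h' (r1 n) x)\<^sup>2 \<partial>tor2) < e" using N le(2)[of "r1 m" "r1 n"] by (meson le_less_trans)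
    qed
  qed
  have "\<exists>r h. strict_mono r \<and> h \<in> L2_torus \<and> (AE x in tor2. (\<lambda>n. h' (r1 (r n)) x) \<longlonglongrightarrow> h x)
      \<and> (\<lambda>n. \<integral>x. (h' (r1 n) x - h x)\<^sup>2 \<partial>tor2) \<longlonglongrightarrow> 0"
    by (rule L2_torus_complete[OF L2(2)]) (rule hC)
  then obtain r2 h where r2: "strict_mono r2" and h: "h \<in> L2_torus"
    "AE x in tor2. (\<lambda>n. h' (r1 (r2 n)) x) \<longlonglongrightarrow> h x" "(\<lambda>n. \<integral>x. (h' (r1 n) x - h x)\<^sup>2 \<partial>tor2) \<longlonglongrightarrow> 0"
    by (elim exE conjE)
  have r12: "strict_mono (r1 \<circ> r2)" using r1 r2 by (rule strict_mono_o)
  \<comment> \<open>Passing to a subsequence only moves further into the tail, so membership in the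
    hull from index \<open>n\<close> is kept.\<close>
  have "f (r1 (r2 n)) \<in> midpoint_hull ?T n" for n
    using f[of "r1 (r2 n)"] midpoint_hull_antimono[of n "r1 (r2 n)" ?T] seq_suble[OF r12, of n] by auto
  moreover have "(\<lambda>n. \<integral>x. (p' (r1 (r2 n)) x - p x)\<^sup>2 \<partial>tor2) \<longlonglongrightarrow> 0"
    using LIMSEQ_subseq_LIMSEQ[OF p(3) r12] by (simp add: o_def)
  moreover have "(\<lambda>n. \<integral>x. (h' (r1 (r2 n)) x - h x)\<^sup>2 \<partial>tor2) \<longlonglongrightarrow> 0"
    using LIMSEQ_subseq_LIMSEQ[OF h(3) r2] by (simp add: o_def)
  moreover have "AE x in tor2. (\<lambda>n. p' (r1 (r2 n)) x) \<longlonglongrightarrow> p x"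
    using p(2)
  proof eventually_elim
    case (elim x)
    from LIMSEQ_subseq_LIMSEQ[OF this r2] show ?case by (simp add: o_def)
  qed
  ultimately show ?thesis using p(1) h(1,2) unfolding p'_def h'_def
    by (intro exI[of _ "\<lambda>n. f (r1 (r2 n))"] exI[of _ p] exI[of _ h] conjI allI)
qed

section \<open>Passage to the limit in the energy\<close>

lemma trig_has_weak_deriv:
  assumes f: "f \<in> trig" and e: "e \<in> {e1, e2}"
  shows "has_weak_deriv [e] f (dir_deriv e f)"
proof -
  have d: "dir_deriv e f \<in> trig" using trig_derivs f e by auto
  show ?thesis
    using integration_by_parts_test[OF _ trig_test[OF f] e] e
    by (subst has_weak_deriv_iff[OF trig_measurable[OF f] trig_measurable[OF d]]) auto
qed

lemma burgers_term_L2_torusI: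
  assumes "weak_deriv_in_L2 [e1] u" "weak_deriv_in_L2 [e2] u" "integrable tor2 (\<lambda>x. (burgers_term u x)\<^sup>2)"
  shows "burgers_term u \<in> L2_torus"
proof (rule L2_torusI[OF _ _ assms(3)])
  note W = L2_torusD[OF weak_deriv_props(1)[OF assms(1)]] and P = L2_torusD[OF weak_deriv_props(1)[OF assms(2)]]
  show "periodic2 (burgers_term u)" using W(1) P(1) by (simp add: periodic2_def burgers_term_def)
  note [measurable] = W(2) P(2)
  show "burgers_term u \<in> borel_measurable borel" unfolding burgers_term_def by measurable
qed

text \<open>Compactness and lower semicontinuity together. The \<open>V n\<close> are not assumed to
  satisfy the constraint on slices, so it is absent here; the uniform convergence in the conclusion
  is what later allows it to be recovered.\<close>

lemma trig_energy_limit: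
  assumes \<epsilon>: "\<epsilon> > 0" and V: "\<And>n. V n \<in> trig" and VE: "\<And>n. trig_energy \<epsilon> (V n) \<le> E n"
    and E: "E \<longlonglongrightarrow> m" and L: "\<And>n. \<bar>\<integral>x. V n x \<partial>tor2\<bar> \<le> L"
  shows "\<exists>k u. strict_mono k \<and> uniform_limit UNIV (\<lambda>n. V (k n)) u sequentially \<and> continuous_on UNIV u
    \<and> u \<in> W12_torus \<and> weak_deriv_in_L2 [e1, e1] u \<and> burgers_term u \<in> L2_torus \<and> torus_energy \<epsilon> u \<le> m"
proof -
  have "Bseq E" by (intro Bseq_eq_bounded convergent_imp_Bseq convergentI[OF E])
  then obtain B where B: "\<And>n. \<bar>E n\<bar> \<le> B" by (auto simp: Bseq_def)
  define M where "M = max (2 * \<epsilon> * B) (2 * B / \<epsilon>)"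
  have "trig_energy \<epsilon> (V n) \<le> B" for n using VE[of n] B[of n] by linarith
  hence tb: "trig_function_bounded (V n) M" for n
    unfolding M_def using V \<epsilon> by (intro trig_energy_bounded)
  obtain k1 u where k1: "strict_mono k1" and u: "periodic2 u" "continuous_on UNIV u"
    and ul: "uniform_limit UNIV (\<lambda>n. V (k1 n)) u sequentially"
    using trig_functions_uniform_limit[of V M L, OF tb L] by (elim exE conjE)
  have "\<exists>r w. strict_mono r \<and> w \<in> L2_torus \<and> (AE x in tor2. (\<lambda>n. dir_deriv e1 (V (k1 (r n))) x) \<longlonglongrightarrow> w x)
     \<and> (\<lambda>n. \<integral>x. (dir_deriv e1 (V (k1 n)) x - w x)\<^sup>2 \<partial>tor2) \<longlonglongrightarrow> 0"
  proof (rule L2_torus_complete)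
    show "dir_deriv e1 (V (k1 n)) \<in> L2_torus" for n by (intro trig_L2_torus trig_derivs V)
    show "\<exists>N. \<forall>m\<ge>N. \<forall>n\<ge>N. (\<integral>x. (dir_deriv e1 (V (k1 m)) x - dir_deriv e1 (V (k1 n)) x)\<^sup>2 \<partial>tor2) < e" if "e > 0" for e
      by (rule trig_derivs_Cauchy[OF tb ul that])
  qed
  then obtain r w where r: "strict_mono r" and w: "w \<in> L2_torus"
    and wAE: "AE x in tor2. (\<lambda>n. dir_deriv e1 (V (k1 (r n))) x) \<longlonglongrightarrow> w x"
    and wL2: "(\<lambda>n. \<integral>x. (dir_deriv e1 (V (k1 n)) x - w x)\<^sup>2 \<partial>tor2) \<longlonglongrightarrow> 0"
    by (elim exE conjE)
  \<comment> \<open>Along \<open>k\<close> the first derivatives converge almost everywhere as well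
    as in L2; the combinations below are formed from this sequence \<open>F\<close>.\<close>
  define k where "k = k1 \<circ> r"
  have k: "strict_mono k" unfolding k_def using k1 r by (rule strict_mono_o)
  define F where "F n = V (k n)" for n
  have F: "F n \<in> trig" for n by (simp add: F_def V)
  have Fb: "trig_function_bounded (F n) M" for n by (simp add: F_def tb)
  have Fu: "uniform_limit UNIV F u sequentially"
    unfolding F_def[abs_def] k_def o_def using filterlim_compose[OF ul filterlim_subseq[OF r]] by simp
  have FE: "trig_energy \<epsilon> (F n) \<le> E (k n)" for n by (simp add: F_def VE)
  have Ek: "(\<lambda>n. E (k n)) \<longlonglongrightarrow> m" using LIMSEQ_subseq_LIMSEQ[OF E k] by (simp add: o_def)
  have Fw: "AE x in tor2. (\<lambda>n. dir_deriv e1 (F n) x) \<longlonglongrightarrow> w x"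
    using wAE by (simp add: F_def k_def)
  have Fw2: "(\<lambda>n. \<integral>x. (dir_deriv e1 (F n) x - w x)\<^sup>2 \<partial>tor2) \<longlonglongrightarrow> 0"
    using LIMSEQ_subseq_LIMSEQ[OF wL2 r] by (simp add: F_def k_def o_def)
  have "(\<integral>x. (norm (quad (F n) x))\<^sup>2 \<partial>tor2) \<le> (L + (3 * sqrt (6 * M) + sqrt (2 * trig_function_bounded.N M)))\<^sup>2
     + 3 * M\<^sup>2 + trig_function_bounded.N M + M" for n
    by (rule quad_norm_bound[OF Fb]) (simp add: F_def L)
  from midpoint_hull_quad_limit[of F, OF F this] obtain g p h
    where g': "\<forall>n. g n \<in> midpoint_hull (\<lambda>k. quad (F k)) n" and p: "p \<in> L2_torus" and h: "h \<in> L2_torus"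
      and pL2: "(\<lambda>n. \<integral>x. (fst (snd (snd (g n x))) - p x)\<^sup>2 \<partial>tor2) \<longlonglongrightarrow> 0"
      and hL2: "(\<lambda>n. \<integral>x. (snd (snd (snd (g n x))) - h x)\<^sup>2 \<partial>tor2) \<longlonglongrightarrow> 0"
      and pAE: "AE x in tor2. (\<lambda>n. fst (snd (snd (g n x)))) \<longlonglongrightarrow> p x"
      and hAE: "AE x in tor2. (\<lambda>n. snd (snd (snd (g n x)))) \<longlonglongrightarrow> h x"
    by (elim exE conjE)
  note g = spec[OF g']
  have gc: "continuous_on UNIV (g n)" for n
    by (rule midpoint_hull_continuous[OF g]) (intro continuous_quad F)
  have gL2: "(\<lambda>x. fst (g n x)) \<in> L2_torus" "(\<lambda>x. fst (snd (snd (g n x)))) \<in> L2_torus" "(\<lambda>x. snd (snd (snd (g n x)))) \<in> L2_torus" for n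
    by (rule midpoint_hull_quad_L2[OF F g])+
  have uL2: "u \<in> L2_torus" using u by (rule continuous_L2_torus)
  have unif: "\<exists>N. \<forall>n\<ge>N. \<forall>x. \<bar>F n x - u x\<bar> \<le> e" if "e > 0" for e
  proof -
    from uniform_limitD[OF Fu that] obtain N where "\<forall>n\<ge>N. \<forall>x\<in>UNIV. dist (F n x) (u x) < e"
      unfolding eventually_sequentially ..
    thus ?thesis by (intro exI[of _ N]) (auto simp: dist_real_def intro: less_imp_le)
  qed
  have gu: "(\<lambda>n. \<integral>x. (fst (g n x) - u x)\<^sup>2 \<partial>tor2) \<longlonglongrightarrow> 0"
  proof (rule uniform_tendsto_L2)
    show "continuous_on UNIV (\<lambda>x. fst (g n x))" for n by (intro continuous_intros gc)
    fix e :: real assume "e > 0"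
    from unif[OF this] obtain N where N: "\<forall>n\<ge>N. \<forall>x. \<bar>F n x - u x\<bar> \<le> e" ..
    have "\<bar>fst (g n x) - u x\<bar> \<le> e" if "n \<ge> N" for n x
    proof (rule midpoint_hull_quad_value[OF g])
      fix k assume "n \<le> k"
      hence "N \<le> k" using that by simp
      from N[rule_format, OF this] show "\<bar>F k x - u x\<bar> \<le> e" .
    qed
    thus "\<exists>N. \<forall>n\<ge>N. \<forall>x. \<bar>fst (g n x) - u x\<bar> \<le> e" by (intro exI[of _ N] allI impI)
  qed (rule u(2))
  have Fu2: "(\<lambda>n. \<integral>x. (F n x - u x)\<^sup>2 \<partial>tor2) \<longlonglongrightarrow> 0"
    by (rule uniform_tendsto_L2[OF trig_continuous[OF F] u(2) unif])
  \<comment> \<open>\<open>w\<close> is identified through \<open>F\<close>, but \<open>p\<close>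
    and \<open>h\<close> through the combinations \<open>g\<close>. All are derivatives of the same
    \<open>u\<close>, because \<open>F\<close> and the first entry of \<open>g\<close> have the same
    limit.\<close>
  have d1: "has_weak_deriv [e1] u w"
    by (rule has_weak_deriv_limit[OF _ uL2 Fu2 _ w Fw2])
       (auto intro!: trig_L2_torus trig_has_weak_deriv F trig_derivs)
  have d2: "has_weak_deriv [e2] u p"
    by (rule has_weak_deriv_limit[OF gL2(1) uL2 gu gL2(2) p pL2 _ midpoint_hull_quad_weak_deriv(1)[OF g F]]) simp
  have d11: "has_weak_deriv [e1, e1] u h"
    by (rule has_weak_deriv_limit[OF gL2(1) uL2 gu gL2(3) h hL2 _ midpoint_hull_quad_weak_deriv(2)[OF g F]]) simp
  have in_L2: "weak_deriv_in_L2 [e1] u" "weak_deriv_in_L2 [e2] u" "weak_deriv_in_L2 [e1, e1] u"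
    unfolding weak_deriv_in_L2_def by (rule bexI[OF _ w], rule d1, rule bexI[OF _ p], rule d2, rule bexI[OF _ h], rule d11)
  hence W12: "u \<in> W12_torus" using uL2 by (simp add: W12_torus_def)
  note wp = weak_deriv_props[OF in_L2(1)] weak_deriv_props[OF in_L2(2)] weak_deriv_props[OF in_L2(3)]
  have eq1: "AE x in tor2. weak_deriv [e1] u x = w x"
    by (rule weak_deriv_AE_unique[OF L2_torusD(2)[OF uL2] wp(1,2) w d1]) simp
  have eq2: "AE x in tor2. weak_deriv [e2] u x = p x"
    by (rule weak_deriv_AE_unique[OF L2_torusD(2)[OF uL2] wp(3,4) p d2]) simp
  have eq11: "AE x in tor2. weak_deriv [e1, e1] u x = h x"
    by (rule weak_deriv_AE_unique[OF L2_torusD(2)[OF uL2] wp(5,6) h d11]) simp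
  note [measurable] = L2_torusD(2)[OF w] L2_torusD(2)[OF p] L2_torusD(2)[OF h]
    L2_torusD(2)[OF wp(1)] L2_torusD(2)[OF wp(3)] L2_torusD(2)[OF wp(5)]
  have [measurable]: "burgers_term u \<in> borel_measurable borel" unfolding burgers_term_def by measurable
  define J where "J x = 1 / 2 * (1 / \<epsilon> * (p x - 1 / 2 * (w x)\<^sup>2)\<^sup>2 + \<epsilon> * (h x)\<^sup>2)" for x
  define j where "j n x = 1 / 2 * (1 / \<epsilon> * (fst (snd (snd (g n x))) - 1 / 2 * fst (snd (g n x)))\<^sup>2 + \<epsilon> * (snd (snd (snd (g n x))))\<^sup>2)" for n x
  have jc: "continuous_on UNIV (j n)" for n unfolding j_def by (intro continuous_intros gc)
  have qj: "quad_energy \<epsilon> (g n) = (\<integral>x. j n x \<partial>tor2)" for n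
    unfolding quad_energy_def j_def by (simp only: integral_mult_right_zero)
  \<comment> \<open>The entry is a combination of squares, not the square of a combination; it tends
    to \<open>w\<^sup>2\<close> because all squares in the tail are close to it. Strong convergence
    of \<open>w\<close> is indispensable at this point.\<close>
  have QAE: "AE x in tor2. (\<lambda>n. fst (snd (g n x))) \<longlonglongrightarrow> (w x)\<^sup>2"
    using Fw
  proof eventually_elim
    case (elim x)
    have sq: "(\<lambda>n. (dir_deriv e1 (F n) x)\<^sup>2) \<longlonglongrightarrow> (w x)\<^sup>2" by (intro tendsto_intros elim)
    show ?case
    proof (rule LIMSEQ_I)
      fix e :: real assume e: "e > 0"
      hence e2: "0 < e / 2" "e / 2 < e" by simp_all
      from LIMSEQ_D[OF sq e2(1)] obtain N where N: "\<forall>n\<ge>N. norm ((dir_deriv e1 (F n) x)\<^sup>2 - (w x)\<^sup>2) < e / 2" ..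
      show "\<exists>N. \<forall>n\<ge>N. norm (fst (snd (g n x)) - (w x)\<^sup>2) < e"
      proof (intro exI[of _ N] allI impI)
        fix n assume n: "N \<le> n"
        have "\<bar>fst (snd (g n x)) - (w x)\<^sup>2\<bar> \<le> e / 2"
        proof (rule midpoint_hull_quad_square[OF g])
          fix k assume "n \<le> k"
          with n have "N \<le> k" by (rule order_trans)
          from less_imp_le[OF N[rule_format, OF this]]
          show "\<bar>(dir_deriv e1 (F k) x)\<^sup>2 - (w x)\<^sup>2\<bar> \<le> e / 2" unfolding real_norm_def .
        qed
        from le_less_trans[OF this e2(2)]
        show "norm (fst (snd (g n x)) - (w x)\<^sup>2) < e" unfolding real_norm_def .
      qed
    qed
  qed
  have jAE: "AE x in tor2. (\<lambda>n. j (n + N) x) \<longlonglongrightarrow> J x" for N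
    using pAE hAE QAE
  proof eventually_elim
    case (elim x)
    have "(\<lambda>n. j n x) \<longlonglongrightarrow> J x" unfolding j_def J_def by (intro tendsto_intros elim)
    thus ?case by (rule LIMSEQ_ignore_initial_segment)
  qed
  have [measurable]: "J \<in> borel_measurable borel" unfolding J_def by measurable
  \<comment> \<open>For \<open>c > m\<close> the bounds \<open>E (k n)\<close> are below
    \<open>c\<close> from some \<open>N\<close> on, and so are the energies of combinations of that
    tail; the shift by \<open>N\<close> makes this hold for every index. Letting \<open>c\<close>
    decrease to \<open>m\<close> afterwards gives the bound \<open>m\<close>.\<close>
  have Fatou: "integrable tor2 J" "(\<integral>x. J x \<partial>tor2) \<le> c" if c: "m < c" for c
  proof -
    obtain N where N: "\<And>n. n \<ge> N \<Longrightarrow> E (k n) < c"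
      using order_tendstoD(2)[OF Ek c] by (auto simp: eventually_sequentially)
    have le: "(\<integral>x. j (n + N) x \<partial>tor2) \<le> c" for n
      unfolding qj[symmetric]
    proof (rule midpoint_hull_quad_energy[OF \<epsilon> F g])
      fix k' assume "n + N \<le> k'"
      thus "trig_energy \<epsilon> (F k') \<le> c" using FE[of k'] N[of k'] by simp
    qed
    have j0: "0 \<le> j n x" for n x using \<epsilon> by (simp add: j_def)
    have ji: "integrable tor2 (j n)" for n by (intro integrable_tor2_continuous jc)
    have jm: "j n \<in> borel_measurable tor2" for n using borel_measurable_integrable[OF ji] .
    have Jm: "J \<in> borel_measurable tor2" by measurable
    show "integrable tor2 J" by (rule Fatou_real(1)[OF jm Jm ji j0 le jAE])
    show "(\<integral>x. J x \<partial>tor2) \<le> c" by (rule Fatou_real(2)[OF jm Jm ji j0 le jAE])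
  qed
  have JI: "integrable tor2 J" using Fatou(1)[of "m + 1"] by simp
  have Jle: "(\<integral>x. J x \<partial>tor2) \<le> m" by (rule dense_ge) (rule Fatou(2))
  have beq: "AE x in tor2. burgers_term u x = p x - 1 / 2 * (w x)\<^sup>2"
    using eq1 eq2 by eventually_elim (simp add: burgers_term_def)
  \<comment> \<open>\<open>2 * \<epsilon> * J\<close> is the squared Burgers term plus a nonnegative
    remainder, so finiteness of the limit energy puts the Burgers term in L2.\<close>
  have bi: "integrable tor2 (\<lambda>x. (burgers_term u x)\<^sup>2)"
  proof (rule Bochner_Integration.integrable_bound[where f="\<lambda>x. 2 * \<epsilon> * J x"])
    show "integrable tor2 (\<lambda>x. 2 * \<epsilon> * J x)" using JI by simp
    show "AE x in tor2. norm ((burgers_term u x)\<^sup>2) \<le> norm (2 * \<epsilon> * J x)"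
      using beq
    proof eventually_elim
      case (elim x)
      have "2 * \<epsilon> * J x = (p x - 1 / 2 * (w x)\<^sup>2)\<^sup>2 + \<epsilon>\<^sup>2 * (h x)\<^sup>2"
        using \<epsilon> by (simp add: J_def distrib_left power2_eq_square)
      moreover have "0 \<le> \<epsilon>\<^sup>2 * (h x)\<^sup>2" by simp
      ultimately have "(p x - 1 / 2 * (w x)\<^sup>2)\<^sup>2 \<le> \<bar>2 * \<epsilon> * J x\<bar>" by linarith
      thus ?case unfolding elim real_norm_def by (simp only: abs_of_nonneg zero_le_power2)
    qed
  qed measurable
  have bt: "burgers_term u \<in> L2_torus" by (rule burgers_term_L2_torusI[OF in_L2(1,2) bi])
  have "torus_energy \<epsilon> u = (\<integral>x. 1 / 2 * (1 / \<epsilon> * (burgers_term u x)\<^sup>2 + \<epsilon> * (weak_deriv [e1, e1] u x)\<^sup>2) \<partial>tor2)"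
    unfolding torus_energy_def by (simp only: integral_mult_right_zero)
  also have "\<dots> = (\<integral>x. J x \<partial>tor2)"
  proof (rule integral_cong_AE)
    show "AE x in tor2. 1 / 2 * (1 / \<epsilon> * (burgers_term u x)\<^sup>2 + \<epsilon> * (weak_deriv [e1, e1] u x)\<^sup>2) = J x"
      using beq eq11 by eventually_elim (simp only: J_def)
  qed measurable
  finally have "torus_energy \<epsilon> u \<le> m" using Jle by simp
  moreover have "uniform_limit UNIV (\<lambda>n. V (k n)) u sequentially" using Fu by (simp add: F_def[abs_def])
  ultimately show ?thesis using k u(2) W12 in_L2(3) bt by (intro exI[of _ k] exI[of _ u] conjI)
qed

section \<open>The admissible class and the constraint on slice means\<close>

lemma admissibleD:
  assumes "u \<in> admissible \<epsilon> g"
  shows "u \<in> W12_torus" "u \<in> L2_torus" "weak_deriv_in_L2 [e1, e1] u" "burgers_term u \<in> L2_torus"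
    and "energy \<epsilon> u = ennreal (torus_energy \<epsilon> u)"
    and "AE t in tor1. (\<integral>s. u (s, t) \<partial>tor1) = g t"
proof -
  have u: "u \<in> W12_torus" "energy \<epsilon> u < \<infinity>" 
    "AE x2 in lborel. x2 \<in> {0..<1} \<longrightarrow> (LINT x1:{0..<1}|lborel. u (x1, x2)) = g x2"
    using assms by (auto simp: admissible_def)
  show "u \<in> W12_torus" by (rule u(1))
  thus L2: "u \<in> L2_torus" by (simp add: W12_torus_def)
  show *: "weak_deriv_in_L2 [e1, e1] u" "burgers_term u \<in> L2_torus"
    using u(2) by (auto simp: energy_def split: if_splits)
  show "energy \<epsilon> u = ennreal (torus_energy \<epsilon> u)" by (rule energy_eq_torus_energy[OF *])
  have "(\<lambda>s. u (s, t)) \<in> borel_measurable borel" for t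
    by (rule measurable_compose[OF borel_measurable_continuous_onI L2_torusD(2)[OF L2]]) (intro continuous_intros)
  from set_integral_tor1[OF this] show "AE t in tor1. (\<integral>s. u (s, t) \<partial>tor1) = g t"
    unfolding AE_tor1 using u(3) by simp
qed

lemma admissibleI:
  assumes "u \<in> W12_torus" "weak_deriv_in_L2 [e1, e1] u" "burgers_term u \<in> L2_torus"
    and "AE t in tor1. (\<integral>s. u (s, t) \<partial>tor1) = g t"
  shows "u \<in> admissible \<epsilon> g"
proof -
  have L2: "u \<in> L2_torus" using assms(1) by (simp add: W12_torus_def)
  have "(\<lambda>s. u (s, t)) \<in> borel_measurable borel" for t
    by (rule measurable_compose[OF borel_measurable_continuous_onI L2_torusD(2)[OF L2]]) (intro continuous_intros)
  from set_integral_tor1[OF this]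
  have "AE x2 in lborel. x2 \<in> {0..<1} \<longrightarrow> (LINT x1:{0..<1}|lborel. u (x1, x2)) = g x2"
    using assms(4) unfolding AE_tor1 by simp
  thus ?thesis
    using assms(1) energy_eq_torus_energy[OF assms(2,3)] by (simp add: admissible_def)
qed

text \<open>Integration over the first variable is a contraction in L1. Measurability of
  \<open>g\<close> is not among the hypotheses, so the slice means of \<open>v 0\<close> stand in
  for it; for every \<open>n\<close> they agree almost everywhere with those of
  \<open>v n\<close>.\<close>

lemma slice_means_AE_eq:
  fixes u :: "real \<times> real \<Rightarrow> real" and v :: "nat \<Rightarrow> real \<times> real \<Rightarrow> real"
  assumes u: "integrable tor2 u" and v: "\<And>n. integrable tor2 (v n)"
    and lim: "(\<lambda>n. \<integral>x. \<bar>u x - v n x\<bar> \<partial>tor2) \<longlonglongrightarrow> 0"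
    and mean: "\<And>n. AE t in tor1. (\<integral>s. v n (s, t) \<partial>tor1) = g t"
  shows "AE t in tor1. (\<integral>s. u (s, t) \<partial>tor1) = g t"
proof -
  define d where "d t = (\<integral>s. u (s, t) \<partial>tor1) - (\<integral>s. v 0 (s, t) \<partial>tor1)" for t
  have di: "integrable tor1 (\<lambda>t. \<bar>d t\<bar>)"
    unfolding d_def by (intro integrable_abs Bochner_Integration.integrable_diff integral_tor2_iterated1(2) u v)
  have le: "(\<integral>t. \<bar>d t\<bar> \<partial>tor1) \<le> (\<integral>x. \<bar>u x - v n x\<bar> \<partial>tor2)" for n
  proof -
    have i: "integrable tor2 (\<lambda>x. \<bar>u x - v n x\<bar>)" by (intro integrable_abs Bochner_Integration.integrable_diff u v)
    have "(\<integral>t. \<bar>d t\<bar> \<partial>tor1) \<le> (\<integral>t. (\<integral>s. \<bar>u (s, t) - v n (s, t)\<bar> \<partial>tor1) \<partial>tor1)"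
    proof (rule integral_mono_AE[OF di])
      show "integrable tor1 (\<lambda>t. \<integral>s. \<bar>u (s, t) - v n (s, t)\<bar> \<partial>tor1)"
        using integral_tor2_iterated1(2)[OF i] .
      show "AE t in tor1. \<bar>d t\<bar> \<le> (\<integral>s. \<bar>u (s, t) - v n (s, t)\<bar> \<partial>tor1)"
        using mean[of 0] mean[of n] integral_tor2_iterated1(3)[OF u] integral_tor2_iterated1(3)[OF v[of n]]
      proof eventually_elim
        case (elim t)
        have "d t = (\<integral>s. u (s, t) - v n (s, t) \<partial>tor1)" using elim by (simp add: d_def)
        thus ?case by (simp only: integral_abs_bound)
      qed
    qed
    thus ?thesis using integral_tor2_iterated1(1)[OF i] by simp
  qed
  have "(\<integral>t. \<bar>d t\<bar> \<partial>tor1) \<le> 0"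
    by (rule LIMSEQ_le_const[OF lim]) (use le in blast)
  moreover have "0 \<le> (\<integral>t. \<bar>d t\<bar> \<partial>tor1)" by simp
  ultimately have "AE t in tor1. \<bar>d t\<bar> = 0"
    using integral_nonneg_eq_0_iff_AE[OF di] by simp
  thus ?thesis using mean[of 0] by eventually_elim (simp add: d_def)
qed

theorem corollary2p12:
  fixes \<epsilon> :: real and g :: "real \<Rightarrow> real"
  assumes "\<epsilon> > 0"
    and "periodic1 g"
    and "admissible \<epsilon> g \<noteq> {}"
  shows "\<exists>u\<^sub>\<epsilon> \<in> admissible \<epsilon> g. energy \<epsilon> u\<^sub>\<epsilon> = (INF u \<in> admissible \<epsilon> g. energy \<epsilon> u)"
proof -
  let ?A = "admissible \<epsilon> g"
  define m where "m = Inf (torus_energy \<epsilon> ` ?A)"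
  have nonneg: "0 \<le> torus_energy \<epsilon> v" for v
    using assms(1) by (simp add: torus_energy_def)
  have bdd: "bdd_below (torus_energy \<epsilon> ` ?A)" using nonneg by (intro bdd_belowI[of _ 0]) auto
  \<comment> \<open>The pair is kept together: \<open>U\<close> carries the estimates,
    \<open>v\<close> the constraint. One error term comes from near-minimality of \<open>v\<close>,
    the other from the approximation by \<open>U\<close>, which explains the factor 2.\<close>
  have ex: "\<exists>v U. v \<in> ?A \<and> U \<in> trig \<and> (\<integral>x. (U x - v x)\<^sup>2 \<partial>tor2) < inverse (real (Suc n))
     \<and> trig_energy \<epsilon> U \<le> m + 2 * inverse (real (Suc n))" for n
  proof -
    let ?\<delta> = "inverse (real (Suc n))"
    have "Inf (torus_energy \<epsilon> ` ?A) < m + ?\<delta>" by (simp add: m_def)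
    from cInf_lessD[OF _ this] assms(3) obtain v where v: "v \<in> ?A" "torus_energy \<epsilon> v < m + ?\<delta>" by auto
    obtain U where "U \<in> trig" "(\<integral>x. (U x - v x)\<^sup>2 \<partial>tor2) < ?\<delta>" "trig_energy \<epsilon> U < torus_energy \<epsilon> v + ?\<delta>"
      using trig_approximation[OF admissibleD(1,3,4)[OF v(1)], of ?\<delta> \<epsilon>] by auto
    thus ?thesis using v by (intro exI[of _ v] exI[of _ U]) auto
  qed
  from choice[OF allI[OF ex]] obtain v where
    "\<forall>n. \<exists>U. v n \<in> ?A \<and> U \<in> trig \<and> (\<integral>x. (U x - v n x)\<^sup>2 \<partial>tor2) < inverse (real (Suc n))
     \<and> trig_energy \<epsilon> U \<le> m + 2 * inverse (real (Suc n))" ..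
  from choice[OF this] obtain V where
    V: "\<forall>n. v n \<in> ?A \<and> V n \<in> trig \<and> (\<integral>x. (V n x - v n x)\<^sup>2 \<partial>tor2) < inverse (real (Suc n))
     \<and> trig_energy \<epsilon> (V n) \<le> m + 2 * inverse (real (Suc n))" ..
  have v: "v n \<in> ?A" and Vt: "V n \<in> trig" and Vv: "(\<integral>x. (V n x - v n x)\<^sup>2 \<partial>tor2) < inverse (real (Suc n))"
    and VE: "trig_energy \<epsilon> (V n) \<le> m + 2 * inverse (real (Suc n))" for n
    using V by auto
  note vL2 = L2_torusD[OF admissibleD(2)[OF v]]
  have vi: "integrable tor2 (v n)" for n using vL2(2,3) by (rule integrable_if_square_integrable)
  have Vi: "integrable tor2 (V n)" for n by (rule trig_integrable[OF Vt])
  have close: "(\<integral>x. \<bar>V n x - v n x\<bar> \<partial>tor2) \<le> sqrt (inverse (real (Suc n)))" for n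
  proof -
    have [measurable]: "v n \<in> borel_measurable borel" "V n \<in> borel_measurable borel" by (rule vL2(2), rule trig_measurable[OF Vt])
    have "(\<integral>x. \<bar>V n x - v n x\<bar> \<partial>tor2) \<le> sqrt (\<integral>x. (V n x - v n x)\<^sup>2 \<partial>tor2)"
      using vL2(3)[of n] trig_integrable[OF trig_power[OF Vt[of n], of 2]]
      by (intro integral_abs_le_square square_integrable_diff) auto
    also have "\<dots> \<le> sqrt (inverse (real (Suc n)))" by (intro real_sqrt_le_mono less_imp_le Vv)
    finally show ?thesis .
  qed
  \<comment> \<open>The constraint determines the integral over the torus. The reference is
    \<open>v 0\<close> and not \<open>g\<close>, because integrability is available for the slice
    means of \<open>v 0\<close>.\<close>
  have mean: "(\<integral>x. v n x \<partial>tor2) = (\<integral>x. v 0 x \<partial>tor2)" for n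
    unfolding integral_tor2_iterated1(1)[OF vi]
  proof (rule integral_cong_AE)
    show "(\<lambda>t. \<integral>s. v n (s, t) \<partial>tor1) \<in> borel_measurable tor1" for n
      by (rule borel_measurable_integrable[OF integral_tor2_iterated1(2)[OF vi]])
    thus "(\<lambda>t. \<integral>s. v 0 (s, t) \<partial>tor1) \<in> borel_measurable tor1" .
    show "AE t in tor1. (\<integral>s. v n (s, t) \<partial>tor1) = (\<integral>s. v 0 (s, t) \<partial>tor1)"
      using admissibleD(6)[OF v[of n]] admissibleD(6)[OF v[of 0]] by eventually_elim simp
  qed
  have L: "\<bar>\<integral>x. V n x \<partial>tor2\<bar> \<le> \<bar>\<integral>x. v 0 x \<partial>tor2\<bar> + 1" for n
  proof -
    have "(\<integral>x. V n x \<partial>tor2) = (\<integral>x. v 0 x \<partial>tor2) + (\<integral>x. V n x - v n x \<partial>tor2)"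
      using Vi[of n] vi[of n] mean[of n] by simp
    moreover have "\<bar>\<integral>x. V n x - v n x \<partial>tor2\<bar> \<le> (\<integral>x. \<bar>V n x - v n x\<bar> \<partial>tor2)" by (rule integral_abs_bound)
    moreover have "inverse (real (Suc n)) \<le> 1" by (simp add: inverse_le_1_iff)
    hence "sqrt (inverse (real (Suc n))) \<le> 1" by simp
    ultimately show ?thesis using close[of n] by linarith
  qed
  have "(\<lambda>n. m + 2 * inverse (real (Suc n))) \<longlonglongrightarrow> m + 2 * 0"
    by (intro tendsto_intros LIMSEQ_inverse_real_of_nat)
  hence "(\<lambda>n. m + 2 * inverse (real (Suc n))) \<longlonglongrightarrow> m" by simp
  from trig_energy_limit[of \<epsilon> V, OF assms(1) Vt VE this L] obtain k u where k: "strict_mono k"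
    and ul: "uniform_limit UNIV (\<lambda>n. V (k n)) u sequentially" and u: "continuous_on UNIV u" "u \<in> W12_torus"
      "weak_deriv_in_L2 [e1, e1] u" "burgers_term u \<in> L2_torus" and le: "torus_energy \<epsilon> u \<le> m"
    by (elim exE conjE)
  have ui: "integrable tor2 u" by (rule integrable_tor2_continuous[OF u(1)])
  \<comment> \<open>\<open>V (k n)\<close> is close to \<open>u\<close> uniformly and to
    \<open>v (k n)\<close> in L1, so the admissible partners converge to \<open>u\<close> in L1 and
    hand the constraint over to it.\<close>
  have lim0: "(\<lambda>n. \<integral>x. \<bar>u x - v (k n) x\<bar> \<partial>tor2) \<longlonglongrightarrow> 0"
  proof (rule LIMSEQ_I)
    fix e :: real assume e: "e > 0"
    have "(\<lambda>n. sqrt (inverse (real (Suc n)))) \<longlonglongrightarrow> sqrt 0"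
      by (intro tendsto_real_sqrt LIMSEQ_inverse_real_of_nat)
    hence "(\<lambda>n. sqrt (inverse (real (Suc n)))) \<longlonglongrightarrow> 0" by simp
    from LIMSEQ_subseq_LIMSEQ[OF this k] have "(\<lambda>n. sqrt (inverse (real (Suc (k n))))) \<longlonglongrightarrow> 0" by (simp add: o_def)
    hence ev1: "\<forall>\<^sub>F n in sequentially. sqrt (inverse (real (Suc (k n)))) < e / 2"
      by (rule order_tendstoD(2)) (use e in simp)
    have ev2: "\<forall>\<^sub>F n in sequentially. \<forall>x\<in>UNIV. dist (V (k n) x) (u x) < e / 2"
      by (rule uniform_limitD[OF ul]) (use e in simp)
    have "\<forall>\<^sub>F n in sequentially. norm ((\<integral>x. \<bar>u x - v (k n) x\<bar> \<partial>tor2) - 0) < e"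
      using ev1 ev2
    proof eventually_elim
      case (elim n)
      have "(\<integral>x. \<bar>u x - v (k n) x\<bar> \<partial>tor2) \<le> (\<integral>x. e / 2 + \<bar>V (k n) x - v (k n) x\<bar> \<partial>tor2)"
      proof (intro integral_mono integrable_abs Bochner_Integration.integrable_add Bochner_Integration.integrable_diff ui vi Vi)
        fix x
        have "\<bar>V (k n) x - u x\<bar> < e / 2" using bspec[OF elim(2), of x] by (simp add: dist_real_def)
        thus "\<bar>u x - v (k n) x\<bar> \<le> e / 2 + \<bar>V (k n) x - v (k n) x\<bar>" by linarith
      qed simp
      also have "\<dots> = e / 2 + (\<integral>x. \<bar>V (k n) x - v (k n) x\<bar> \<partial>tor2)"
        using integrable_abs[OF Bochner_Integration.integrable_diff[OF Vi[of "k n"] vi[of "k n"]]] by simp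
      also have "\<dots> < e" using close[of "k n"] elim(1) by linarith
      finally show ?case by simp
    qed
    thus "\<exists>no. \<forall>n\<ge>no. norm ((\<integral>x. \<bar>u x - v (k n) x\<bar> \<partial>tor2) - 0) < e"
      by (simp only: eventually_sequentially)
  qed
  have "AE t in tor1. (\<integral>s. u (s, t) \<partial>tor1) = g t"
    by (rule slice_means_AE_eq[OF ui vi lim0 admissibleD(6)[OF v]])
  hence uA: "u \<in> ?A" by (rule admissibleI[OF u(2-4)])
  show ?thesis
  proof (intro bexI[OF _ uA] antisym)
    show "energy \<epsilon> u \<le> (INF v \<in> ?A. energy \<epsilon> v)"
    proof (rule INF_greatest)
      fix w assume w: "w \<in> ?A"
      have "m \<le> torus_energy \<epsilon> w" unfolding m_def using w bdd by (intro cInf_lower) auto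
      thus "energy \<epsilon> u \<le> energy \<epsilon> w"
        unfolding admissibleD(5)[OF uA] admissibleD(5)[OF w] using le by (intro ennreal_leI) simp
    qed
    show "(INF v \<in> ?A. energy \<epsilon> v) \<le> energy \<epsilon> u" by (rule INF_lower[OF uA])
  qed
qed

end
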